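(* Let $k$ be an algebraically closed field and let $\mathcal{C}$ be a $k$-linear Hom-finite, 2-Calabi--Yau triangulated category with split idempotents and with a cluster-tilting object $T$. Let $F=\mathcal{C}(T,?)$. Let $L,M\in\mathcal{C}$ be such that $\dim_k\mathcal{C}(L,\Sigma M)=1$, and let $$\Delta:\ M\xrightarrow{i}B\xrightarrow{p}L\xrightarrow{\varepsilon}\Sigma M,\qquad \Delta':\ L\xrightarrow{i'}B'\xrightarrow{p'}M\xrightarrow{\varepsilon'}\Sigma L$$ be non-split triangles. Let $i_U:U\to M$ and $i_V:V\to L$ be two morphisms of $\mathcal{C}$ whose images under $F$ are monomorphisms. Then the equivalent conditions (i)--(iii) (listed in the context) hold for the triangle $\Delta$ and the pair $(i_U,i_V)$ if and only if they do not hold for the triangle $\Delta'$ and the pair $(i_V,i_U)$. In particular, in terms of condition (i): there is a submodule $E\subset FB$ with $(Fp)E=FV$ and $(Fi)^{-1}E=FU$ if and only if there is no submodule $E'\subset FB'$ with $(Fp')E'=FU$ and $(Fi')^{-1}E'=FV$.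
   Context: $\Sigma$ is the suspension functor of $\mathcal{C}$ and $D=\operatorname{Hom}_k(?,k)$. Hom-finite: all spaces $\mathcal{C}(X,Y)$ are finite-dimensional. 2-Calabi--Yau: there are bifunctorial isomorphisms $\mathcal{C}(X,\Sigma Y)\simeq D\mathcal{C}(Y,\Sigma X)$. Cluster-tilting: $\mathcal{C}(T,\Sigma T)=0$, and any $X$ with $\mathcal{C}(X,\Sigma T)=0$ belongs to $\operatorname{add}T$, the full subcategory of direct summands of finite direct sums of copies of $T$. $F=\mathcal{C}(T,?)$ takes values in $\operatorname{mod}\operatorname{End}_{\mathcal{C}}(T)$, the category of finite-dimensional right modules. $(T)$ (resp. $(\Sigma T)$) is the ideal of morphisms of $\mathcal{C}$ factoring through an object of $\operatorname{add}T$ (resp. $\operatorname{add}\Sigma T$). Conditions: for a triangle $M\xrightarrow{i}B\xrightarrow{p}L\xrightarrow{\varepsilon}\Sigma M$ and morphisms $i_U:U\to M$, $i_V:V\to L$ with $Fi_U,Fi_V$ monomorphisms (by which $FU$, $FV$ are viewed as submodules of $FM$, $FL$), the following three conditions are equivalent: (i) there exists a submodule $E\subset FB$ such that $FV=(Fp)E$ and $FU=(Fi)^{-1}E$; (ii) there exist morphisms $e:\Sigma^{-1}V\to U$ and $f:\Sigma^{-1}L\to U$ such that (a) $(\Sigma^{-1}\varepsilon)(\Sigma^{-1}i_V)=i_Ue$, (b) $e\in(T)$, (c) $i_Uf-\Sigma^{-1}\varepsilon\in(\Sigma T)$; (iii) condition (ii) holds with, moreover, $e=f\,\Sigma^{-1}i_V$.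 The conditions for $\Delta'$ and $(i_V,i_U)$ are obtained by exchanging the roles: $M\leftrightarrow L$, $U\leftrightarrow V$, and $(B,i,p,\varepsilon)$ replaced by $(B',i',p',\varepsilon')$. *)

theory Defs
  imports "HOL-Computational_Algebra.Polynomial" "HOL-Library.FuncSet"
begin

section \<open>Linear categories\<close>

text \<open>
  The Hom-spaces of a \<open>k\<close>-linear category are subspaces of one ambient \<open>k\<close>-vector space \<open>'m\<close>.
  This loses no generality: for \<open>'m\<close> one may take the direct sum of all Hom-spaces. Hom-spaces
  for different pairs of objects may overlap (they always share \<open>0\<close>), and nothing is assumed about
  composites of non-composable arrows. The composite \<open>g \<cdot> f\<close> is ``first \<open>f\<close>, then \<open>g\<close>''.
\<close>

record ('k, 'o, 'm) linear_category_data =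
  scale :: "'k \<Rightarrow> 'm \<Rightarrow> 'm"
  Ob :: "'o set"
  hom :: "'o \<Rightarrow> 'o \<Rightarrow> 'm set"
  ident :: "'o \<Rightarrow> 'm"
  cmp :: "'m \<Rightarrow> 'm \<Rightarrow> 'm"  (infixr "\<cdot>\<index>" 70)

locale linear_category = vector_space "scale C"
  for C :: "('k::field, 'o, 'm::ab_group_add, 'z) linear_category_data_scheme" (structure) +
  assumes hom_subspace: "\<lbrakk>X \<in> Ob C; Y \<in> Ob C\<rbrakk> \<Longrightarrow> subspace (hom C X Y)"
    and ident_in_hom: "X \<in> Ob C \<Longrightarrow> ident C X \<in> hom C X X"
    and cmp_in_hom: "\<lbrakk>X \<in> Ob C; Y \<in> Ob C; Z \<in> Ob C; f \<in> hom C X Y; g \<in> hom C Y Z\<rbrakk>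
      \<Longrightarrow> g \<cdot> f \<in> hom C X Z"
    and cmp_ident_right: "\<lbrakk>X \<in> Ob C; Y \<in> Ob C; f \<in> hom C X Y\<rbrakk> \<Longrightarrow> f \<cdot> ident C X = f"
    and cmp_ident_left: "\<lbrakk>X \<in> Ob C; Y \<in> Ob C; f \<in> hom C X Y\<rbrakk> \<Longrightarrow> ident C Y \<cdot> f = f"
    and cmp_assoc: "\<lbrakk>W \<in> Ob C; X \<in> Ob C; Y \<in> Ob C; Z \<in> Ob C;
        f \<in> hom C W X; g \<in> hom C X Y; h \<in> hom C Y Z\<rbrakk> \<Longrightarrow> (h \<cdot> g) \<cdot> f = h \<cdot> (g \<cdot> f)"
    and cmp_add_left: "\<lbrakk>X \<in> Ob C; Y \<in> Ob C; Z \<in> Ob C;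
        f \<in> hom C X Y; g \<in> hom C Y Z; g' \<in> hom C Y Z\<rbrakk> \<Longrightarrow> (g + g') \<cdot> f = g \<cdot> f + g' \<cdot> f"
    and cmp_add_right: "\<lbrakk>X \<in> Ob C; Y \<in> Ob C; Z \<in> Ob C;
        f \<in> hom C X Y; f' \<in> hom C X Y; g \<in> hom C Y Z\<rbrakk> \<Longrightarrow> g \<cdot> (f + f') = g \<cdot> f + g \<cdot> f'"
    and cmp_scale_left: "\<lbrakk>X \<in> Ob C; Y \<in> Ob C; Z \<in> Ob C; f \<in> hom C X Y; g \<in> hom C Y Z\<rbrakk>
      \<Longrightarrow> scale C a g \<cdot> f = scale C a (g \<cdot> f)"
    and cmp_scale_right: "\<lbrakk>X \<in> Ob C; Y \<in> Ob C; Z \<in> Ob C; f \<in> hom C X Y; g \<in> hom C Y Z\<rbrakk>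
      \<Longrightarrow> g \<cdot> scale C a f = scale C a (g \<cdot> f)"

definition iso_arrow ::
  "('k, 'o, 'm, 'z) linear_category_data_scheme \<Rightarrow> 'o \<Rightarrow> 'o \<Rightarrow> 'm \<Rightarrow> bool" where
  "iso_arrow C X Y f \<longleftrightarrow> f \<in> hom C X Y \<and>
     (\<exists>g \<in> hom C Y X. cmp C g f = ident C X \<and> cmp C f g = ident C Y)"

definition zero_object ::
  "('k, 'o, 'm::ab_group_add, 'z) linear_category_data_scheme \<Rightarrow> 'o \<Rightarrow> bool" where
  "zero_object C Z \<longleftrightarrow> Z \<in> Ob C \<and> (\<forall>X \<in> Ob C. hom C X Z = {0} \<and> hom C Z X = {0})"

text \<open>\<open>P\<close> with injections \<open>\<iota>\<close> and projections \<open>\<pi>\<close> is the direct sum of a finite list of objects.\<close>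

definition direct_sum_via ::
  "('k, 'o, 'm::ab_group_add, 'z) linear_category_data_scheme
    \<Rightarrow> 'o list \<Rightarrow> 'o \<Rightarrow> (nat \<Rightarrow> 'm) \<Rightarrow> (nat \<Rightarrow> 'm) \<Rightarrow> bool" where
  "direct_sum_via C Xs P \<iota> \<pi> \<longleftrightarrow>
     (\<forall>j < length Xs. \<iota> j \<in> hom C (Xs ! j) P \<and> \<pi> j \<in> hom C P (Xs ! j)) \<and>
     (\<forall>j < length Xs. \<forall>l < length Xs.
        cmp C (\<pi> l) (\<iota> j) = (if j = l then ident C (Xs ! j) else 0)) \<and>
     (\<Sum>j < length Xs. cmp C (\<iota> j) (\<pi> j)) = ident C P"

definition direct_sum ::
  "('k, 'o, 'm::ab_group_add, 'z) linear_category_data_scheme \<Rightarrow> 'o list \<Rightarrow> 'o \<Rightarrow> bool" where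
  "direct_sum C Xs P \<longleftrightarrow> P \<in> Ob C \<and> (\<exists>\<iota> \<pi>. direct_sum_via C Xs P \<iota> \<pi>)"

definition direct_summand ::
  "('k, 'o, 'm::ab_group_add, 'z) linear_category_data_scheme \<Rightarrow> 'o \<Rightarrow> 'o \<Rightarrow> bool" where
  "direct_summand C X P \<longleftrightarrow> X \<in> Ob C \<and> (\<exists>X' \<in> Ob C. direct_sum C [X, X'] P)"

definition add_closure ::
  "('k, 'o, 'm::ab_group_add, 'z) linear_category_data_scheme \<Rightarrow> 'o \<Rightarrow> 'o set" where
  "add_closure C T = {X. \<exists>n P. direct_sum C (replicate n T) P \<and> direct_summand C X P}"

text \<open>The arrows \<open>X \<rightarrow> Y\<close> in the ideal \<open>(T)\<close>.\<close>

definition ideal_of ::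
  "('k, 'o, 'm::ab_group_add, 'z) linear_category_data_scheme \<Rightarrow> 'o \<Rightarrow> 'o \<Rightarrow> 'o \<Rightarrow> 'm set" where
  "ideal_of C T X Y =
     {cmp C h g | g h A. A \<in> add_closure C T \<and> g \<in> hom C X A \<and> h \<in> hom C A Y}"

definition split_idempotents ::
  "('k, 'o, 'm, 'z) linear_category_data_scheme \<Rightarrow> bool" where
  "split_idempotents C \<longleftrightarrow>
     (\<forall>X \<in> Ob C. \<forall>e \<in> hom C X X. cmp C e e = e \<longrightarrow>
        (\<exists>Y \<in> Ob C. \<exists>r \<in> hom C X Y. \<exists>s \<in> hom C Y X.
           cmp C s r = e \<and> cmp C r s = ident C Y))"

definition hom_finite ::
  "('k::field, 'o, 'm::ab_group_add, 'z) linear_category_data_scheme \<Rightarrow> bool" where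
  "hom_finite C \<longleftrightarrow>
     (\<forall>X \<in> Ob C. \<forall>Y \<in> Ob C. \<exists>B. finite B \<and> module.span (scale C) B = hom C X Y)"

locale additive_category = linear_category +
  assumes zero_object_exists: "\<exists>Z. zero_object C Z"
    and direct_sum_exists: "\<lbrakk>X \<in> Ob C; Y \<in> Ob C\<rbrakk> \<Longrightarrow> \<exists>P. direct_sum C [X, Y] P"


section \<open>Triangulated categories\<close>

text \<open>
  The suspension is a \<open>k\<close>-linear autoequivalence. It comes with a quasi-inverse
  (\<open>desusp_ob\<close>, \<open>desusp\<close>), and with isomorphisms
  \<open>desusp_unit X : \<Sigma>\<^sup>-\<^sup>1 \<Sigma> X \<rightarrow> X\<close> and \<open>susp_unit X : \<Sigma> \<Sigma>\<^sup>-\<^sup>1 X \<rightarrow> X\<close>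
  natural in \<open>X\<close>. If the suspension is an automorphism, these can be taken to be identities.
  The predicate \<open>tri C X Y Z f g h\<close> says that \<open>X \<rightarrow> Y \<rightarrow> Z \<rightarrow> \<Sigma> X\<close> is a distinguished triangle.
\<close>

record ('k, 'o, 'm) triangulated_data = "('k, 'o, 'm) linear_category_data" +
  susp_ob :: "'o \<Rightarrow> 'o"
  susp :: "'m \<Rightarrow> 'm"
  desusp_ob :: "'o \<Rightarrow> 'o"
  desusp :: "'m \<Rightarrow> 'm"
  desusp_unit :: "'o \<Rightarrow> 'm"
  susp_unit :: "'o \<Rightarrow> 'm"
  tri :: "'o \<Rightarrow> 'o \<Rightarrow> 'o \<Rightarrow> 'm \<Rightarrow> 'm \<Rightarrow> 'm \<Rightarrow> bool"

definition linear_endofunctor ::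
  "('k, 'o, 'm::ab_group_add, 'z) linear_category_data_scheme
    \<Rightarrow> ('o \<Rightarrow> 'o) \<Rightarrow> ('m \<Rightarrow> 'm) \<Rightarrow> bool" where
  "linear_endofunctor C G\<^sub>0 G \<longleftrightarrow>
     (\<forall>X \<in> Ob C. G\<^sub>0 X \<in> Ob C \<and> G (ident C X) = ident C (G\<^sub>0 X)) \<and>
     (\<forall>X \<in> Ob C. \<forall>Y \<in> Ob C. \<forall>f \<in> hom C X Y. G f \<in> hom C (G\<^sub>0 X) (G\<^sub>0 Y)) \<and>
     (\<forall>X \<in> Ob C. \<forall>Y \<in> Ob C. \<forall>Z \<in> Ob C. \<forall>f \<in> hom C X Y. \<forall>g \<in> hom C Y Z.
        G (cmp C g f) = cmp C (G g) (G f)) \<and>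
     (\<forall>X \<in> Ob C. \<forall>Y \<in> Ob C. \<forall>f \<in> hom C X Y. \<forall>g \<in> hom C X Y. G (f + g) = G f + G g) \<and>
     (\<forall>X \<in> Ob C. \<forall>Y \<in> Ob C. \<forall>f \<in> hom C X Y. \<forall>a. G (scale C a f) = scale C a (G f))"

definition natural_iso_to_identity ::
  "('k, 'o, 'm, 'z) linear_category_data_scheme
    \<Rightarrow> ('o \<Rightarrow> 'o) \<Rightarrow> ('m \<Rightarrow> 'm) \<Rightarrow> ('o \<Rightarrow> 'm) \<Rightarrow> bool" where
  "natural_iso_to_identity C G\<^sub>0 G \<eta> \<longleftrightarrow>
     (\<forall>X \<in> Ob C. iso_arrow C (G\<^sub>0 X) X (\<eta> X)) \<and>
     (\<forall>X \<in> Ob C. \<forall>Y \<in> Ob C. \<forall>f \<in> hom C X Y. cmp C (\<eta> Y) (G f) = cmp C f (\<eta> X))"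

locale triangulated_category = additive_category C
  for C :: "('k::field, 'o, 'm::ab_group_add, 'z) triangulated_data_scheme" (structure) +
  assumes susp_functor: "linear_endofunctor C (susp_ob C) (susp C)"
    and desusp_functor: "linear_endofunctor C (desusp_ob C) (desusp C)"
    and desusp_susp: "natural_iso_to_identity C
        (\<lambda>X. desusp_ob C (susp_ob C X)) (\<lambda>f. desusp C (susp C f)) (desusp_unit C)"
    and susp_desusp: "natural_iso_to_identity C
        (\<lambda>X. susp_ob C (desusp_ob C X)) (\<lambda>f. susp C (desusp C f)) (susp_unit C)"
    and tri_type: "tri C X Y Z f g h \<Longrightarrow> X \<in> Ob C \<and> Y \<in> Ob C \<and> Z \<in> Ob C \<and>
        f \<in> hom C X Y \<and> g \<in> hom C Y Z \<and> h \<in> hom C Z (susp_ob C X)"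
    and tri_iso: "\<lbrakk>tri C X Y Z f g h; X' \<in> Ob C; Y' \<in> Ob C; Z' \<in> Ob C;
        f' \<in> hom C X' Y'; g' \<in> hom C Y' Z'; h' \<in> hom C Z' (susp_ob C X');
        iso_arrow C X X' a; iso_arrow C Y Y' b; iso_arrow C Z Z' c;
        b \<cdot> f = f' \<cdot> a; c \<cdot> g = g' \<cdot> b; susp C a \<cdot> h = h' \<cdot> c\<rbrakk>
      \<Longrightarrow> tri C X' Y' Z' f' g' h'"
    and tri_ident: "\<lbrakk>X \<in> Ob C; zero_object C Z\<rbrakk> \<Longrightarrow> tri C X X Z (ident C X) 0 0"
    and tri_exists: "\<lbrakk>X \<in> Ob C; Y \<in> Ob C; f \<in> hom C X Y\<rbrakk> \<Longrightarrow> \<exists>Z g h. tri C X Y Z f g h"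
    and tri_rotate: "\<lbrakk>X \<in> Ob C; Y \<in> Ob C; Z \<in> Ob C;
        f \<in> hom C X Y; g \<in> hom C Y Z; h \<in> hom C Z (susp_ob C X)\<rbrakk>
      \<Longrightarrow> tri C X Y Z f g h \<longleftrightarrow> tri C Y Z (susp_ob C X) g h (- susp C f)"
    and tri_morphism: "\<lbrakk>tri C X Y Z f g h; tri C X' Y' Z' f' g' h';
        a \<in> hom C X X'; b \<in> hom C Y Y'; b \<cdot> f = f' \<cdot> a\<rbrakk>
      \<Longrightarrow> \<exists>c \<in> hom C Z Z'. c \<cdot> g = g' \<cdot> b \<and> susp C a \<cdot> h = h' \<cdot> c"
    and tri_octahedron: "\<lbrakk>tri C X Y Z' f a b; tri C Y Z X' g c d; tri C X Z Y' (g \<cdot> f) p q\<rbrakk>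
      \<Longrightarrow> \<exists>u v. tri C Z' Y' X' u v (susp C a \<cdot> d) \<and>
            u \<cdot> a = p \<cdot> g \<and> q \<cdot> u = b \<and> v \<cdot> p = c \<and> d \<cdot> v = susp C f \<cdot> q"

text \<open>
  A split triangle is one whose first two arrows are the canonical injection \<open>\<iota> 0\<close> and projection
  \<open>\<pi> 1\<close> of a direct sum of its end terms (the third arrow is then \<open>0\<close>).
\<close>

definition split_triangle ::
  "('k, 'o, 'm::ab_group_add, 'z) triangulated_data_scheme
    \<Rightarrow> 'o \<Rightarrow> 'o \<Rightarrow> 'o \<Rightarrow> 'm \<Rightarrow> 'm \<Rightarrow> 'm \<Rightarrow> bool" where
  "split_triangle C X Y Z f g h \<longleftrightarrow> tri C X Y Z f g h \<and>
     (\<exists>\<iota> \<pi>. direct_sum_via C [X, Z] Y \<iota> \<pi> \<and> \<iota> 0 = f \<and> \<pi> 1 = g)"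

text \<open>
  The dual of a subspace \<open>V\<close> of the ambient space: linear forms defined on \<open>V\<close> only, made
  extensional so that they are determined by their values on \<open>V\<close>.
\<close>

definition dual_space :: "('k::field \<Rightarrow> 'm::ab_group_add \<Rightarrow> 'm) \<Rightarrow> 'm set \<Rightarrow> ('m \<Rightarrow> 'k) set" where
  "dual_space sc V = {\<phi> \<in> extensional V.
     (\<forall>x \<in> V. \<forall>y \<in> V. \<phi> (x + y) = \<phi> x + \<phi> y) \<and> (\<forall>a. \<forall>x \<in> V. \<phi> (sc a x) = a * \<phi> x)}"

text \<open>
  The map \<open>\<Phi> X Y : C(X, \<Sigma> Y) \<rightarrow> D C(Y, \<Sigma> X)\<close> is a \<open>k\<close>-linear bijection; the last
  clause is naturality along \<open>u : X' \<rightarrow> X\<close> and \<open>v : Y \<rightarrow> Y'\<close>.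
\<close>

definition calabi_yau_2 ::
  "('k::field, 'o, 'm::ab_group_add, 'z) triangulated_data_scheme \<Rightarrow> bool" where
  "calabi_yau_2 C \<longleftrightarrow> (\<exists>\<Phi>.
     (\<forall>X \<in> Ob C. \<forall>Y \<in> Ob C.
        bij_betw (\<Phi> X Y) (hom C X (susp_ob C Y)) (dual_space (scale C) (hom C Y (susp_ob C X))) \<and>
        (\<forall>g \<in> hom C X (susp_ob C Y). \<forall>h \<in> hom C Y (susp_ob C X).
           (\<forall>g' \<in> hom C X (susp_ob C Y). \<Phi> X Y (g + g') h = \<Phi> X Y g h + \<Phi> X Y g' h) \<and>
           (\<forall>a. \<Phi> X Y (scale C a g) h = a * \<Phi> X Y g h))) \<and>
     (\<forall>X \<in> Ob C. \<forall>X' \<in> Ob C. \<forall>Y \<in> Ob C. \<forall>Y' \<in> Ob C.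
        \<forall>u \<in> hom C X' X. \<forall>v \<in> hom C Y Y'.
        \<forall>g \<in> hom C X (susp_ob C Y). \<forall>h \<in> hom C Y' (susp_ob C X').
          \<Phi> X' Y' (cmp C (susp C v) (cmp C g u)) h = \<Phi> X Y g (cmp C (susp C u) (cmp C h v))))"

definition cluster_tilting ::
  "('k, 'o, 'm::ab_group_add, 'z) triangulated_data_scheme \<Rightarrow> 'o \<Rightarrow> bool" where
  "cluster_tilting C T \<longleftrightarrow> T \<in> Ob C \<and> hom C T (susp_ob C T) = {0} \<and>
     (\<forall>X \<in> Ob C. hom C X (susp_ob C T) = {0} \<longrightarrow> X \<in> add_closure C T)"


section \<open>The functor \<open>F = C(T, ?)\<close> and the three conditions\<close>

text \<open>
  \<open>F\<^sub>0 C T X\<close> is a right module over \<open>End T = C(T, T)\<close>, where \<open>a\<close> acts by \<open>x \<mapsto> x \<cdot> a\<close>.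
\<close>

definition F\<^sub>0 :: "('k, 'o, 'm, 'z) linear_category_data_scheme \<Rightarrow> 'o \<Rightarrow> 'o \<Rightarrow> 'm set" where
  "F\<^sub>0 C T X = hom C T X"

definition F\<^sub>1 :: "('k, 'o, 'm, 'z) linear_category_data_scheme \<Rightarrow> 'm \<Rightarrow> 'm \<Rightarrow> 'm" where
  "F\<^sub>1 C f = (\<lambda>x. cmp C f x)"

definition F_submodule ::
  "('k::field, 'o, 'm::ab_group_add, 'z) linear_category_data_scheme
    \<Rightarrow> 'o \<Rightarrow> 'o \<Rightarrow> 'm set \<Rightarrow> bool" where
  "F_submodule C T X E \<longleftrightarrow> E \<subseteq> F\<^sub>0 C T X \<and> module.subspace (scale C) E \<and>
     (\<forall>x \<in> E. \<forall>a \<in> hom C T T. cmp C x a \<in> E)"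

definition F_mono ::
  "('k, 'o, 'm, 'z) linear_category_data_scheme \<Rightarrow> 'o \<Rightarrow> 'o \<Rightarrow> 'm \<Rightarrow> bool" where
  "F_mono C T X f \<longleftrightarrow> inj_on (F\<^sub>1 C f) (F\<^sub>0 C T X)"

text \<open>
  Conditions for a triangle with arrows \<open>i : M \<rightarrow> B\<close>, \<open>p : B \<rightarrow> L\<close>, \<open>\<epsilon> : L \<rightarrow> \<Sigma> M\<close> and arrows
  \<open>iU : U \<rightarrow> M\<close>, \<open>iV : V \<rightarrow> L\<close>. In \<open>condition_i\<close>, the submodules \<open>FU\<close> of \<open>FM\<close> and \<open>FV\<close> of \<open>FL\<close>
  are the images of \<open>F iU\<close> and \<open>F iV\<close>.
\<close>

definition condition_i ::
  "('k::field, 'o, 'm::ab_group_add, 'z) triangulated_data_scheme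
    \<Rightarrow> 'o \<Rightarrow> 'o \<Rightarrow> 'o \<Rightarrow> 'o \<Rightarrow> 'm \<Rightarrow> 'm \<Rightarrow> 'm \<Rightarrow> 'o \<Rightarrow> 'o \<Rightarrow> 'm \<Rightarrow> 'm \<Rightarrow> bool" where
  "condition_i C T M B L i p \<epsilon> U V iU iV \<longleftrightarrow>
     (\<exists>E. F_submodule C T B E \<and>
        F\<^sub>1 C iV ` F\<^sub>0 C T V = F\<^sub>1 C p ` E \<and>
        F\<^sub>1 C iU ` F\<^sub>0 C T U = {x \<in> F\<^sub>0 C T M. F\<^sub>1 C i x \<in> E})"

text \<open>\<open>desusp_to C M \<epsilon>\<close> is \<open>\<Sigma>\<^sup>-\<^sup>1 \<epsilon>\<close> with its codomain \<open>\<Sigma>\<^sup>-\<^sup>1 \<Sigma> M\<close> identified with \<open>M\<close>.\<close>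

definition desusp_to ::
  "('k, 'o, 'm, 'z) triangulated_data_scheme \<Rightarrow> 'o \<Rightarrow> 'm \<Rightarrow> 'm" where
  "desusp_to C M \<epsilon> = cmp C (desusp_unit C M) (desusp C \<epsilon>)"

definition condition_ii_for ::
  "('k, 'o, 'm::ab_group_add, 'z) triangulated_data_scheme
    \<Rightarrow> 'o \<Rightarrow> 'o \<Rightarrow> 'o \<Rightarrow> 'm \<Rightarrow> 'o \<Rightarrow> 'o \<Rightarrow> 'm \<Rightarrow> 'm \<Rightarrow> 'm \<Rightarrow> 'm \<Rightarrow> bool" where
  "condition_ii_for C T M L \<epsilon> U V iU iV e f \<longleftrightarrow>
     e \<in> hom C (desusp_ob C V) U \<and> f \<in> hom C (desusp_ob C L) U \<and>
     cmp C (desusp_to C M \<epsilon>) (desusp C iV) = cmp C iU e \<and>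
     e \<in> ideal_of C T (desusp_ob C V) U \<and>
     cmp C iU f - desusp_to C M \<epsilon> \<in> ideal_of C (susp_ob C T) (desusp_ob C L) M"

definition condition_ii ::
  "('k, 'o, 'm::ab_group_add, 'z) triangulated_data_scheme
    \<Rightarrow> 'o \<Rightarrow> 'o \<Rightarrow> 'o \<Rightarrow> 'o \<Rightarrow> 'm \<Rightarrow> 'm \<Rightarrow> 'm \<Rightarrow> 'o \<Rightarrow> 'o \<Rightarrow> 'm \<Rightarrow> 'm \<Rightarrow> bool" where
  "condition_ii C T M B L i p \<epsilon> U V iU iV \<longleftrightarrow>
     (\<exists>e f. condition_ii_for C T M L \<epsilon> U V iU iV e f)"

definition condition_iii ::
  "('k, 'o, 'm::ab_group_add, 'z) triangulated_data_scheme
    \<Rightarrow> 'o \<Rightarrow> 'o \<Rightarrow> 'o \<Rightarrow> 'o \<Rightarrow> 'm \<Rightarrow> 'm \<Rightarrow> 'm \<Rightarrow> 'o \<Rightarrow> 'o \<Rightarrow> 'm \<Rightarrow> 'm \<Rightarrow> bool" where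
  "condition_iii C T M B L i p \<epsilon> U V iU iV \<longleftrightarrow>
     (\<exists>e f. condition_ii_for C T M L \<epsilon> U V iU iV e f \<and> e = cmp C f (desusp C iV))"

end

theory Submission
  imports Defs "HOL-Library.Product_Plus"
begin

text \<open>
  Write arrows \<open>\<Sigma>\<^sup>-\<^sup>1 X \<rightarrow> Y\<close> as arrows \<open>X \<rightarrow> \<Sigma> Y\<close>. Approximation triangles by \<open>add T\<close> turn membership
  in the ideals \<open>(T)\<close> and \<open>(\<Sigma> T)\<close> into vanishing on all arrows from \<open>T\<close>, respectively \<open>\<Sigma> T\<close> (being a
  ghost), and under the Calabi--Yau pairing the ghosts \<open>X \<rightarrow> \<Sigma> Y\<close> and the ghosts \<open>Y \<rightarrow> \<Sigma> X\<close> are mutual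
  annihilators. Condition (iii) for \<open>\<Delta>\<close> says that some \<open>(\<phi>, \<eta>)\<close> with \<open>\<eta> \<noteq> 0\<close> lies in the kernel of a
  linear map \<open>\<alpha>\<close>, because \<open>\<epsilon>\<close> spans \<open>C(L, \<Sigma> M)\<close>; condition (ii) for \<open>\<Delta>'\<close> says that \<open>(0, \<epsilon>')\<close> lies in the
  image of the transpose of \<open>\<alpha>\<close>. Exactly one of the two happens, since the annihilator of that image
  is the kernel of \<open>\<alpha>\<close>.
\<close>

section \<open>Arrows of linear categories\<close>

text \<open>Conditions (ii) and (iii) play different roles. In (iii) the arrow \<open>e\<close> is
  determined by \<open>f\<close>, so after replacing \<epsilon> by a variable \<eta> the condition
  is linear in the pair and suits a kernel; in (ii) \<open>e\<close> and \<open>f\<close> are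
  independent, which suits an image. The dichotomy is therefore proved between (iii) for one
  triangle and (ii) for the other. Passing from (ii) to (iii), which takes an extension argument
  along \<open>iV\<close>, restores the symmetry of the statement.

  The separating functional yields some \<eta> in C(L, \<Sigma> M), not \<epsilon> itself.
  One-dimensionality makes \<eta> a multiple of \<epsilon>, the pairing with \<epsilon>' shows that
  the multiple is nonzero, and dividing by it gives the lifting. This duality argument makes no
  dimension count: separating a vector from a subspace and representing functionals by the pairing
  are enough.\<close>

context linear_category
begin

text \<open>Membership carries the object conditions, so that a single fact discharges all typing
  premises and the rules below chain by \<open>OF\<close>. The set is empty if \<open>X\<close> or
  \<open>Y\<close> is not an object.\<close>

definition Hom :: "'o \<Rightarrow> 'o \<Rightarrow> 'm set" where
  "Hom X Y = {f \<in> hom C X Y. X \<in> Ob C \<and> Y \<in> Ob C}"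

lemma Hom_eq_hom: "\<lbrakk>X \<in> Ob C; Y \<in> Ob C\<rbrakk> \<Longrightarrow> Hom X Y = hom C X Y"
  by (auto simp: Hom_def)

lemma Hom_dom: "f \<in> Hom X Y \<Longrightarrow> X \<in> Ob C"
  and Hom_cod: "f \<in> Hom X Y \<Longrightarrow> Y \<in> Ob C"
  by (simp_all add: Hom_def)

lemma Hom_ident: "X \<in> Ob C \<Longrightarrow> ident C X \<in> Hom X X"
  by (simp add: Hom_def ident_in_hom)

lemma Hom_cmp: "\<lbrakk>g \<in> Hom Y Z; f \<in> Hom X Y\<rbrakk> \<Longrightarrow> g \<cdot> f \<in> Hom X Z"
  using cmp_in_hom by (auto simp: Hom_def)

lemma ident_right: "f \<in> Hom X Y \<Longrightarrow> f \<cdot> ident C X = f"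
  and ident_left: "f \<in> Hom X Y \<Longrightarrow> ident C Y \<cdot> f = f"
  using cmp_ident_right cmp_ident_left by (auto simp: Hom_def)

lemma assoc: "\<lbrakk>h \<in> Hom Y Z; g \<in> Hom X Y; f \<in> Hom W X\<rbrakk> \<Longrightarrow> (h \<cdot> g) \<cdot> f = h \<cdot> (g \<cdot> f)"
  using cmp_assoc by (auto simp: Hom_def)

lemma distrib_left_cmp: "\<lbrakk>g \<in> Hom Y Z; g' \<in> Hom Y Z; f \<in> Hom X Y\<rbrakk> \<Longrightarrow> (g + g') \<cdot> f = g \<cdot> f + g' \<cdot> f"
  and distrib_right_cmp: "\<lbrakk>g \<in> Hom Y Z; f \<in> Hom X Y; f' \<in> Hom X Y\<rbrakk> \<Longrightarrow> g \<cdot> (f + f') = g \<cdot> f + g \<cdot> f'"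
  and scale_left_cmp: "\<lbrakk>g \<in> Hom Y Z; f \<in> Hom X Y\<rbrakk> \<Longrightarrow> scale C a g \<cdot> f = scale C a (g \<cdot> f)"
  and scale_right_cmp: "\<lbrakk>g \<in> Hom Y Z; f \<in> Hom X Y\<rbrakk> \<Longrightarrow> g \<cdot> scale C a f = scale C a (g \<cdot> f)"
  using cmp_add_left cmp_add_right cmp_scale_left cmp_scale_right by (auto simp: Hom_def)

lemma subspace_Hom: "\<lbrakk>X \<in> Ob C; Y \<in> Ob C\<rbrakk> \<Longrightarrow> subspace (Hom X Y)"
  by (simp add: Hom_eq_hom hom_subspace)

lemma Hom_zero: "\<lbrakk>X \<in> Ob C; Y \<in> Ob C\<rbrakk> \<Longrightarrow> 0 \<in> Hom X Y"
  by (simp add: subspace_Hom subspace_0)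

lemma Hom_add: "\<lbrakk>f \<in> Hom X Y; g \<in> Hom X Y\<rbrakk> \<Longrightarrow> f + g \<in> Hom X Y"
  and Hom_diff: "\<lbrakk>f \<in> Hom X Y; g \<in> Hom X Y\<rbrakk> \<Longrightarrow> f - g \<in> Hom X Y"
  and Hom_scale: "f \<in> Hom X Y \<Longrightarrow> scale C a f \<in> Hom X Y"
  and Hom_uminus: "f \<in> Hom X Y \<Longrightarrow> - f \<in> Hom X Y"
  using subspace_Hom[of X Y] Hom_dom[of f X Y] Hom_cod[of f X Y]
  by (blast intro: subspace_add subspace_diff subspace_scale subspace_neg)+

lemma Hom_sum: "\<lbrakk>X \<in> Ob C; Y \<in> Ob C; \<And>j. j \<in> J \<Longrightarrow> f j \<in> Hom X Y\<rbrakk> \<Longrightarrow> sum f J \<in> Hom X Y"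
  by (rule subspace_sum[OF subspace_Hom])

lemma zero_cmp: "f \<in> Hom X Y \<Longrightarrow> 0 \<cdot> f = 0"
  using distrib_left_cmp[of 0 Y Y 0 f X] Hom_cod Hom_zero by fastforce

lemma cmp_zero: "g \<in> Hom Y Z \<Longrightarrow> g \<cdot> 0 = 0"
  using distrib_right_cmp[of g Y Z 0 Y 0] Hom_dom Hom_zero by fastforce

lemma uminus_cmp: "\<lbrakk>g \<in> Hom Y Z; f \<in> Hom X Y\<rbrakk> \<Longrightarrow> (- g) \<cdot> f = - (g \<cdot> f)"
  using distrib_left_cmp[of g Y Z "- g" f X] Hom_uminus[of g Y Z] zero_cmp
  by (metis add.right_inverse minus_unique)

lemma cmp_uminus: "\<lbrakk>g \<in> Hom Y Z; f \<in> Hom X Y\<rbrakk> \<Longrightarrow> g \<cdot> (- f) = - (g \<cdot> f)"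
  using distrib_right_cmp[of g Y Z f X "- f"] Hom_uminus[of f X Y] cmp_zero
  by (metis add.right_inverse minus_unique)

lemma diff_cmp: "\<lbrakk>g \<in> Hom Y Z; g' \<in> Hom Y Z; f \<in> Hom X Y\<rbrakk> \<Longrightarrow> (g - g') \<cdot> f = g \<cdot> f - g' \<cdot> f"
  using distrib_left_cmp[of g Y Z "- g'" f X] Hom_uminus[of g' Y Z] uminus_cmp by simp

lemma cmp_diff: "\<lbrakk>g \<in> Hom Y Z; f \<in> Hom X Y; f' \<in> Hom X Y\<rbrakk> \<Longrightarrow> g \<cdot> (f - f') = g \<cdot> f - g \<cdot> f'"
  using distrib_right_cmp[of g Y Z f X "- f'"] Hom_uminus[of f' X Y] cmp_uminus by simp

lemma sum_cmp:
  assumes "\<And>j. j \<in> J \<Longrightarrow> g j \<in> Hom Y Z" and "f \<in> Hom X Y" and "Z \<in> Ob C"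
  shows "sum g J \<cdot> f = (\<Sum>j\<in>J. g j \<cdot> f)"
  using assms(1)
proof (induction J rule: infinite_finite_induct)
  case (insert x J)
  have "sum g J \<in> Hom Y Z"
    using insert.prems assms Hom_dom Hom_cod by (blast intro: Hom_sum)
  then show ?case
    using insert distrib_left_cmp[of "g x" Y Z "sum g J" f X] assms by simp
qed (use assms zero_cmp in auto)

lemma cmp_sum:
  assumes "\<And>j. j \<in> J \<Longrightarrow> f j \<in> Hom X Y" and "g \<in> Hom Y Z" and "X \<in> Ob C"
  shows "g \<cdot> sum f J = (\<Sum>j\<in>J. g \<cdot> f j)"
  using assms(1)
proof (induction J rule: infinite_finite_induct)
  case (insert x J)
  have "sum f J \<in> Hom X Y"
    using insert.prems assms Hom_dom Hom_cod by (blast intro: Hom_sum)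
  then show ?case
    using insert distrib_right_cmp[of g Y Z "f x" X "sum f J"] assms by simp
qed (use assms cmp_zero in auto)

lemma iso_arrowE:
  assumes "iso_arrow C X Y f" "X \<in> Ob C" "Y \<in> Ob C"
  obtains g where "f \<in> Hom X Y" "g \<in> Hom Y X" "g \<cdot> f = ident C X" "f \<cdot> g = ident C Y"
  using assms by (auto simp: iso_arrow_def Hom_def)

lemma iso_arrowI:
  "\<lbrakk>f \<in> Hom X Y; g \<in> Hom Y X; g \<cdot> f = ident C X; f \<cdot> g = ident C Y\<rbrakk> \<Longrightarrow> iso_arrow C X Y f"
  by (auto simp: iso_arrow_def Hom_def)

lemma iso_arrow_ident: "X \<in> Ob C \<Longrightarrow> iso_arrow C X X (ident C X)"
  by (rule iso_arrowI[where g = "ident C X"]) (simp_all add: Hom_ident ident_left[OF Hom_ident])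

section \<open>Linear endofunctors and equivalences\<close>

lemma functor_Hom:
  assumes "linear_endofunctor C G\<^sub>0 G" and "f \<in> Hom X Y"
  shows "G f \<in> Hom (G\<^sub>0 X) (G\<^sub>0 Y)"
  using assms by (auto simp: linear_endofunctor_def Hom_def)

lemma functor_cmp:
  assumes "linear_endofunctor C G\<^sub>0 G" and "g \<in> Hom Y Z" and "f \<in> Hom X Y"
  shows "G (g \<cdot> f) = G g \<cdot> G f"
proof -
  have "X \<in> Ob C" "Y \<in> Ob C" "Z \<in> Ob C" "f \<in> hom C X Y" "g \<in> hom C Y Z"
    using assms by (auto simp: Hom_def)
  then show ?thesis using assms(1) unfolding linear_endofunctor_def by blast
qed

text \<open>By naturality \<open>f\<close> equals \<open>\<eta> Y \<cdot> H (G f)\<close> followed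
  on the right by the inverse of \<open>\<eta> X\<close>, an expression in \<open>G f\<close>
  alone.\<close>

lemma functor_faithful:
  assumes G: "linear_endofunctor C G\<^sub>0 G" and H: "linear_endofunctor C H\<^sub>0 H"
    and \<eta>: "natural_iso_to_identity C (\<lambda>X. H\<^sub>0 (G\<^sub>0 X)) (\<lambda>f. H (G f)) \<eta>"
    and f: "f \<in> Hom X Y" and f': "f' \<in> Hom X Y" and eq: "G f = G f'"
  shows "f = f'"
proof -
  have X: "X \<in> Ob C" using f Hom_dom by blast
  have "iso_arrow C (H\<^sub>0 (G\<^sub>0 X)) X (\<eta> X)" "H\<^sub>0 (G\<^sub>0 X) \<in> Ob C"
    using \<eta> G H X by (auto simp: natural_iso_to_identity_def linear_endofunctor_def)
  then obtain g where \<eta>X: "\<eta> X \<in> Hom (H\<^sub>0 (G\<^sub>0 X)) X" and g: "g \<in> Hom X (H\<^sub>0 (G\<^sub>0 X))"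
    and g': "\<eta> X \<cdot> g = ident C X"
    using X by (auto elim: iso_arrowE)
  have nat: "\<eta> Y \<cdot> H (G a) = a \<cdot> \<eta> X" if "a \<in> Hom X Y" for a
    using \<eta> that by (auto simp: natural_iso_to_identity_def Hom_def)
  have "a = (\<eta> Y \<cdot> H (G a)) \<cdot> g" if "a \<in> Hom X Y" for a
    using nat[OF that] assoc[OF that \<eta>X g] g' ident_right[OF that] by simp
  from this[OF f] this[OF f'] eq show ?thesis by simp
qed

text \<open>The same expression with \<open>h\<close> in place of \<open>G f\<close> defines the
  preimage. Cancelling \<open>\<eta> Y\<close> gives \<open>H (G f) = H h\<close>, and \<kappa>
  makes \<open>H\<close> faithful.\<close>

lemma functor_full:
  assumes G: "linear_endofunctor C G\<^sub>0 G" and H: "linear_endofunctor C H\<^sub>0 H"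
    and \<eta>: "natural_iso_to_identity C (\<lambda>X. H\<^sub>0 (G\<^sub>0 X)) (\<lambda>f. H (G f)) \<eta>"
    and \<kappa>: "natural_iso_to_identity C (\<lambda>X. G\<^sub>0 (H\<^sub>0 X)) (\<lambda>f. G (H f)) \<kappa>"
    and X: "X \<in> Ob C" and Y: "Y \<in> Ob C" and h: "h \<in> Hom (G\<^sub>0 X) (G\<^sub>0 Y)"
  shows "\<exists>f \<in> Hom X Y. G f = h"
proof -
  have Ob: "H\<^sub>0 (G\<^sub>0 X) \<in> Ob C" "H\<^sub>0 (G\<^sub>0 Y) \<in> Ob C"
    using G H X Y by (auto simp: linear_endofunctor_def)
  have iso: "iso_arrow C (H\<^sub>0 (G\<^sub>0 X)) X (\<eta> X)" "iso_arrow C (H\<^sub>0 (G\<^sub>0 Y)) Y (\<eta> Y)"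
    using \<eta> X Y by (auto simp: natural_iso_to_identity_def)
  obtain g where \<eta>X: "\<eta> X \<in> Hom (H\<^sub>0 (G\<^sub>0 X)) X" and g: "g \<in> Hom X (H\<^sub>0 (G\<^sub>0 X))"
    and g': "g \<cdot> \<eta> X = ident C (H\<^sub>0 (G\<^sub>0 X))"
    using iso(1) Ob X by (auto elim: iso_arrowE)
  obtain g2 where \<eta>Y: "\<eta> Y \<in> Hom (H\<^sub>0 (G\<^sub>0 Y)) Y" and g2: "g2 \<in> Hom Y (H\<^sub>0 (G\<^sub>0 Y))"
    and g2': "g2 \<cdot> \<eta> Y = ident C (H\<^sub>0 (G\<^sub>0 Y))"
    using iso(2) Ob Y by (auto elim: iso_arrowE)
  have Hh: "H h \<in> Hom (H\<^sub>0 (G\<^sub>0 X)) (H\<^sub>0 (G\<^sub>0 Y))" by (rule functor_Hom[OF H h])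
  define f where "f = \<eta> Y \<cdot> (H h \<cdot> g)"
  have f: "f \<in> Hom X Y" unfolding f_def by (intro Hom_cmp[OF \<eta>Y] Hom_cmp[OF Hh] g)
  have nat: "\<eta> Y \<cdot> H (G f) = f \<cdot> \<eta> X"
    using \<eta> f by (auto simp: natural_iso_to_identity_def Hom_def)
  have HGf: "H (G f) \<in> Hom (H\<^sub>0 (G\<^sub>0 X)) (H\<^sub>0 (G\<^sub>0 Y))"
    by (intro functor_Hom[OF H] functor_Hom[OF G] f)
  have "f \<cdot> \<eta> X = \<eta> Y \<cdot> H h"
    unfolding f_def using assoc[OF \<eta>Y Hom_cmp[OF Hh g] \<eta>X] assoc[OF Hh g \<eta>X] g' ident_right[OF Hh]
    by simp
  then have "g2 \<cdot> (\<eta> Y \<cdot> H (G f)) = g2 \<cdot> (\<eta> Y \<cdot> H h)" using nat by simp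
  then have "H (G f) = H h"
    using assoc[OF g2 \<eta>Y HGf] assoc[OF g2 \<eta>Y Hh] g2' ident_left[OF HGf] ident_left[OF Hh] by simp
  then have "G f = h"
    using functor_faithful[OF H G \<kappa> functor_Hom[OF G f] h] by blast
  with f show ?thesis by blast
qed

lemma functor_add:
  assumes "linear_endofunctor C G\<^sub>0 G" and "f \<in> Hom X Y" and "g \<in> Hom X Y"
  shows "G (f + g) = G f + G g"
  using assms by (auto simp: linear_endofunctor_def Hom_def)

lemma functor_zero:
  assumes "linear_endofunctor C G\<^sub>0 G" and "X \<in> Ob C"
  shows "G 0 = 0"
  using functor_add[OF assms(1), of 0 X X 0] Hom_zero assms by simp

lemma functor_uminus:
  assumes G: "linear_endofunctor C G\<^sub>0 G" and f: "f \<in> Hom X Y"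
  shows "G (- f) = - G f"
  using functor_add[OF G f Hom_uminus[OF f]] functor_zero[OF G Hom_dom[OF f]]
  by (simp add: eq_neg_iff_add_eq_0 add.commute)

lemma functor_diff:
  assumes G: "linear_endofunctor C G\<^sub>0 G" and f: "f \<in> Hom X Y" and g: "g \<in> Hom X Y"
  shows "G (f - g) = G f - G g"
  using functor_add[OF G f Hom_uminus[OF g]] functor_uminus[OF G g] by simp

lemma functor_sum:
  assumes G: "linear_endofunctor C G\<^sub>0 G" and XY: "X \<in> Ob C" "Y \<in> Ob C"
    and f: "\<And>j. j \<in> J \<Longrightarrow> f j \<in> Hom X Y"
  shows "G (sum f J) = (\<Sum>j\<in>J. G (f j))"
  using f
proof (induction J rule: infinite_finite_induct)
  case (insert x J)
  have "sum f J \<in> Hom X Y" using insert.prems XY by (blast intro: Hom_sum)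
  then show ?case using insert functor_add[OF G, of "f x" X Y "sum f J"] by simp
qed (use functor_zero[OF G XY(1)] in auto)

end

section \<open>Direct sums and additive closures\<close>

context linear_category
begin

lemma direct_sum_viaD:
  assumes "direct_sum_via C Xs P \<iota> \<pi>" "P \<in> Ob C" "set Xs \<subseteq> Ob C"
  shows "j < length Xs \<Longrightarrow> \<iota> j \<in> Hom (Xs ! j) P"
    and "j < length Xs \<Longrightarrow> \<pi> j \<in> Hom P (Xs ! j)"
    and "\<lbrakk>j < length Xs; l < length Xs\<rbrakk> \<Longrightarrow> \<pi> l \<cdot> \<iota> j = (if j = l then ident C (Xs ! j) else 0)"
    and "(\<Sum>j < length Xs. \<iota> j \<cdot> \<pi> j) = ident C P"
  using assms nth_mem[of _ Xs] unfolding direct_sum_via_def Hom_def by blast+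

lemma direct_sum_viaI:
  assumes "\<And>j. j < length Xs \<Longrightarrow> \<iota> j \<in> Hom (Xs ! j) P"
    and "\<And>j. j < length Xs \<Longrightarrow> \<pi> j \<in> Hom P (Xs ! j)"
    and "\<And>j l. \<lbrakk>j < length Xs; l < length Xs\<rbrakk>
      \<Longrightarrow> \<pi> l \<cdot> \<iota> j = (if j = l then ident C (Xs ! j) else 0)"
    and "(\<Sum>j < length Xs. \<iota> j \<cdot> \<pi> j) = ident C P"
  shows "direct_sum_via C Xs P \<iota> \<pi>"
  using assms unfolding direct_sum_via_def Hom_def by auto

lemma direct_sum_via_pairI:
  assumes i0: "i0 \<in> Hom X P" and i1: "i1 \<in> Hom Y P" and p0: "p0 \<in> Hom P X" and p1: "p1 \<in> Hom P Y"
    and "p0 \<cdot> i0 = ident C X" "p1 \<cdot> i1 = ident C Y" "p0 \<cdot> i1 = 0" "p1 \<cdot> i0 = 0"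
    and "i0 \<cdot> p0 + i1 \<cdot> p1 = ident C P"
  shows "direct_sum_via C [X, Y] P (\<lambda>j. if j = 0 then i0 else i1) (\<lambda>j. if j = 0 then p0 else p1)"
  using assms by (intro direct_sum_viaI) (auto simp: less_Suc_eq numeral_2_eq_2 lessThan_Suc add.commute)

lemma direct_sum_via_pairE:
  assumes "direct_sum_via C [X, Y] P \<iota> \<pi>" "P \<in> Ob C" "X \<in> Ob C" "Y \<in> Ob C"
  shows "\<iota> 0 \<in> Hom X P" "\<iota> 1 \<in> Hom Y P" "\<pi> 0 \<in> Hom P X" "\<pi> 1 \<in> Hom P Y"
    "\<pi> 0 \<cdot> \<iota> 0 = ident C X" "\<pi> 1 \<cdot> \<iota> 1 = ident C Y" "\<pi> 0 \<cdot> \<iota> 1 = 0" "\<pi> 1 \<cdot> \<iota> 0 = 0"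
    "\<iota> 0 \<cdot> \<pi> 0 + \<iota> 1 \<cdot> \<pi> 1 = ident C P"
proof -
  have set: "set [X, Y] \<subseteq> Ob C" using assms by simp
  note D = direct_sum_viaD[OF assms(1,2) set]
  show "\<iota> 0 \<in> Hom X P" "\<iota> 1 \<in> Hom Y P" using D(1)[of 0] D(1)[of 1] by simp_all
  show "\<pi> 0 \<in> Hom P X" "\<pi> 1 \<in> Hom P Y" using D(2)[of 0] D(2)[of 1] by simp_all
  show "\<pi> 0 \<cdot> \<iota> 0 = ident C X" using D(3)[of 0 0] by simp
  show "\<pi> 1 \<cdot> \<iota> 1 = ident C Y" using D(3)[of 1 1] by simp
  show "\<pi> 0 \<cdot> \<iota> 1 = 0" using D(3)[of 1 0] by simp
  show "\<pi> 1 \<cdot> \<iota> 0 = 0" using D(3)[of 0 1] by simp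
  show "\<iota> 0 \<cdot> \<pi> 0 + \<iota> 1 \<cdot> \<pi> 1 = ident C P" using D(4) by (simp add: lessThan_Suc add.commute)
qed

lemma direct_sum_Cons:
  assumes Xs: "direct_sum C Xs P" and Q: "direct_sum C [X, P] Q" and Ob: "X \<in> Ob C" "set Xs \<subseteq> Ob C"
  shows "direct_sum C (X # Xs) Q"
proof -
  obtain \<iota> \<pi> where P: "P \<in> Ob C" and via: "direct_sum_via C Xs P \<iota> \<pi>"
    using Xs by (auto simp: direct_sum_def)
  obtain \<iota>' \<pi>' where QOb: "Q \<in> Ob C" and via': "direct_sum_via C [X, P] Q \<iota>' \<pi>'"
    using Q by (auto simp: direct_sum_def)
  note D = direct_sum_viaD[OF via P Ob(2)] and E = direct_sum_via_pairE[OF via' QOb Ob(1) P]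
  \<comment> \<open>Index 0 is the new summand; index \<open>Suc n\<close> is the old index
    \<open>n\<close>, routed through \<open>P\<close>.\<close>
  define i where "i j = (case j of 0 \<Rightarrow> \<iota>' 0 | Suc n \<Rightarrow> \<iota>' 1 \<cdot> \<iota> n)" for j
  define p where "p j = (case j of 0 \<Rightarrow> \<pi>' 0 | Suc n \<Rightarrow> \<pi> n \<cdot> \<pi>' 1)" for j
  have i_Hom: "i j \<in> Hom ((X # Xs) ! j) Q" if "j < length (X # Xs)" for j
    using that E(1,2) D(1) by (cases j) (auto simp: i_def intro: Hom_cmp)
  have p_Hom: "p j \<in> Hom Q ((X # Xs) ! j)" if "j < length (X # Xs)" for j
    using that E(3,4) D(2) by (cases j) (auto simp: p_def intro: Hom_cmp)
  have ortho: "p l \<cdot> i j = (if j = l then ident C ((X # Xs) ! j) else 0)"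
    if j: "j < length (X # Xs)" and l: "l < length (X # Xs)" for j l
  proof (cases j)
    case 0
    note j0 = this
    show ?thesis
    proof (cases l)
      case 0 then show ?thesis using j0 E by (simp add: i_def p_def)
    next
      case (Suc l')
      then have \<pi>: "\<pi> l' \<in> Hom P (Xs ! l')" using l D(2) by simp
      show ?thesis using Suc j0 assoc[OF \<pi> E(4) E(1)] cmp_zero[OF \<pi>] E(8) by (simp add: i_def p_def)
    qed
  next
    case (Suc j')
    note jS = this
    have \<iota>: "\<iota> j' \<in> Hom (Xs ! j') P" using j Suc D(1) by simp
    show ?thesis
    proof (cases l)
      case 0 then show ?thesis
        using jS assoc[OF E(3) E(2) \<iota>] zero_cmp[OF \<iota>] E(7) by (simp add: i_def p_def)
    next
      case (Suc l')
      then have \<pi>: "\<pi> l' \<in> Hom P (Xs ! l')" using l D(2) by simp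
      have "(\<pi> l' \<cdot> \<pi>' 1) \<cdot> (\<iota>' 1 \<cdot> \<iota> j') = \<pi> l' \<cdot> \<iota> j'"
        using assoc[OF \<pi> E(4) Hom_cmp[OF E(2) \<iota>]] assoc[OF E(4) E(2) \<iota>] E(6) ident_left[OF \<iota>]
        by simp
      then show ?thesis using Suc jS j l D(3) by (simp add: i_def p_def)
    qed
  qed
  have "(\<Sum>j<length (X # Xs). i j \<cdot> p j) = \<iota>' 0 \<cdot> \<pi>' 0 + (\<Sum>j<length Xs. (\<iota>' 1 \<cdot> \<iota> j) \<cdot> (\<pi> j \<cdot> \<pi>' 1))"
    by (simp add: sum.lessThan_Suc_shift i_def p_def del: sum.lessThan_Suc)
  also have "(\<Sum>j<length Xs. (\<iota>' 1 \<cdot> \<iota> j) \<cdot> (\<pi> j \<cdot> \<pi>' 1)) = (\<Sum>j<length Xs. \<iota>' 1 \<cdot> ((\<iota> j \<cdot> \<pi> j) \<cdot> \<pi>' 1))"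
  proof (rule sum.cong[OF refl])
    fix j assume "j \<in> {..<length Xs}"
    then have \<iota>: "\<iota> j \<in> Hom (Xs ! j) P" and \<pi>: "\<pi> j \<in> Hom P (Xs ! j)" using D by auto
    show "(\<iota>' 1 \<cdot> \<iota> j) \<cdot> (\<pi> j \<cdot> \<pi>' 1) = \<iota>' 1 \<cdot> ((\<iota> j \<cdot> \<pi> j) \<cdot> \<pi>' 1)"
      using assoc[OF E(2) \<iota> Hom_cmp[OF \<pi> E(4)]] assoc[OF \<iota> \<pi> E(4)] by simp
  qed
  also have "\<dots> = \<iota>' 1 \<cdot> (\<Sum>j<length Xs. (\<iota> j \<cdot> \<pi> j) \<cdot> \<pi>' 1)"
    using D E(4) QOb by (intro cmp_sum[OF _ E(2), symmetric]) (auto intro!: Hom_cmp)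
  also have "(\<Sum>j<length Xs. (\<iota> j \<cdot> \<pi> j) \<cdot> \<pi>' 1) = (\<Sum>j<length Xs. \<iota> j \<cdot> \<pi> j) \<cdot> \<pi>' 1"
    using D P by (intro sum_cmp[OF _ E(4), symmetric]) (auto intro!: Hom_cmp)
  also have "\<dots> = \<pi>' 1" using D(4) ident_left[OF E(4)] by simp
  finally have "(\<Sum>j<length (X # Xs). i j \<cdot> p j) = ident C Q" using E(9) by simp
  then have "direct_sum_via C (X # Xs) Q i p"
    using i_Hom p_Hom ortho by (intro direct_sum_viaI)
  then show ?thesis using QOb by (auto simp: direct_sum_def)
qed

lemma add_closure_Ob: "A \<in> add_closure C S \<Longrightarrow> A \<in> Ob C"
  by (auto simp: add_closure_def direct_summand_def)

text \<open>Cutting the decomposition of the identity of a power of \<open>S\<close> down to the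
  summand \<open>A\<close> leaves a sum of arrows through \<open>S\<close>. The vanishing and
  lifting arguments for additive closures rest on this form.\<close>

lemma add_closure_ident:
  assumes S: "S \<in> Ob C" and A: "A \<in> add_closure C S"
  shows "\<exists>(n :: nat) s r. (\<forall>j<n. s j \<in> Hom S A \<and> r j \<in> Hom A S) \<and> (\<Sum>j<n. s j \<cdot> r j) = ident C A"
proof -
  obtain n P X' \<iota> \<pi> \<iota>' \<pi>' where P: "P \<in> Ob C" and AOb: "A \<in> Ob C" and X': "X' \<in> Ob C"
    and via: "direct_sum_via C (replicate n S) P \<iota> \<pi>" and via': "direct_sum_via C [A, X'] P \<iota>' \<pi>'"
    using A by (auto simp: add_closure_def direct_summand_def direct_sum_def)
  have "set (replicate n S) \<subseteq> Ob C" using S by auto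
  note D = direct_sum_viaD[OF via P this] and E = direct_sum_via_pairE[OF via' P AOb X']
  have \<iota>: "\<iota> j \<in> Hom S P" and \<pi>: "\<pi> j \<in> Hom P S" if "j < n" for j
    using D(1,2)[of j] that by simp_all
  have "(\<Sum>j<n. (\<pi>' 0 \<cdot> \<iota> j) \<cdot> (\<pi> j \<cdot> \<iota>' 0)) = (\<Sum>j<n. \<pi>' 0 \<cdot> ((\<iota> j \<cdot> \<pi> j) \<cdot> \<iota>' 0))"
  proof (rule sum.cong[OF refl])
    fix j assume "j \<in> {..<n}"
    then have j: "j < n" by simp
    show "(\<pi>' 0 \<cdot> \<iota> j) \<cdot> (\<pi> j \<cdot> \<iota>' 0) = \<pi>' 0 \<cdot> ((\<iota> j \<cdot> \<pi> j) \<cdot> \<iota>' 0)"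
      using assoc[OF E(3) \<iota>[OF j] Hom_cmp[OF \<pi>[OF j] E(1)]] assoc[OF \<iota>[OF j] \<pi>[OF j] E(1)] by simp
  qed
  also have "\<dots> = \<pi>' 0 \<cdot> (\<Sum>j<n. (\<iota> j \<cdot> \<pi> j) \<cdot> \<iota>' 0)"
    using \<iota> \<pi> E(1) AOb by (intro cmp_sum[OF _ E(3), symmetric]) (auto intro!: Hom_cmp)
  also have "(\<Sum>j<n. (\<iota> j \<cdot> \<pi> j) \<cdot> \<iota>' 0) = (\<Sum>j<n. \<iota> j \<cdot> \<pi> j) \<cdot> \<iota>' 0"
    using \<iota> \<pi> P by (intro sum_cmp[OF _ E(1), symmetric]) (auto intro!: Hom_cmp)
  also have "\<dots> = \<iota>' 0" using D(4) ident_left[OF E(1)] by simp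
  finally have "(\<Sum>j<n. (\<pi>' 0 \<cdot> \<iota> j) \<cdot> (\<pi> j \<cdot> \<iota>' 0)) = ident C A" using E(5) by simp
  moreover have "\<forall>j<n. \<pi>' 0 \<cdot> \<iota> j \<in> Hom S A \<and> \<pi> j \<cdot> \<iota>' 0 \<in> Hom A S"
    using \<iota> \<pi> E by (auto intro: Hom_cmp)
  ultimately show ?thesis by (intro exI[of _ n] exI[of _ "\<lambda>j. \<pi>' 0 \<cdot> \<iota> j"] exI[of _ "\<lambda>j. \<pi> j \<cdot> \<iota>' 0"]) simp
qed

lemma add_closure_iso:
  assumes A: "A \<in> add_closure C S" and f: "f \<in> Hom A A'" and g: "g \<in> Hom A' A"
    and gf: "g \<cdot> f = ident C A" and fg: "f \<cdot> g = ident C A'"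
  shows "A' \<in> add_closure C S"
proof -
  obtain n P X' \<iota> \<pi> where P: "P \<in> Ob C" and AOb: "A \<in> Ob C" and X': "X' \<in> Ob C"
    and Pn: "direct_sum C (replicate n S) P" and via: "direct_sum_via C [A, X'] P \<iota> \<pi>"
    using A unfolding add_closure_def direct_summand_def direct_sum_def by blast
  note E = direct_sum_via_pairE[OF via P AOb X']
  have 1: "(f \<cdot> \<pi> 0) \<cdot> (\<iota> 0 \<cdot> g) = ident C A'"
    using assoc[OF f E(3) Hom_cmp[OF E(1) g]] assoc[OF E(3) E(1) g] E(5) ident_left[OF g] fg by simp
  have 2: "(f \<cdot> \<pi> 0) \<cdot> \<iota> 1 = 0"
    using assoc[OF f E(3) E(2)] E(7) cmp_zero[OF f] by simp
  have 3: "\<pi> 1 \<cdot> (\<iota> 0 \<cdot> g) = 0"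
    using assoc[OF E(4) E(1) g] E(8) zero_cmp[OF g] by simp
  have "(\<iota> 0 \<cdot> g) \<cdot> (f \<cdot> \<pi> 0) = \<iota> 0 \<cdot> \<pi> 0"
    using assoc[OF E(1) g Hom_cmp[OF f E(3)]] assoc[OF g f E(3)] gf ident_left[OF E(3)] by simp
  then have 4: "(\<iota> 0 \<cdot> g) \<cdot> (f \<cdot> \<pi> 0) + \<iota> 1 \<cdot> \<pi> 1 = ident C P" using E(9) by simp
  have "direct_sum C [A', X'] P"
    using direct_sum_via_pairI[OF Hom_cmp[OF E(1) g] E(2) Hom_cmp[OF f E(3)] E(4) 1 E(6) 2 3 4] P
    by (auto simp: direct_sum_def)
  then show ?thesis
    using Pn Hom_cod[OF f] X' by (auto simp: add_closure_def direct_summand_def)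
qed

lemma add_closure_functor:
  assumes G: "linear_endofunctor C G\<^sub>0 G" and S: "S \<in> Ob C" and A: "A \<in> add_closure C S"
  shows "G\<^sub>0 A \<in> add_closure C (G\<^sub>0 S)"
proof -
  have GOb: "G\<^sub>0 X \<in> Ob C" "G (ident C X) = ident C (G\<^sub>0 X)" if "X \<in> Ob C" for X
    using G that by (auto simp: linear_endofunctor_def)
  have map: "direct_sum C (map G\<^sub>0 Xs) (G\<^sub>0 P)" if P: "direct_sum C Xs P" and Xs: "set Xs \<subseteq> Ob C" for Xs P
  proof -
    obtain \<iota> \<pi> where P: "P \<in> Ob C" and via: "direct_sum_via C Xs P \<iota> \<pi>"
      using P by (auto simp: direct_sum_def)
    note D = direct_sum_viaD[OF via P Xs]
    have cmp: "G (\<pi> l) \<cdot> G (\<iota> j) = G (\<pi> l \<cdot> \<iota> j)" if "j < length Xs" "l < length Xs" for j l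
      using functor_cmp[OF G D(2) D(1)] that by simp
    have "(\<Sum>j<length Xs. G (\<iota> j) \<cdot> G (\<pi> j)) = (\<Sum>j<length Xs. G (\<iota> j \<cdot> \<pi> j))"
      using functor_cmp[OF G D(1) D(2)] by simp
    also have "\<dots> = G (\<Sum>j<length Xs. \<iota> j \<cdot> \<pi> j)"
      using D by (intro functor_sum[OF G P P, symmetric]) (auto intro!: Hom_cmp)
    finally have sum: "(\<Sum>j<length Xs. G (\<iota> j) \<cdot> G (\<pi> j)) = ident C (G\<^sub>0 P)"
      using D(4) GOb[OF P] by simp
    have "direct_sum_via C (map G\<^sub>0 Xs) (G\<^sub>0 P) (\<lambda>j. G (\<iota> j)) (\<lambda>j. G (\<pi> j))"
    proof (rule direct_sum_viaI)
      fix j l assume jl: "j < length (map G\<^sub>0 Xs)" "l < length (map G\<^sub>0 Xs)"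
      then have "Xs ! j \<in> Ob C" "Xs ! l \<in> Ob C" using Xs by auto
      then show "G (\<pi> l) \<cdot> G (\<iota> j) = (if j = l then ident C (map G\<^sub>0 Xs ! j) else 0)"
        using jl cmp D(3) GOb functor_zero[OF G P] by simp
    qed (use D sum functor_Hom[OF G] in auto)
    then show ?thesis using GOb[OF P] by (auto simp: direct_sum_def)
  qed
  obtain n P X' where X': "X' \<in> Ob C" "A \<in> Ob C"
    and Pn: "direct_sum C (replicate n S) P" and AP: "direct_sum C [A, X'] P"
    using A by (auto simp: add_closure_def direct_summand_def)
  have "direct_sum C (replicate n (G\<^sub>0 S)) (G\<^sub>0 P)" using map[OF Pn] S by (simp add: set_replicate_conv_if)
  moreover have "direct_sum C [G\<^sub>0 A, G\<^sub>0 X'] (G\<^sub>0 P)" using map[OF AP] X' by simp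
  ultimately show ?thesis
    using GOb X' unfolding add_closure_def direct_summand_def by blast
qed

text \<open>For \<open>S = T\<close> this says that F sends \<open>g\<close> to 0.\<close>

definition ghost :: "'o \<Rightarrow> 'o \<Rightarrow> 'm \<Rightarrow> bool" where
  "ghost S X g \<longleftrightarrow> (\<forall>s \<in> Hom S X. g \<cdot> s = 0)"

text \<open>The identity of \<open>A\<close> is a sum of composites that start with an arrow to
  \<open>S\<close> and continue by an arrow from \<open>S\<close>, and \<open>f\<close> kills each
  of them.\<close>

lemma ghost_add_closure_zero:
  assumes S: "S \<in> Ob C" and A: "A \<in> add_closure C S" and f: "f \<in> Hom A Y" and gh: "ghost S A f"
  shows "f = 0"
proof -
  obtain n :: nat and s r where sr: "\<forall>j<n. s j \<in> Hom S A \<and> r j \<in> Hom A S"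
    and id: "(\<Sum>j<n. s j \<cdot> r j) = ident C A"
    using add_closure_ident[OF S A] by blast
  have s: "s j \<in> Hom S A" and r: "r j \<in> Hom A S" if "j < n" for j
    using sr that by auto
  have "f = f \<cdot> (\<Sum>j<n. s j \<cdot> r j)" using id ident_right[OF f] by simp
  also have "\<dots> = (\<Sum>j<n. f \<cdot> (s j \<cdot> r j))"
    using s r add_closure_Ob[OF A] by (intro cmp_sum[OF _ f]) (auto intro!: Hom_cmp)
  also have "\<dots> = 0"
  proof (rule sum.neutral, rule ballI)
    fix j assume "j \<in> {..<n}"
    then have j: "j < n" by simp
    have "f \<cdot> s j = 0" using gh s[OF j] by (simp add: ghost_def)
    then show "f \<cdot> (s j \<cdot> r j) = 0" using assoc[OF f s[OF j] r[OF j]] zero_cmp[OF r[OF j]] by simp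
  qed
  finally show ?thesis .
qed

text \<open>This is projectivity of C(S, A) over the endomorphism ring of \<open>S\<close>, realized
  by an arrow: lift the finitely many \<open>s j\<close> to \<open>y j\<close> and recombine with
  the \<open>r j\<close>. The composites \<open>u \<cdot> s\<close> stay in \<open>E\<close> because
  each \<open>r j \<cdot> s\<close> is an endomorphism of \<open>S\<close> and \<open>E\<close> is a
  submodule.\<close>

lemma add_closure_lift:
  assumes S: "S \<in> Ob C" and A: "A \<in> add_closure C S" and h: "h \<in> Hom A Z" and g: "g \<in> Hom Y Z"
    and E: "F_submodule C S Y E" and lift: "\<And>s. s \<in> Hom S A \<Longrightarrow> \<exists>y \<in> E. g \<cdot> y = h \<cdot> s"
  obtains u where "u \<in> Hom A Y" "g \<cdot> u = h" "\<forall>s \<in> Hom S A. u \<cdot> s \<in> E"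
proof -
  have Y: "Y \<in> Ob C" using Hom_dom[OF g] .
  have sub: "subspace E" and EH: "\<And>y. y \<in> E \<Longrightarrow> y \<in> Hom S Y"
    and EE: "\<And>y a. \<lbrakk>y \<in> E; a \<in> Hom S S\<rbrakk> \<Longrightarrow> y \<cdot> a \<in> E"
    using E S Y by (auto simp: F_submodule_def F\<^sub>0_def Hom_def)
  obtain n :: nat and s r where sr: "\<forall>j<n. s j \<in> Hom S A \<and> r j \<in> Hom A S"
    and id: "(\<Sum>j<n. s j \<cdot> r j) = ident C A"
    using add_closure_ident[OF S A] by blast
  have s: "s j \<in> Hom S A" and r: "r j \<in> Hom A S" if "j < n" for j
    using sr that by auto
  have "\<forall>j. \<exists>y. j < n \<longrightarrow> y \<in> E \<and> g \<cdot> y = h \<cdot> s j"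
    using lift s by blast
  then obtain y where y: "\<And>j. j < n \<Longrightarrow> y j \<in> E" "\<And>j. j < n \<Longrightarrow> g \<cdot> y j = h \<cdot> s j"
    by metis
  have AOb: "A \<in> Ob C" using A add_closure_Ob by blast
  define u where "u = (\<Sum>j<n. y j \<cdot> r j)"
  have yr: "y j \<cdot> r j \<in> Hom A Y" if "j < n" for j
    using Hom_cmp[OF EH[OF y(1)] r] that by blast
  have u: "u \<in> Hom A Y" unfolding u_def using yr AOb Y by (intro Hom_sum) auto
  have "g \<cdot> u = (\<Sum>j<n. g \<cdot> (y j \<cdot> r j))"
    unfolding u_def using yr AOb by (intro cmp_sum[OF _ g]) auto
  also have "\<dots> = (\<Sum>j<n. h \<cdot> (s j \<cdot> r j))"
  proof (rule sum.cong[OF refl])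
    fix j assume "j \<in> {..<n}"
    then have j: "j < n" by simp
    show "g \<cdot> (y j \<cdot> r j) = h \<cdot> (s j \<cdot> r j)"
      using assoc[OF g EH[OF y(1)[OF j]] r[OF j]] assoc[OF h s[OF j] r[OF j]] y(2)[OF j] by simp
  qed
  also have "\<dots> = h \<cdot> (\<Sum>j<n. s j \<cdot> r j)"
    using s r AOb by (intro cmp_sum[OF _ h, symmetric]) (auto intro!: Hom_cmp)
  also have "\<dots> = h" using id ident_right[OF h] by simp
  finally have gu: "g \<cdot> u = h" .
  have "u \<cdot> t \<in> E" if t: "t \<in> Hom S A" for t
  proof -
    have "u \<cdot> t = (\<Sum>j<n. (y j \<cdot> r j) \<cdot> t)"
      unfolding u_def using yr Y by (intro sum_cmp[OF _ t]) auto
    also have "\<dots> = (\<Sum>j<n. y j \<cdot> (r j \<cdot> t))"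
      using assoc[OF EH[OF y(1)] r t] by simp
    also have "\<dots> \<in> E"
      using EE[OF y(1) Hom_cmp[OF r t]] by (intro subspace_sum[OF sub]) auto
    finally show ?thesis .
  qed
  with u gu that show thesis by blast
qed

lemma F_submodule_Hom: "\<lbrakk>S \<in> Ob C; Y \<in> Ob C\<rbrakk> \<Longrightarrow> F_submodule C S Y (Hom S Y)"
  using Hom_cmp[of _ S Y _ S] subspace_Hom by (auto simp: F_submodule_def F\<^sub>0_def Hom_eq_hom)

end

section \<open>Finite direct sums and right approximations\<close>

context additive_category
begin

lemma direct_sum_list_exists: "set Xs \<subseteq> Ob C \<Longrightarrow> \<exists>P. direct_sum C Xs P"
proof (induction Xs)
  case Nil
  obtain Z where Z: "zero_object C Z" using zero_object_exists by blast
  then have ZOb: "Z \<in> Ob C" by (simp add: zero_object_def)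
  have "ident C Z = 0" using Z ident_in_hom[OF ZOb] ZOb by (auto simp: zero_object_def)
  then have "direct_sum_via C [] Z (\<lambda>_. 0) (\<lambda>_. 0)" by (simp add: direct_sum_via_def)
  then show ?case using ZOb by (auto simp: direct_sum_def)
next
  case (Cons X Xs)
  then obtain P where P: "direct_sum C Xs P" by auto
  then have "P \<in> Ob C" by (simp add: direct_sum_def)
  then obtain Q where "direct_sum C [X, P] Q" using direct_sum_exists[of X P] Cons.prems by auto
  then show ?case using direct_sum_Cons[OF P] Cons.prems by auto
qed

text \<open>\<open>P\<close> is a direct summand of itself, with a zero object as
  complement.\<close>

lemma direct_sum_in_add_closure:
  assumes P: "direct_sum C (replicate n S) P"
  shows "P \<in> add_closure C S"
proof -
  have POb: "P \<in> Ob C" using P by (simp add: direct_sum_def)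
  obtain Z where Z: "zero_object C Z" using zero_object_exists by blast
  then have ZOb: "Z \<in> Ob C" by (simp add: zero_object_def)
  have "ident C Z = 0" using Z ident_in_hom[OF ZOb] ZOb by (auto simp: zero_object_def)
  then have "direct_sum_via C [P, Z] P (\<lambda>j. if j = 0 then ident C P else 0) (\<lambda>j. if j = 0 then ident C P else 0)"
    using POb ZOb Hom_ident[OF POb] zero_cmp[OF Hom_zero[OF POb ZOb]] zero_cmp[OF Hom_zero[OF ZOb POb]]
    by (intro direct_sum_via_pairI)
      (auto intro: Hom_zero ident_left zero_cmp cmp_zero simp: ident_left[OF Hom_ident])
  then have "direct_summand C P P"
    using POb ZOb by (auto simp: direct_summand_def direct_sum_def)
  then show ?thesis using P by (auto simp: add_closure_def)
qed

text \<open>One copy of \<open>S\<close> for each element of a finite spanning set of \<open>C(S, X)\<close>.\<close>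

lemma right_approximation:
  assumes fin: "hom_finite C" and S: "S \<in> Ob C" and X: "X \<in> Ob C"
  obtains P v where "P \<in> add_closure C S" "v \<in> Hom P X" "\<And>s. s \<in> Hom S X \<Longrightarrow> \<exists>y \<in> Hom S P. v \<cdot> y = s"
proof -
  obtain B where B: "finite B" "span B = Hom S X"
    using fin S X unfolding hom_finite_def Hom_eq_hom[OF S X] by blast
  obtain bs where bs: "set bs = B" using finite_list[OF B(1)] by blast
  define n where "n = length bs"
  have rep: "set (replicate n S) \<subseteq> Ob C" using S by auto
  obtain P where P: "direct_sum C (replicate n S) P"
    using direct_sum_list_exists[OF rep] by blast
  then obtain \<iota> \<pi> where POb: "P \<in> Ob C" and via: "direct_sum_via C (replicate n S) P \<iota> \<pi>"
    by (auto simp: direct_sum_def)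
  note D = direct_sum_viaD[OF via POb rep]
  have \<iota>: "\<iota> j \<in> Hom S P" and \<pi>: "\<pi> j \<in> Hom P S" if "j < n" for j
    using D(1,2)[of j] that by simp_all
  have b: "bs ! j \<in> Hom S X" if "j < n" for j
    using that B(2) bs n_def nth_mem[of j bs] span_superset[of B] by auto
  define v where "v = (\<Sum>j<n. bs ! j \<cdot> \<pi> j)"
  have v: "v \<in> Hom P X"
    unfolding v_def using b \<pi> POb X by (intro Hom_sum) (auto intro!: Hom_cmp)
  have "v \<cdot> \<iota> l = bs ! l" if l: "l < n" for l
  proof -
    have "v \<cdot> \<iota> l = (\<Sum>j<n. (bs ! j \<cdot> \<pi> j) \<cdot> \<iota> l)"
      unfolding v_def using b \<pi> X by (intro sum_cmp[OF _ \<iota>[OF l]]) (auto intro!: Hom_cmp)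
    also have "\<dots> = (\<Sum>j<n. if j = l then bs ! j else 0)"
    proof (rule sum.cong[OF refl])
      fix j assume "j \<in> {..<n}"
      then have j: "j < n" by simp
      show "(bs ! j \<cdot> \<pi> j) \<cdot> \<iota> l = (if j = l then bs ! j else 0)"
        using assoc[OF b[OF j] \<pi>[OF j] \<iota>[OF l]] D(3)[of l j] j l
          ident_right[OF b[OF j]] cmp_zero[OF b[OF j]] by (cases "j = l") simp_all
    qed
    also have "\<dots> = bs ! l" using l by simp
    finally show ?thesis .
  qed
  then have "bs ! l \<in> (\<lambda>y. v \<cdot> y) ` Hom S P" if "l < n" for l
    using \<iota>[OF that] that by (metis imageI)
  then have sub: "B \<subseteq> (\<lambda>y. v \<cdot> y) ` Hom S P"
    unfolding bs[symmetric] n_def set_conv_nth by blast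
  \<comment> \<open>Together with \<open>sub\<close> this puts the span of \<open>B\<close>, which
    is all of C(S, X), inside the image of composition with \<open>v\<close>.\<close>
  have "subspace ((\<lambda>y. v \<cdot> y) ` Hom S P)"
  proof (rule subspaceI)
    show "0 \<in> (\<lambda>y. v \<cdot> y) ` Hom S P"
      using cmp_zero[OF v] Hom_zero[OF S POb] by (metis imageI)
  next
    fix x y assume "x \<in> (\<lambda>y. v \<cdot> y) ` Hom S P" "y \<in> (\<lambda>y. v \<cdot> y) ` Hom S P"
    then obtain x' y' where "x' \<in> Hom S P" "y' \<in> Hom S P" "x = v \<cdot> x'" "y = v \<cdot> y'" by auto
    then show "x + y \<in> (\<lambda>y. v \<cdot> y) ` Hom S P"
      using distrib_right_cmp[OF v, of x' S y'] Hom_add[of x' S P y'] by (metis imageI)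
  next
    fix c x assume "x \<in> (\<lambda>y. v \<cdot> y) ` Hom S P"
    then obtain x' where "x' \<in> Hom S P" "x = v \<cdot> x'" by auto
    then show "scale C c x \<in> (\<lambda>y. v \<cdot> y) ` Hom S P"
      using scale_right_cmp[OF v, of x' S c] Hom_scale[of x' S P c] by (metis imageI)
  qed
  then have "Hom S X \<subseteq> (\<lambda>y. v \<cdot> y) ` Hom S P" using span_minimal[OF sub] B(2) by simp
  then show thesis using that[OF direct_sum_in_add_closure[OF P] v] by blast
qed

end

section \<open>Triangles\<close>

context triangulated_category
begin

abbreviation \<Sigma>\<^sub>0 :: "'o \<Rightarrow> 'o" where "\<Sigma>\<^sub>0 \<equiv> susp_ob C"
abbreviation \<Sigma> :: "'m \<Rightarrow> 'm" where "\<Sigma> \<equiv> susp C"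

lemma susp_Ob: "X \<in> Ob C \<Longrightarrow> \<Sigma>\<^sub>0 X \<in> Ob C"
  and desusp_Ob: "X \<in> Ob C \<Longrightarrow> desusp_ob C X \<in> Ob C"
  and susp_ident: "X \<in> Ob C \<Longrightarrow> \<Sigma> (ident C X) = ident C (\<Sigma>\<^sub>0 X)"
  using susp_functor desusp_functor by (auto simp: linear_endofunctor_def)

lemmas susp_Hom = functor_Hom[OF susp_functor]
  and susp_cmp = functor_cmp[OF susp_functor]
  and susp_zero = functor_zero[OF susp_functor]
  and susp_diff = functor_diff[OF susp_functor]
  and susp_inject = functor_faithful[OF susp_functor desusp_functor desusp_susp]
  and susp_full = functor_full[OF susp_functor desusp_functor desusp_susp susp_desusp]
  and desusp_Hom = functor_Hom[OF desusp_functor]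
  and desusp_cmp = functor_cmp[OF desusp_functor]
  and desusp_diff = functor_diff[OF desusp_functor]
  and desusp_inject = functor_faithful[OF desusp_functor susp_functor susp_desusp]
  and desusp_full = functor_full[OF desusp_functor susp_functor susp_desusp desusp_susp]

lemma susp_eq_0: "\<lbrakk>f \<in> Hom X Y; \<Sigma> f = 0\<rbrakk> \<Longrightarrow> f = 0"
  using susp_inject[of f X Y 0] susp_zero[of X] Hom_zero[of X Y] Hom_dom[of f X Y] Hom_cod[of f X Y]
  by simp

lemma tri_Hom:
  assumes "tri C X Y Z f g h"
  shows "f \<in> Hom X Y" "g \<in> Hom Y Z" "h \<in> Hom Z (\<Sigma>\<^sub>0 X)"
  using tri_type[OF assms] susp_Ob by (auto simp: Hom_def)

lemma tri_rot: "tri C X Y Z f g h \<Longrightarrow> tri C Y Z (\<Sigma>\<^sub>0 X) g h (- \<Sigma> f)"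
  using tri_rotate tri_type by blast

lemma tri_unrot:
  assumes "tri C Y Z (\<Sigma>\<^sub>0 X) g h (- \<Sigma> f)" and "f \<in> Hom X Y"
  shows "tri C X Y Z f g h"
  using assms tri_type[OF assms(1)] tri_rotate[of X Y Z f g h] by (auto simp: Hom_def)

lemma zero_object_Hom:
  assumes "zero_object C Z"
  shows "f \<in> Hom X Z \<Longrightarrow> f = 0" and "f \<in> Hom Z X \<Longrightarrow> f = 0"
  using assms by (auto simp: zero_object_def Hom_def)

section \<open>Exactness of Hom functors on triangles\<close>

lemma tri_cmp_zero:
  assumes t: "tri C X Y Z f g h"
  shows "g \<cdot> f = 0"
proof -
  note H = tri_Hom[OF t]
  obtain N where N: "zero_object C N" using zero_object_exists by blast
  have X: "X \<in> Ob C" using Hom_dom[OF H(1)] .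
  have "f \<cdot> ident C X = f \<cdot> ident C X" ..
  \<comment> \<open>The trivial triangle on \<open>X\<close> maps to the given one by the identity
    and \<open>f\<close>. Its third object is zero, so \<open>g \<cdot> f\<close> passes through
    0.\<close>
  then obtain c where c: "c \<in> hom C N Z" "c \<cdot> 0 = g \<cdot> f"
    using tri_morphism[OF tri_ident[OF X N] t, of "ident C X" f] Hom_ident[OF X] H
    by (auto simp: Hom_def)
  then have "c \<in> Hom N Z" using N H by (auto simp: Hom_def zero_object_def)
  then show ?thesis using c cmp_zero by metis
qed

lemma tri_cmp_zero':
  assumes t: "tri C X Y Z f g h"
  shows "h \<cdot> g = 0" and "\<Sigma> f \<cdot> h = 0"
proof -
  show "h \<cdot> g = 0" using tri_cmp_zero[OF tri_rot[OF t]] .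
  have "(- \<Sigma> f) \<cdot> h = 0" using tri_cmp_zero[OF tri_rot[OF tri_rot[OF t]]] .
  then show "\<Sigma> f \<cdot> h = 0"
    using uminus_cmp[OF susp_Hom[OF tri_Hom(1)[OF t]] tri_Hom(3)[OF t]] by simp
qed

text \<open>Rotate both triangles, complete the square by the axiom, and undo the suspension by
  fullness. The signs from the two rotations cancel.\<close>

lemma tri_morphism_first:
  assumes t: "tri C X Y Z f g h" and t': "tri C X' Y' Z' f' g' h'"
    and b: "b \<in> Hom Y Y'" and c: "c \<in> Hom Z Z'" and eq: "c \<cdot> g = g' \<cdot> b"
  obtains a where "a \<in> Hom X X'" "b \<cdot> f = f' \<cdot> a" "\<Sigma> a \<cdot> h = h' \<cdot> c"
proof -
  note H = tri_Hom[OF t] and H' = tri_Hom[OF t']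
  obtain a' where "a' \<in> hom C (\<Sigma>\<^sub>0 X) (\<Sigma>\<^sub>0 X')" and a'h: "a' \<cdot> h = h' \<cdot> c"
    and a'f: "\<Sigma> b \<cdot> (- \<Sigma> f) = (- \<Sigma> f') \<cdot> a'"
    using tri_morphism[OF tri_rot[OF t] tri_rot[OF t'], of b c] b c eq by (auto simp: Hom_def)
  then have a': "a' \<in> Hom (\<Sigma>\<^sub>0 X) (\<Sigma>\<^sub>0 X')"
    using Hom_cod[OF H(3)] Hom_cod[OF H'(3)] by (simp add: Hom_def)
  obtain a where a: "a \<in> Hom X X'" and aa': "\<Sigma> a = a'"
    using susp_full[OF Hom_dom[OF H(1)] Hom_dom[OF H'(1)] a'] by blast
  have "\<Sigma> (b \<cdot> f) = \<Sigma> (f' \<cdot> a)"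
    using a'f cmp_uminus[OF susp_Hom[OF b] susp_Hom[OF H(1)]] uminus_cmp[OF susp_Hom[OF H'(1)] a']
      susp_cmp[OF b H(1)] susp_cmp[OF H'(1) a] aa' by simp
  then have "b \<cdot> f = f' \<cdot> a" by (rule susp_inject[OF Hom_cmp[OF b H(1)] Hom_cmp[OF H'(1) a]])
  then show thesis using that a aa' a'h by blast
qed

text \<open>A factorization of \<open>a\<close> through \<open>f\<close> is a morphism of triangles
  from the trivial triangle on \<open>W\<close>.\<close>

lemma tri_factor_first:
  assumes t: "tri C X Y Z f g h" and a: "a \<in> Hom W Y" and ga: "g \<cdot> a = 0"
  obtains b where "b \<in> Hom W X" "f \<cdot> b = a"
proof -
  note H = tri_Hom[OF t]
  obtain N where N: "zero_object C N" using zero_object_exists by blast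
  have W: "W \<in> Ob C" using Hom_dom[OF a] .
  have NOb: "N \<in> Ob C" using N by (simp add: zero_object_def)
  have 0: "0 \<in> Hom N Z" using Hom_zero[OF NOb Hom_cod[OF H(2)]] .
  have "0 \<cdot> 0 = g \<cdot> a" using ga cmp_zero[OF 0] by simp
  then obtain b where "b \<in> Hom W X" "a \<cdot> ident C W = f \<cdot> b"
    using tri_morphism_first[OF tri_ident[OF W N] t a 0] by metis
  then show thesis using that ident_right[OF a] by simp
qed

lemma tri_factor_second:
  assumes t: "tri C X Y Z f g h" and a: "a \<in> Hom W Z" and ha: "h \<cdot> a = 0"
  obtains b where "b \<in> Hom W Y" "g \<cdot> b = a"
  using tri_factor_first[OF tri_rot[OF t] a ha] .

lemma tri_factor_third:
  assumes t: "tri C X Y Z f g h" and a: "a \<in> Hom W (\<Sigma>\<^sub>0 X)" and fa: "\<Sigma> f \<cdot> a = 0"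
  obtains b where "b \<in> Hom W Z" "h \<cdot> b = a"
proof -
  have "(- \<Sigma> f) \<cdot> a = 0" using fa uminus_cmp[OF susp_Hom[OF tri_Hom(1)[OF t]] a] by simp
  then show thesis using tri_factor_first[OF tri_rot[OF tri_rot[OF t]] a] that by blast
qed

text \<open>Exactness at C(W, X), phrased after suspending so that the connecting arrow
  \<open>h\<close> applies without any desuspension.\<close>

lemma tri_exact_first:
  assumes t: "tri C X Y Z f g h" and a: "a \<in> Hom W X" and fa: "f \<cdot> a = 0"
  obtains b where "b \<in> Hom (\<Sigma>\<^sub>0 W) Z" "h \<cdot> b = \<Sigma> a"
proof -
  have "\<Sigma> f \<cdot> \<Sigma> a = 0"
    using susp_cmp[OF tri_Hom(1)[OF t] a] fa susp_zero[OF Hom_dom[OF a]] by simp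
  then show thesis using tri_factor_third[OF t susp_Hom[OF a]] that by blast
qed

lemma zero_object_susp:
  assumes N: "zero_object C N"
  shows "zero_object C (\<Sigma>\<^sub>0 N)"
proof -
  have NOb: "N \<in> Ob C" using N by (simp add: zero_object_def)
  have "ident C N = 0" using zero_object_Hom(1)[OF N Hom_ident[OF NOb]] .
  then have id0: "ident C (\<Sigma>\<^sub>0 N) = 0" using susp_ident[OF NOb] susp_zero[OF NOb] by simp
  have "f = 0" if "f \<in> Hom X (\<Sigma>\<^sub>0 N)" for f X
    using ident_left[OF that] id0 zero_cmp[OF that] by simp
  moreover have "f = 0" if "f \<in> Hom (\<Sigma>\<^sub>0 N) X" for f X
    using ident_right[OF that] id0 cmp_zero[OF that] by simp
  ultimately have "Hom X (\<Sigma>\<^sub>0 N) = {0} \<and> Hom (\<Sigma>\<^sub>0 N) X = {0}" if "X \<in> Ob C" for X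
    using Hom_zero[OF that susp_Ob[OF NOb]] Hom_zero[OF susp_Ob[OF NOb] that] by blast
  then show ?thesis using susp_Ob[OF NOb] by (simp add: zero_object_def Hom_eq_hom)
qed

lemma tri_extend_second:
  assumes t: "tri C X Y Z f g h" and a: "a \<in> Hom Y W" and af: "a \<cdot> f = 0"
  obtains b where "b \<in> Hom Z W" "b \<cdot> g = a"
proof -
  note H = tri_Hom[OF t]
  obtain N where N: "zero_object C N" using zero_object_exists by blast
  have W: "W \<in> Ob C" using Hom_cod[OF a] .
  have NOb: "N \<in> Ob C" using N by (simp add: zero_object_def)
  \<comment> \<open>The dual test triangle, with the zero object in front, is a trivial triangle
    rotated back; its third object is then \<Sigma> N, which must be zero as well.\<close>
  have t': "tri C N W W 0 (ident C W) 0"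
    using tri_ident[OF W zero_object_susp[OF N]] susp_zero[OF NOb] Hom_zero[OF NOb W]
    by (simp add: tri_unrot)
  have "a \<cdot> f = 0 \<cdot> 0" using af zero_cmp[OF Hom_zero[OF NOb NOb]] by simp
  moreover have "0 \<in> hom C X N" "a \<in> hom C Y W"
    using Hom_zero[OF Hom_dom[OF H(1)] NOb] a by (simp_all add: Hom_def)
  ultimately obtain b where b: "b \<in> hom C Z W" "b \<cdot> g = ident C W \<cdot> a"
    using tri_morphism[OF t t'] by blast
  have "b \<in> Hom Z W" using b(1) W Hom_cod[OF H(2)] by (simp add: Hom_def)
  then show thesis using that b(2) ident_left[OF a] by simp
qed

lemma tri_extend_third:
  assumes t: "tri C X Y Z f g h" and a: "a \<in> Hom Z W" and ag: "a \<cdot> g = 0"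
  obtains b where "b \<in> Hom (\<Sigma>\<^sub>0 X) W" "b \<cdot> h = a"
  using tri_extend_second[OF tri_rot[OF t] a ag] .

lemma tri_extend_first:
  assumes t: "tri C X Y Z f g h" and a: "a \<in> Hom X W" and ah: "\<Sigma> a \<cdot> h = 0"
  obtains b where "b \<in> Hom Y W" "b \<cdot> f = a"
proof -
  note H = tri_Hom[OF t]
  obtain b' where b': "b' \<in> Hom (\<Sigma>\<^sub>0 Y) (\<Sigma>\<^sub>0 W)" "b' \<cdot> (- \<Sigma> f) = \<Sigma> a"
    using tri_extend_third[OF tri_rot[OF t] susp_Hom[OF a] ah] .
  \<comment> \<open>The minus sign absorbs the one that rotation puts on \<Sigma> f.\<close>
  obtain b where b: "b \<in> Hom Y W" "\<Sigma> b = - b'"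
    using susp_full[OF Hom_cod[OF H(1)] Hom_cod[OF a] Hom_uminus[OF b'(1)]] by blast
  have "\<Sigma> (b \<cdot> f) = \<Sigma> a"
    using susp_cmp[OF b(1) H(1)] b b' uminus_cmp[OF b'(1) susp_Hom[OF H(1)]]
      cmp_uminus[OF b'(1) susp_Hom[OF H(1)]] by simp
  then have "b \<cdot> f = a" by (rule susp_inject[OF Hom_cmp[OF b(1) H(1)] a])
  then show thesis using that b by blast
qed

lemma tri_morphism_third:
  assumes t: "tri C X Y Z f g h" and t': "tri C X' Y' Z' f' g' h'"
    and a: "a \<in> Hom X X'" and c: "c \<in> Hom Z Z'" and eq: "\<Sigma> a \<cdot> h = h' \<cdot> c"
  obtains b where "b \<in> Hom Y Y'" "b \<cdot> f = f' \<cdot> a" "c \<cdot> g = g' \<cdot> b"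
proof -
  note H = tri_Hom[OF t] and H' = tri_Hom[OF t']
  obtain b where b: "b \<in> Hom Y Y'" "c \<cdot> g = g' \<cdot> b" "\<Sigma> b \<cdot> (- \<Sigma> f) = (- \<Sigma> f') \<cdot> \<Sigma> a"
    using tri_morphism_first[OF tri_rot[OF t] tri_rot[OF t'] c susp_Hom[OF a] eq] by blast
  have "\<Sigma> (b \<cdot> f) = \<Sigma> (f' \<cdot> a)"
    using b(3) cmp_uminus[OF susp_Hom[OF b(1)] susp_Hom[OF H(1)]]
      uminus_cmp[OF susp_Hom[OF H'(1)] susp_Hom[OF a]]
      susp_cmp[OF b(1) H(1)] susp_cmp[OF H'(1) a] by simp
  then have "b \<cdot> f = f' \<cdot> a" by (rule susp_inject[OF Hom_cmp[OF b(1) H(1)] Hom_cmp[OF H'(1) a]])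
  then show thesis using that b by blast
qed

text \<open>The axiom makes \<open>v\<close> the first arrow of a triangle. To rotate back, the cone
  must literally be a suspension, so it is replaced by the isomorphic
  \<open>\<Sigma>\<^sub>0 (desusp_ob C W)\<close> and the third arrow is transported along
  \<open>susp_unit\<close>.\<close>

lemma tri_complete_right:
  assumes v: "v \<in> Hom Y Z"
  obtains X f h where "tri C X Y Z f v h"
proof -
  have YZ: "Y \<in> Ob C" "Z \<in> Ob C" using v Hom_dom Hom_cod by blast+
  obtain W g k where t: "tri C Y Z W v g k"
    using tri_exists[OF YZ, of v] v unfolding Hom_def by blast
  note H = tri_Hom[OF t]
  have W: "W \<in> Ob C" using Hom_cod[OF H(2)] .
  define X where "X = desusp_ob C W"
  have X: "X \<in> Ob C" unfolding X_def by (rule desusp_Ob[OF W])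
  have "iso_arrow C (\<Sigma>\<^sub>0 X) W (susp_unit C W)"
    using susp_desusp W by (simp add: natural_iso_to_identity_def X_def)
  then obtain \<theta> where \<kappa>: "susp_unit C W \<in> Hom (\<Sigma>\<^sub>0 X) W" and \<theta>: "\<theta> \<in> Hom W (\<Sigma>\<^sub>0 X)"
    and \<theta>\<kappa>: "\<theta> \<cdot> susp_unit C W = ident C (\<Sigma>\<^sub>0 X)" and \<kappa>\<theta>: "susp_unit C W \<cdot> \<theta> = ident C W"
    by (rule iso_arrowE[OF _ susp_Ob[OF X] W])
  define k' where "k' = k \<cdot> susp_unit C W"
  have k': "k' \<in> Hom (\<Sigma>\<^sub>0 X) (\<Sigma>\<^sub>0 Y)" unfolding k'_def by (rule Hom_cmp[OF H(3) \<kappa>])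
  have gv: "\<theta> \<cdot> g \<in> Hom Z (\<Sigma>\<^sub>0 X)" by (rule Hom_cmp[OF \<theta> H(2)])
  have e1: "ident C Z \<cdot> v = v \<cdot> ident C Y" using ident_left[OF v] ident_right[OF v] by simp
  have e2: "\<theta> \<cdot> g = (\<theta> \<cdot> g) \<cdot> ident C Z" using ident_right[OF gv] by simp
  have "k' \<cdot> \<theta> = k"
    unfolding k'_def using assoc[OF H(3) \<kappa> \<theta>] \<kappa>\<theta> ident_right[OF H(3)] by simp
  then have e3: "\<Sigma> (ident C Y) \<cdot> k = k' \<cdot> \<theta>"
    using susp_ident[OF YZ(1)] ident_left[OF H(3)] by simp
  have "tri C Y Z (\<Sigma>\<^sub>0 X) v (\<theta> \<cdot> g) k'"
    using tri_iso[OF t YZ susp_Ob[OF X] _ _ _ iso_arrow_ident[OF YZ(1)] iso_arrow_ident[OF YZ(2)]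
        iso_arrowI[OF \<theta> \<kappa> \<kappa>\<theta> \<theta>\<kappa>] e1 e2 e3] v gv k'
    by (simp add: Hom_def)
  moreover obtain f where f: "f \<in> Hom X Y" "\<Sigma> f = - k'"
    using susp_full[OF X YZ(1) Hom_uminus[OF k']] by blast
  ultimately have "tri C X Y Z f v (\<theta> \<cdot> g)" by (simp add: tri_unrot)
  then show thesis by (rule that)
qed

text \<open>With a zero connecting arrow, \<open>g\<close> has a section \<open>s\<close> and
  \<open>f\<close> is monic. The idempotent \<open>ident C Y - s \<cdot> g\<close> factors as
  \<open>f \<cdot> r\<close>, and cancelling \<open>f\<close> gives the remaining identities. The
  contrapositive supplies nonzero \<epsilon> and \<epsilon>' from non-split triangles.\<close>

lemma split_triangle_if_zero:
  assumes t: "tri C X Y Z f g 0"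
  shows "split_triangle C X Y Z f g 0"
proof -
  note H = tri_Hom[OF t]
  have Ob: "X \<in> Ob C" "Y \<in> Ob C" "Z \<in> Ob C" using tri_type[OF t] by auto
  have f_mono: "a = 0" if a: "a \<in> Hom W X" and fa: "f \<cdot> a = 0" for a W
  proof -
    obtain b where "b \<in> Hom (\<Sigma>\<^sub>0 W) Z" "0 \<cdot> b = \<Sigma> a" using tri_exact_first[OF t a fa] .
    then have "\<Sigma> a = 0" using zero_cmp by metis
    then show ?thesis using susp_eq_0[OF a] by blast
  qed
  obtain s where s: "s \<in> Hom Z Y" and gs: "g \<cdot> s = ident C Z"
    using tri_factor_second[OF t Hom_ident[OF Ob(3)] zero_cmp[OF Hom_ident[OF Ob(3)]]] .
  have sg: "s \<cdot> g \<in> Hom Y Y" by (rule Hom_cmp[OF s H(2)])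
  have "g \<cdot> (ident C Y - s \<cdot> g) = 0"
    using cmp_diff[OF H(2) Hom_ident[OF Ob(2)] sg] ident_right[OF H(2)] assoc[OF H(2) s H(2)] gs
      ident_left[OF H(2)] by simp
  then obtain r where r: "r \<in> Hom Y X" and fr: "f \<cdot> r = ident C Y - s \<cdot> g"
    using tri_factor_first[OF t Hom_diff[OF Hom_ident[OF Ob(2)] sg]] by blast
  have gf: "g \<cdot> f = 0" by (rule tri_cmp_zero[OF t])
  have rf_id: "r \<cdot> f - ident C X \<in> Hom X X" by (intro Hom_diff Hom_cmp[OF r H(1)] Hom_ident Ob)
  have "f \<cdot> (r \<cdot> f) = f"
    using assoc[OF H(1) r H(1)] fr diff_cmp[OF Hom_ident[OF Ob(2)] sg H(1)] ident_left[OF H(1)]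
      assoc[OF s H(2) H(1)] gf cmp_zero[OF s] by simp
  then have "f \<cdot> (r \<cdot> f - ident C X) = 0"
    using cmp_diff[OF H(1) Hom_cmp[OF r H(1)] Hom_ident[OF Ob(1)]] ident_right[OF H(1)] by simp
  then have rf: "r \<cdot> f = ident C X" using f_mono[OF rf_id] by simp
  have "f \<cdot> (r \<cdot> s) = 0"
    using assoc[OF H(1) r s] fr diff_cmp[OF Hom_ident[OF Ob(2)] sg s] ident_left[OF s]
      assoc[OF s H(2) s] gs ident_right[OF s] by simp
  then have rs: "r \<cdot> s = 0" using f_mono[OF Hom_cmp[OF r s]] by blast
  have "f \<cdot> r + s \<cdot> g = ident C Y" using fr by simp
  from direct_sum_via_pairI[OF H(1) s r H(2) rf gs rs gf this]
  show ?thesis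
    unfolding split_triangle_def using t
    by (intro conjI exI[of _ "\<lambda>j. if j = 0 then f else s"] exI[of _ "\<lambda>j. if j = 0 then r else g"])
      auto
qed

section \<open>The natural bijection between C(X, \<Sigma> Y) and arrows from the desuspension of X
  to Y\<close>

lemma desusp_unit_iso:
  assumes "X \<in> Ob C"
  obtains \<theta> where "desusp_unit C X \<in> Hom (desusp_ob C (\<Sigma>\<^sub>0 X)) X" "\<theta> \<in> Hom X (desusp_ob C (\<Sigma>\<^sub>0 X))"
    "\<theta> \<cdot> desusp_unit C X = ident C (desusp_ob C (\<Sigma>\<^sub>0 X))" "desusp_unit C X \<cdot> \<theta> = ident C X"
proof -
  have "iso_arrow C (desusp_ob C (\<Sigma>\<^sub>0 X)) X (desusp_unit C X)"
    using desusp_susp assms by (simp add: natural_iso_to_identity_def)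
  then show thesis by (rule iso_arrowE[OF _ desusp_Ob[OF susp_Ob[OF assms]] assms]) (rule that)
qed

lemma desusp_unit_Hom: "X \<in> Ob C \<Longrightarrow> desusp_unit C X \<in> Hom (desusp_ob C (\<Sigma>\<^sub>0 X)) X"
  using desusp_unit_iso by metis

lemma desusp_unit_natural:
  "f \<in> Hom X Y \<Longrightarrow> desusp_unit C Y \<cdot> desusp C (\<Sigma> f) = f \<cdot> desusp_unit C X"
  using desusp_susp by (auto simp: natural_iso_to_identity_def Hom_def)

lemma desusp_to_Hom:
  assumes Y: "Y \<in> Ob C" and g: "g \<in> Hom X (\<Sigma>\<^sub>0 Y)"
  shows "desusp_to C Y g \<in> Hom (desusp_ob C X) Y"
  unfolding desusp_to_def by (rule Hom_cmp[OF desusp_unit_Hom[OF Y] desusp_Hom[OF g]])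

lemma desusp_to_diff:
  assumes Y: "Y \<in> Ob C" and g: "g \<in> Hom X (\<Sigma>\<^sub>0 Y)" and g': "g' \<in> Hom X (\<Sigma>\<^sub>0 Y)"
  shows "desusp_to C Y (g - g') = desusp_to C Y g - desusp_to C Y g'"
  unfolding desusp_to_def desusp_diff[OF g g']
  by (rule cmp_diff[OF desusp_unit_Hom[OF Y] desusp_Hom[OF g] desusp_Hom[OF g']])

lemma desusp_to_cmp_right:
  assumes Y: "Y \<in> Ob C" and g: "g \<in> Hom X (\<Sigma>\<^sub>0 Y)" and u: "u \<in> Hom X' X"
  shows "desusp_to C Y (g \<cdot> u) = desusp_to C Y g \<cdot> desusp C u"
  unfolding desusp_to_def desusp_cmp[OF g u]
  by (rule assoc[OF desusp_unit_Hom[OF Y] desusp_Hom[OF g] desusp_Hom[OF u], symmetric])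

lemma desusp_to_cmp_left:
  assumes v: "v \<in> Hom Y Y'" and g: "g \<in> Hom X (\<Sigma>\<^sub>0 Y)"
  shows "desusp_to C Y' (\<Sigma> v \<cdot> g) = v \<cdot> desusp_to C Y g"
proof -
  note D = desusp_unit_Hom[OF Hom_dom[OF v]] desusp_unit_Hom[OF Hom_cod[OF v]]
  show ?thesis
    unfolding desusp_to_def desusp_cmp[OF susp_Hom[OF v] g]
    using assoc[OF D(2) desusp_Hom[OF susp_Hom[OF v]] desusp_Hom[OF g]]
      assoc[OF v D(1) desusp_Hom[OF g]] desusp_unit_natural[OF v] by simp
qed

lemma desusp_to_inject:
  assumes Y: "Y \<in> Ob C" and g: "g \<in> Hom X (\<Sigma>\<^sub>0 Y)" and g': "g' \<in> Hom X (\<Sigma>\<^sub>0 Y)"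
    and eq: "desusp_to C Y g = desusp_to C Y g'"
  shows "g = g'"
proof -
  obtain \<theta> where \<eta>: "desusp_unit C Y \<in> Hom (desusp_ob C (\<Sigma>\<^sub>0 Y)) Y"
    and \<theta>: "\<theta> \<in> Hom Y (desusp_ob C (\<Sigma>\<^sub>0 Y))"
    and \<theta>\<eta>: "\<theta> \<cdot> desusp_unit C Y = ident C (desusp_ob C (\<Sigma>\<^sub>0 Y))"
    by (rule desusp_unit_iso[OF Y])
  have "\<theta> \<cdot> desusp_to C Y a = desusp C a" if a: "a \<in> Hom X (\<Sigma>\<^sub>0 Y)" for a
    unfolding desusp_to_def
    using assoc[OF \<theta> \<eta> desusp_Hom[OF a]] \<theta>\<eta> ident_left[OF desusp_Hom[OF a]] by simp
  from this[OF g] this[OF g'] eq have "desusp C g = desusp C g'" by simp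
  then show ?thesis by (rule desusp_inject[OF g g'])
qed

lemma desusp_to_surj:
  assumes X: "X \<in> Ob C" and f: "f \<in> Hom (desusp_ob C X) Y"
  obtains g where "g \<in> Hom X (\<Sigma>\<^sub>0 Y)" "desusp_to C Y g = f"
proof -
  have Y: "Y \<in> Ob C" using Hom_cod[OF f] .
  obtain \<theta> where \<eta>: "desusp_unit C Y \<in> Hom (desusp_ob C (\<Sigma>\<^sub>0 Y)) Y"
    and \<theta>: "\<theta> \<in> Hom Y (desusp_ob C (\<Sigma>\<^sub>0 Y))"
    and \<eta>\<theta>: "desusp_unit C Y \<cdot> \<theta> = ident C Y"
    by (rule desusp_unit_iso[OF Y])
  obtain g where g: "g \<in> Hom X (\<Sigma>\<^sub>0 Y)" "desusp C g = \<theta> \<cdot> f"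
    using desusp_full[OF X susp_Ob[OF Y] Hom_cmp[OF \<theta> f]] by blast
  have "desusp_to C Y g = f"
    unfolding desusp_to_def g(2) using assoc[OF \<eta> \<theta> f] \<eta>\<theta> ident_left[OF f] by simp
  then show thesis using that g by blast
qed

end

section \<open>Cluster-tilting objects in 2-Calabi--Yau categories\<close>

text \<open>Fixes one Calabi--Yau duality \<Phi>, read as a pairing of C(X, \<Sigma> Y) with C(Y,
  \<Sigma> X). No symmetry between \<open>\<Phi> X Y\<close> and \<open>\<Phi> Y X\<close> is
  assumed, so nondegeneracy on the left comes from injectivity and on the right from
  surjectivity.\<close>

locale cy2_category = triangulated_category C
  for C :: "('k::field, 'o, 'm::ab_group_add, 'z) triangulated_data_scheme" (structure) +
  fixes \<Phi> :: "'o \<Rightarrow> 'o \<Rightarrow> 'm \<Rightarrow> 'm \<Rightarrow> 'k"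
  assumes hom_finite: "hom_finite C"
    and form_bij: "\<lbrakk>X \<in> Ob C; Y \<in> Ob C\<rbrakk> \<Longrightarrow>
        bij_betw (\<Phi> X Y) (hom C X (susp_ob C Y)) (dual_space (scale C) (hom C Y (susp_ob C X)))"
    and form_add_left: "\<lbrakk>X \<in> Ob C; Y \<in> Ob C; g \<in> hom C X (susp_ob C Y); g' \<in> hom C X (susp_ob C Y);
        h \<in> hom C Y (susp_ob C X)\<rbrakk> \<Longrightarrow> \<Phi> X Y (g + g') h = \<Phi> X Y g h + \<Phi> X Y g' h"
    and form_scale_left: "\<lbrakk>X \<in> Ob C; Y \<in> Ob C; g \<in> hom C X (susp_ob C Y); h \<in> hom C Y (susp_ob C X)\<rbrakk>
        \<Longrightarrow> \<Phi> X Y (scale C a g) h = a * \<Phi> X Y g h"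
    and form_natural: "\<lbrakk>X \<in> Ob C; X' \<in> Ob C; Y \<in> Ob C; Y' \<in> Ob C; u \<in> hom C X' X; v \<in> hom C Y Y';
        g \<in> hom C X (susp_ob C Y); h \<in> hom C Y' (susp_ob C X')\<rbrakk>
        \<Longrightarrow> \<Phi> X' Y' (susp C v \<cdot> (g \<cdot> u)) h = \<Phi> X Y g (susp C u \<cdot> (h \<cdot> v))"
begin

section \<open>The Calabi--Yau pairing as a nondegenerate bilinear form\<close>

lemma form_zero_left:
  assumes "X \<in> Ob C" "h \<in> Hom Y (\<Sigma>\<^sub>0 X)"
  shows "\<Phi> X Y 0 h = 0"
  using form_scale_left[of X Y 0 h 0] Hom_zero[of X "\<Sigma>\<^sub>0 Y"] susp_Ob[of Y] assms
  by (simp add: Hom_def)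

lemma form_dual:
  assumes g: "g \<in> Hom X (\<Sigma>\<^sub>0 Y)" and Y: "Y \<in> Ob C"
  shows "\<Phi> X Y g \<in> dual_space (scale C) (Hom Y (\<Sigma>\<^sub>0 X))"
  using bij_betw_apply[OF form_bij[OF Hom_dom[OF g] Y], of g] g Y susp_Ob
  by (simp add: Hom_def)

lemma form_add_right:
  assumes "g \<in> Hom X (\<Sigma>\<^sub>0 Y)" and "h \<in> Hom Y (\<Sigma>\<^sub>0 X)" and "h' \<in> Hom Y (\<Sigma>\<^sub>0 X)"
  shows "\<Phi> X Y g (h + h') = \<Phi> X Y g h + \<Phi> X Y g h'"
  using form_dual[OF assms(1) Hom_dom[OF assms(2)]] assms by (simp add: dual_space_def)

lemma form_scale_right:
  assumes "g \<in> Hom X (\<Sigma>\<^sub>0 Y)" and "h \<in> Hom Y (\<Sigma>\<^sub>0 X)"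
  shows "\<Phi> X Y g (scale C a h) = a * \<Phi> X Y g h"
  using form_dual[OF assms(1) Hom_dom[OF assms(2)]] assms by (simp add: dual_space_def)

lemma form_zero_right:
  assumes "g \<in> Hom X (\<Sigma>\<^sub>0 Y)" and "Y \<in> Ob C"
  shows "\<Phi> X Y g 0 = 0"
  using form_scale_right[OF assms(1) Hom_zero[OF assms(2) susp_Ob[OF Hom_dom[OF assms(1)]]], of 0]
  by simp

lemma form_uminus_right:
  assumes "g \<in> Hom X (\<Sigma>\<^sub>0 Y)" and "h \<in> Hom Y (\<Sigma>\<^sub>0 X)"
  shows "\<Phi> X Y g (- h) = - \<Phi> X Y g h"
  using form_add_right[OF assms Hom_uminus[OF assms(2)]] form_zero_right[OF assms(1) Hom_dom[OF assms(2)]]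
  by (simp add: eq_neg_iff_add_eq_0 add.commute)

lemma form_diff_left:
  assumes "g \<in> Hom X (\<Sigma>\<^sub>0 Y)" and "g' \<in> Hom X (\<Sigma>\<^sub>0 Y)" and "h \<in> Hom Y (\<Sigma>\<^sub>0 X)"
  shows "\<Phi> X Y (g - g') h = \<Phi> X Y g h - \<Phi> X Y g' h"
proof -
  have "g - g' \<in> Hom X (\<Sigma>\<^sub>0 Y)" by (rule Hom_diff[OF assms(1,2)])
  then have "\<Phi> X Y ((g - g') + g') h = \<Phi> X Y (g - g') h + \<Phi> X Y g' h"
    using form_add_left[of X Y "g - g'" g' h] assms by (simp add: Hom_def)
  then show ?thesis by simp
qed

lemma form_nondegenerate:
  assumes g: "g \<in> Hom X (\<Sigma>\<^sub>0 Y)" and Y: "Y \<in> Ob C" and 0: "\<And>h. h \<in> Hom Y (\<Sigma>\<^sub>0 X) \<Longrightarrow> \<Phi> X Y g h = 0"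
  shows "g = 0"
proof -
  have X: "X \<in> Ob C" using Hom_dom[OF g] .
  have z: "0 \<in> Hom X (\<Sigma>\<^sub>0 Y)" using Hom_zero[OF X susp_Ob[OF Y]] .
  \<comment> \<open>Members of \<open>dual_space\<close> are extensional, so agreement on the
    Hom-space is equality of functions and injectivity of \<Phi> applies.\<close>
  have "\<Phi> X Y g = \<Phi> X Y 0"
  proof (rule extensionalityI)
    show "\<Phi> X Y g \<in> extensional (Hom Y (\<Sigma>\<^sub>0 X))" "\<Phi> X Y 0 \<in> extensional (Hom Y (\<Sigma>\<^sub>0 X))"
      using form_dual[OF g Y] form_dual[OF z Y] by (simp_all add: dual_space_def)
    show "\<Phi> X Y g h = \<Phi> X Y 0 h" if "h \<in> Hom Y (\<Sigma>\<^sub>0 X)" for h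
      using 0[OF that] form_zero_left[OF X that] by simp
  qed
  then show ?thesis
    using bij_betw_imp_inj_on[OF form_bij[OF X Y]] g z by (auto simp: inj_on_def Hom_def)
qed

text \<open>A functional on the whole ambient space restricts to an element of the dual of the
  Hom-space, where \<Phi> is surjective.\<close>

lemma form_represents:
  assumes X: "X \<in> Ob C" and Y: "Y \<in> Ob C"
    and add: "\<And>x y. \<psi> (x + y) = \<psi> x + \<psi> y" and scale: "\<And>a x. \<psi> (scale C a x) = a * \<psi> x"
  obtains g where "g \<in> Hom X (\<Sigma>\<^sub>0 Y)" "\<forall>h \<in> Hom Y (\<Sigma>\<^sub>0 X). \<Phi> X Y g h = \<psi> h"
proof -
  let ?H = "hom C Y (\<Sigma>\<^sub>0 X)"
  have sub: "subspace ?H" using hom_subspace[OF Y susp_Ob[OF X]] .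
  have "restrict \<psi> ?H \<in> dual_space (scale C) ?H"
    using subspace_add[OF sub] subspace_scale[OF sub] add scale by (simp add: dual_space_def)
  then have "restrict \<psi> ?H \<in> \<Phi> X Y ` hom C X (\<Sigma>\<^sub>0 Y)"
    using bij_betw_imp_surj_on[OF form_bij[OF X Y]] by simp
  then obtain g where "g \<in> hom C X (\<Sigma>\<^sub>0 Y)" "\<Phi> X Y g = restrict \<psi> ?H" by force
  then show thesis using that[of g] X Y susp_Ob by (simp add: Hom_def)
qed

text \<open>Naturality with one arrow set to an identity: precomposition with \<open>u\<close> is
  adjoint to postcomposition with \<Sigma> u. This adjunction and its mirror image below do all the
  transposing later on.\<close>

lemma form_natural_left:
  assumes g: "g \<in> Hom X (\<Sigma>\<^sub>0 Y)" and Y: "Y \<in> Ob C" and u: "u \<in> Hom X' X" and h: "h \<in> Hom Y (\<Sigma>\<^sub>0 X')"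
  shows "\<Phi> X' Y (g \<cdot> u) h = \<Phi> X Y g (\<Sigma> u \<cdot> h)"
  using form_natural[of X X' Y Y u "ident C Y" g h] assms ident_in_hom[OF Y] susp_ident[OF Y]
    ident_left[OF Hom_cmp[OF g u]] ident_right[OF h] by (simp add: Hom_def)

lemma form_natural_right:
  assumes g: "g \<in> Hom X (\<Sigma>\<^sub>0 Y)" and v: "v \<in> Hom Y Y'" and h: "h \<in> Hom Y' (\<Sigma>\<^sub>0 X)"
  shows "\<Phi> X Y' (\<Sigma> v \<cdot> g) h = \<Phi> X Y g (h \<cdot> v)"
proof -
  have X: "X \<in> Ob C" using Hom_dom[OF g] .
  show ?thesis
    using form_natural[of X X Y Y' "ident C X" v g h] assms ident_in_hom[OF X] susp_ident[OF X]
      ident_right[OF g] ident_left[OF Hom_cmp[OF h v]] by (simp add: Hom_def)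
qed

section \<open>Cluster-tilting objects and rigidity\<close>

lemma cluster_tilting_Ob: "cluster_tilting C S \<Longrightarrow> S \<in> Ob C"
  by (simp add: cluster_tilting_def)

lemma cluster_tilting_rigid:
  assumes "cluster_tilting C S" and "f \<in> Hom S (\<Sigma>\<^sub>0 S)"
  shows "f = 0"
  using assms by (auto simp: cluster_tilting_def Hom_def)

lemma cluster_tilting_maximal:
  assumes S: "cluster_tilting C S" and A: "A \<in> Ob C" and 0: "\<And>f. f \<in> Hom A (\<Sigma>\<^sub>0 S) \<Longrightarrow> f = 0"
  shows "A \<in> add_closure C S"
proof -
  have "Hom A (\<Sigma>\<^sub>0 S) = {0}"
    using 0 Hom_zero[OF A susp_Ob[OF cluster_tilting_Ob[OF S]]] by blast
  then have "hom C A (\<Sigma>\<^sub>0 S) = {0}"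
    using Hom_eq_hom[OF A susp_Ob[OF cluster_tilting_Ob[OF S]]] by simp
  then show ?thesis using S A by (simp add: cluster_tilting_def)
qed

text \<open>Allows the results for \<open>T\<close> to be applied to \<Sigma> T, whose ideal occurs
  in clause (c) of condition (ii). For maximality, an object \<open>X\<close> is desuspended,
  recognized in the additive closure of \<open>S\<close>, and brought back along
  \<open>susp_unit\<close>.\<close>

lemma cluster_tilting_susp:
  assumes S: "cluster_tilting C S"
  shows "cluster_tilting C (\<Sigma>\<^sub>0 S)"
proof -
  have SOb: "S \<in> Ob C" using cluster_tilting_Ob[OF S] .
  have rigid: "f = 0" if f: "f \<in> Hom (\<Sigma>\<^sub>0 S) (\<Sigma>\<^sub>0 (\<Sigma>\<^sub>0 S))" for f
  proof -
    obtain f' where f': "f' \<in> Hom S (\<Sigma>\<^sub>0 S)" "\<Sigma> f' = f"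
      using susp_full[OF SOb susp_Ob[OF SOb] f] by blast
    then show ?thesis using cluster_tilting_rigid[OF S f'(1)] susp_zero[OF SOb] by simp
  qed
  have maximal: "X \<in> add_closure C (\<Sigma>\<^sub>0 S)"
    if X: "X \<in> Ob C" and 0: "\<And>f. f \<in> Hom X (\<Sigma>\<^sub>0 (\<Sigma>\<^sub>0 S)) \<Longrightarrow> f = 0" for X
  proof -
    define A where "A = desusp_ob C X"
    have A: "A \<in> Ob C" unfolding A_def by (rule desusp_Ob[OF X])
    have "iso_arrow C (\<Sigma>\<^sub>0 A) X (susp_unit C X)"
      using susp_desusp X by (simp add: natural_iso_to_identity_def A_def)
    then obtain \<theta> where \<kappa>: "susp_unit C X \<in> Hom (\<Sigma>\<^sub>0 A) X" and \<theta>: "\<theta> \<in> Hom X (\<Sigma>\<^sub>0 A)"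
      and iso: "\<theta> \<cdot> susp_unit C X = ident C (\<Sigma>\<^sub>0 A)" "susp_unit C X \<cdot> \<theta> = ident C X"
      by (rule iso_arrowE[OF _ susp_Ob[OF A] X])
    have "A \<in> add_closure C S"
    proof (rule cluster_tilting_maximal[OF S A])
      fix f assume f: "f \<in> Hom A (\<Sigma>\<^sub>0 S)"
      have \<Sigma>f: "\<Sigma> f \<in> Hom (\<Sigma>\<^sub>0 A) (\<Sigma>\<^sub>0 (\<Sigma>\<^sub>0 S))" by (rule susp_Hom[OF f])
      have "\<Sigma> f = (\<Sigma> f \<cdot> \<theta>) \<cdot> susp_unit C X"
        using assoc[OF \<Sigma>f \<theta> \<kappa>] iso ident_right[OF \<Sigma>f] by simp
      also have "\<dots> = 0" using 0[OF Hom_cmp[OF \<Sigma>f \<theta>]] zero_cmp[OF \<kappa>] by simp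
      finally show "f = 0" by (rule susp_eq_0[OF f])
    qed
    then have "\<Sigma>\<^sub>0 A \<in> add_closure C (\<Sigma>\<^sub>0 S)" by (rule add_closure_functor[OF susp_functor SOb])
    then show ?thesis by (rule add_closure_iso[OF _ \<kappa> \<theta> iso])
  qed
  have Ob: "\<Sigma>\<^sub>0 S \<in> Ob C" "\<Sigma>\<^sub>0 (\<Sigma>\<^sub>0 S) \<in> Ob C" by (intro susp_Ob SOb)+
  have "hom C (\<Sigma>\<^sub>0 S) (\<Sigma>\<^sub>0 (\<Sigma>\<^sub>0 S)) = {0}"
    using rigid Hom_zero[OF Ob] unfolding Hom_eq_hom[OF Ob] by blast
  moreover have "X \<in> add_closure C (\<Sigma>\<^sub>0 S)"
    if "X \<in> Ob C" "hom C X (\<Sigma>\<^sub>0 (\<Sigma>\<^sub>0 S)) = {0}" for X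
    using that by (intro maximal) (simp_all add: Hom_def)
  ultimately show ?thesis
    unfolding cluster_tilting_def using Ob by blast
qed

text \<open>The decomposition of the identity of \<open>A\<close> is convenient when
  \<open>A\<close> is the domain, giving C(A, \<Sigma> S) = 0; the pairing carries this over to C(S,
  \<Sigma> A).\<close>

lemma add_closure_rigid:
  assumes S: "cluster_tilting C S" and A: "A \<in> add_closure C S" and f: "f \<in> Hom S (\<Sigma>\<^sub>0 A)"
  shows "f = 0"
proof (rule form_nondegenerate[OF f add_closure_Ob[OF A]])
  fix h assume h: "h \<in> Hom A (\<Sigma>\<^sub>0 S)"
  have "ghost S A h"
    using cluster_tilting_rigid[OF S Hom_cmp[OF h]] by (simp add: ghost_def)
  then have "h = 0" using ghost_add_closure_zero[OF cluster_tilting_Ob[OF S] A h] by blast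
  then show "\<Phi> S A f h = 0" using form_zero_right[OF f add_closure_Ob[OF A]] by simp
qed

section \<open>Ghosts, ideals and mutual annihilators\<close>

lemma ghost_from_add_susp:
  assumes S: "cluster_tilting C S" and A: "A \<in> add_closure C S"
    and w: "w \<in> Hom X (\<Sigma>\<^sub>0 A)" and c: "c \<in> Hom (\<Sigma>\<^sub>0 A) Y"
  shows "ghost S X (c \<cdot> w)"
  unfolding ghost_def
proof
  fix s assume s: "s \<in> Hom S X"
  show "(c \<cdot> w) \<cdot> s = 0"
    using assoc[OF c w s] add_closure_rigid[OF S A Hom_cmp[OF w s]] cmp_zero[OF c] by simp
qed

text \<open>Complete a right approximation to a triangle. An arrow S to \<Sigma> A dies in \<Sigma>
  P by rigidity, so it factors through \<open>w\<close>; the factor lifts through \<open>v\<close>,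
  and \<open>w \<cdot> v = 0\<close>. Hence C(S, \<Sigma> A) = 0, by duality C(A, \<Sigma> S) = 0,
  and maximality puts \<open>A\<close> in the additive closure.\<close>

lemma approximation_triangle:
  assumes S: "cluster_tilting C S" and X: "X \<in> Ob C"
  obtains A P k v w where "A \<in> add_closure C S" "P \<in> add_closure C S" "tri C A P X k v w"
    "\<And>s. s \<in> Hom S X \<Longrightarrow> \<exists>y \<in> Hom S P. v \<cdot> y = s"
proof -
  have SOb: "S \<in> Ob C" using cluster_tilting_Ob[OF S] .
  obtain P v where P: "P \<in> add_closure C S" and v: "v \<in> Hom P X"
    and lift: "\<And>s. s \<in> Hom S X \<Longrightarrow> \<exists>y \<in> Hom S P. v \<cdot> y = s"
    using right_approximation[OF hom_finite SOb X] by blast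
  obtain A k w where t: "tri C A P X k v w" using tri_complete_right[OF v] by blast
  note H = tri_Hom[OF t]
  have A: "A \<in> Ob C" using Hom_dom[OF H(1)] .
  have van: "h = 0" if h: "h \<in> Hom S (\<Sigma>\<^sub>0 A)" for h
  proof -
    have "\<Sigma> k \<cdot> h = 0" by (rule add_closure_rigid[OF S P Hom_cmp[OF susp_Hom[OF H(1)] h]])
    then obtain b where b: "b \<in> Hom S X" "w \<cdot> b = h" using tri_factor_third[OF t h] by blast
    then obtain y where y: "y \<in> Hom S P" "v \<cdot> y = b" using lift by blast
    then show ?thesis
      using b assoc[OF H(3) v y(1)] tri_cmp_zero'(1)[OF t] zero_cmp[OF y(1)] by simp
  qed
  have "A \<in> add_closure C S"
  proof (rule cluster_tilting_maximal[OF S A])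
    fix f assume f: "f \<in> Hom A (\<Sigma>\<^sub>0 S)"
    show "f = 0"
      using form_nondegenerate[OF f SOb] van form_zero_right[OF f SOb] by blast
  qed
  then show thesis using that P t lift by blast
qed

text \<open>\<open>g \<cdot> v\<close> is a ghost on an object of the additive closure of
  \<open>S\<close>, hence zero, so \<open>g\<close> extends along \<open>w\<close>.\<close>

lemma ghost_factor:
  assumes S: "cluster_tilting C S" and t: "tri C A P X k v w" and P: "P \<in> add_closure C S"
    and g: "g \<in> Hom X Y" and gh: "ghost S X g"
  obtains c where "c \<in> Hom (\<Sigma>\<^sub>0 A) Y" "c \<cdot> w = g"
proof -
  have v: "v \<in> Hom P X" using tri_Hom[OF t] by blast
  have "ghost S P (g \<cdot> v)"
    using gh Hom_cmp[OF v] assoc[OF g v] by (simp add: ghost_def)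
  then have "g \<cdot> v = 0"
    by (rule ghost_add_closure_zero[OF cluster_tilting_Ob[OF S] P Hom_cmp[OF g v]])
  then show thesis using tri_extend_third[OF t g] that by blast
qed

lemma ghost_factor_add:
  assumes S: "cluster_tilting C S" and g: "g \<in> Hom X Y" and gh: "ghost S X g"
  obtains A w c where "A \<in> add_closure C S" "w \<in> Hom X (\<Sigma>\<^sub>0 A)" "c \<in> Hom (\<Sigma>\<^sub>0 A) Y" "c \<cdot> w = g"
proof -
  obtain A P k v w where *: "A \<in> add_closure C S" "P \<in> add_closure C S" "tri C A P X k v w"
    using approximation_triangle[OF S Hom_dom[OF g]] by metis
  then show thesis using ghost_factor[OF S *(3,2) g gh] tri_Hom(3)[OF *(3)] that by blast
qed

text \<open>Suspending a factorization through \<open>A\<close> gives one through \<Sigma> A, and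
  rigidity makes such arrows ghosts. Conversely an approximation triangle factors every ghost
  through some \<Sigma> A, and fullness removes the suspension.\<close>

lemma desusp_to_in_ideal_iff:
  assumes S: "cluster_tilting C S" and Y: "Y \<in> Ob C" and g: "g \<in> Hom X (\<Sigma>\<^sub>0 Y)"
  shows "desusp_to C Y g \<in> ideal_of C S (desusp_ob C X) Y \<longleftrightarrow> ghost S X g"
proof
  have X: "X \<in> Ob C" using Hom_dom[OF g] .
  assume "desusp_to C Y g \<in> ideal_of C S (desusp_ob C X) Y"
  then obtain h k A where A: "A \<in> add_closure C S" and hk: "desusp_to C Y g = h \<cdot> k"
    and "k \<in> hom C (desusp_ob C X) A" "h \<in> hom C A Y"
    by (auto simp: ideal_of_def)
  then have k: "k \<in> Hom (desusp_ob C X) A" and h: "h \<in> Hom A Y"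
    using add_closure_Ob[OF A] desusp_Ob[OF X] Y by (simp_all add: Hom_def)
  obtain w where w: "w \<in> Hom X (\<Sigma>\<^sub>0 A)" "desusp_to C A w = k"
    using desusp_to_surj[OF X k] by blast
  have "desusp_to C Y g = desusp_to C Y (\<Sigma> h \<cdot> w)"
    using desusp_to_cmp_left[OF h w(1)] w(2) hk by simp
  then have "g = \<Sigma> h \<cdot> w"
    by (rule desusp_to_inject[OF Y g Hom_cmp[OF susp_Hom[OF h] w(1)]])
  then show "ghost S X g" using ghost_from_add_susp[OF S A w(1) susp_Hom[OF h]] by simp
next
  assume gh: "ghost S X g"
  obtain A w c where A: "A \<in> add_closure C S" and w: "w \<in> Hom X (\<Sigma>\<^sub>0 A)"
    and c: "c \<in> Hom (\<Sigma>\<^sub>0 A) (\<Sigma>\<^sub>0 Y)" and cw: "c \<cdot> w = g"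
    using ghost_factor_add[OF S g gh] .
  obtain a where a: "a \<in> Hom A Y" "\<Sigma> a = c" using susp_full[OF add_closure_Ob[OF A] Y c] by blast
  have "desusp_to C Y g = a \<cdot> desusp_to C A w"
    using desusp_to_cmp_left[OF a(1) w] a(2) cw by simp
  moreover have "desusp_to C A w \<in> hom C (desusp_ob C X) A" "a \<in> hom C A Y"
    using desusp_to_Hom[OF add_closure_Ob[OF A] w] a by (simp_all add: Hom_def)
  ultimately show "desusp_to C Y g \<in> ideal_of C S (desusp_ob C X) Y"
    using A unfolding ideal_of_def by blast
qed

text \<open>Factor \<open>e\<close> as \<Sigma> a after \<open>w\<close> with \<open>w\<close>
  ending in \<Sigma> A. By adjunction \<open>a\<close> moves next to \<open>x\<close>, and
  \<open>x \<cdot> a\<close> is a ghost on \<open>A\<close>, hence zero.\<close>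

lemma ghost_orthogonal:
  assumes S: "cluster_tilting C S" and Y: "Y \<in> Ob C"
    and x: "x \<in> Hom X (\<Sigma>\<^sub>0 Y)" and gx: "ghost S X x" and e: "e \<in> Hom Y (\<Sigma>\<^sub>0 X)" and ge: "ghost S Y e"
  shows "\<Phi> X Y x e = 0"
proof -
  have X: "X \<in> Ob C" using Hom_dom[OF x] .
  obtain A w c where A: "A \<in> add_closure C S" and w: "w \<in> Hom Y (\<Sigma>\<^sub>0 A)"
    and c: "c \<in> Hom (\<Sigma>\<^sub>0 A) (\<Sigma>\<^sub>0 X)" and cw: "c \<cdot> w = e"
    using ghost_factor_add[OF S e ge] .
  obtain a where a: "a \<in> Hom A X" "\<Sigma> a = c" using susp_full[OF add_closure_Ob[OF A] X c] by blast
  have "ghost S A (x \<cdot> a)"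
    using gx Hom_cmp[OF a(1)] assoc[OF x a(1)] by (simp add: ghost_def)
  then have "x \<cdot> a = 0"
    by (rule ghost_add_closure_zero[OF cluster_tilting_Ob[OF S] A Hom_cmp[OF x a(1)]])
  then show ?thesis
    using form_natural_left[OF x Y a(1) w] a(2) cw form_zero_left[OF add_closure_Ob[OF A] w] by simp
qed

text \<open>For \<open>s\<close> from \<open>S\<close> to \<open>X\<close>, the arrows
  \<open>\<Sigma> s \<cdot> b\<close> are ghosts by rigidity. Orthogonality to them is, by
  adjunction, orthogonality of \<open>x \<cdot> s\<close> to every \<open>b\<close>.\<close>

lemma ghost_if_orthogonal:
  assumes S: "cluster_tilting C S" and Y: "Y \<in> Ob C" and x: "x \<in> Hom X (\<Sigma>\<^sub>0 Y)"
    and orth: "\<And>e. \<lbrakk>e \<in> Hom Y (\<Sigma>\<^sub>0 X); ghost S Y e\<rbrakk> \<Longrightarrow> \<Phi> X Y x e = 0"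
  shows "ghost S X x"
  unfolding ghost_def
proof
  fix s assume s: "s \<in> Hom S X"
  show "x \<cdot> s = 0"
  proof (rule form_nondegenerate[OF Hom_cmp[OF x s] Y])
    fix b assume b: "b \<in> Hom Y (\<Sigma>\<^sub>0 S)"
    have "ghost S Y (\<Sigma> s \<cdot> b)"
      unfolding ghost_def
    proof
      fix r assume r: "r \<in> Hom S Y"
      show "(\<Sigma> s \<cdot> b) \<cdot> r = 0"
        using assoc[OF susp_Hom[OF s] b r] cluster_tilting_rigid[OF S Hom_cmp[OF b r]]
          cmp_zero[OF susp_Hom[OF s]] by simp
    qed
    then show "\<Phi> S Y (x \<cdot> s) b = 0"
      using form_natural_left[OF x Y s b] orth[OF Hom_cmp[OF susp_Hom[OF s] b]] by simp
  qed
qed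

end

section \<open>The equivalence of the three conditions\<close>

text \<open>Interpreted once for each of the two triangles, with the roles of \<open>U\<close> and
  \<open>V\<close> exchanged.\<close>

locale pair_over_triangle = cy2_category C \<Phi>
  for C :: "('k::field, 'o, 'm::ab_group_add, 'z) triangulated_data_scheme" (structure)
    and \<Phi> :: "'o \<Rightarrow> 'o \<Rightarrow> 'm \<Rightarrow> 'm \<Rightarrow> 'k" +
  fixes T M B L U V :: 'o and i p \<epsilon> iU iV :: 'm
  assumes T: "cluster_tilting C T"
    and triangle: "tri C M B L i p \<epsilon>"
    and iU: "iU \<in> Hom U M" and iU_mono: "F_mono C T U iU"
    and iV: "iV \<in> Hom V L" and iV_mono: "F_mono C T V iV"
begin

lemmas TOb = cluster_tilting_Ob[OF T]
  and \<Sigma>T = cluster_tilting_susp[OF T]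
  and i = tri_Hom(1)[OF triangle]
  and p = tri_Hom(2)[OF triangle]
  and \<epsilon> = tri_Hom(3)[OF triangle]

lemma Obs: "U \<in> Ob C" "V \<in> Ob C" "M \<in> Ob C" "B \<in> Ob C" "L \<in> Ob C"
  using Hom_dom[OF iU] Hom_dom[OF iV] tri_type[OF triangle] by auto

lemma F_mono_cancel:
  assumes f: "f \<in> Hom X Y" and mono: "F_mono C T X f" and t: "t \<in> Hom T X" and ft: "f \<cdot> t = 0"
  shows "t = 0"
proof -
  have "0 \<in> Hom T X" by (rule Hom_zero[OF TOb Hom_dom[OF f]])
  then show ?thesis
    using mono t ft cmp_zero[OF f] unfolding F_mono_def F\<^sub>0_def F\<^sub>1_def inj_on_def Hom_def by auto
qed

text \<open>Clause (c) is tested on arrows out of \<Sigma> T; fullness of the suspension brings them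
  back to elements of F X.\<close>

lemma F_mono_susp_cancel:
  assumes f: "f \<in> Hom X Y" and mono: "F_mono C T X f"
    and s: "s \<in> Hom (\<Sigma>\<^sub>0 T) (\<Sigma>\<^sub>0 X)" and fs: "\<Sigma> f \<cdot> s = 0"
  shows "s = 0"
proof -
  obtain t where t: "t \<in> Hom T X" "\<Sigma> t = s" using susp_full[OF TOb Hom_dom[OF f] s] by blast
  have "\<Sigma> (f \<cdot> t) = 0" using susp_cmp[OF f t(1)] t(2) fs by simp
  then have "f \<cdot> t = 0" by (rule susp_eq_0[OF Hom_cmp[OF f t(1)]])
  then show ?thesis using F_mono_cancel[OF f mono t(1)] t(2) susp_zero[OF TOb] by simp
qed

text \<open>Condition (ii), moved from \<open>C(\<Sigma>\<^sup>-\<^sup>1 X, Y)\<close> to \<open>C(X, \<Sigma> Y)\<close>.\<close>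

definition lifting :: "'m \<Rightarrow> 'm \<Rightarrow> bool" where
  "lifting e \<phi> \<longleftrightarrow> e \<in> Hom V (\<Sigma>\<^sub>0 U) \<and> \<phi> \<in> Hom L (\<Sigma>\<^sub>0 U) \<and> \<epsilon> \<cdot> iV = \<Sigma> iU \<cdot> e \<and>
     ghost T V e \<and> ghost (\<Sigma>\<^sub>0 T) L (\<Sigma> iU \<cdot> \<phi> - \<epsilon>)"

lemma condition_ii_for_iff:
  assumes e: "e \<in> Hom V (\<Sigma>\<^sub>0 U)" and \<phi>: "\<phi> \<in> Hom L (\<Sigma>\<^sub>0 U)"
  shows "condition_ii_for C T M L \<epsilon> U V iU iV (desusp_to C U e) (desusp_to C U \<phi>) \<longleftrightarrow> lifting e \<phi>"
proof -
  note iU\<phi> = Hom_cmp[OF susp_Hom[OF iU] \<phi>]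
  have "desusp_to C M \<epsilon> \<cdot> desusp C iV = desusp_to C M (\<epsilon> \<cdot> iV)"
    using desusp_to_cmp_right[OF Obs(3) \<epsilon> iV] by simp
  moreover have "iU \<cdot> desusp_to C U e = desusp_to C M (\<Sigma> iU \<cdot> e)"
    using desusp_to_cmp_left[OF iU e] by simp
  ultimately have 1: "desusp_to C M \<epsilon> \<cdot> desusp C iV = iU \<cdot> desusp_to C U e \<longleftrightarrow> \<epsilon> \<cdot> iV = \<Sigma> iU \<cdot> e"
    using desusp_to_inject[OF Obs(3) Hom_cmp[OF \<epsilon> iV] Hom_cmp[OF susp_Hom[OF iU] e]] by auto
  have 2: "iU \<cdot> desusp_to C U \<phi> - desusp_to C M \<epsilon> = desusp_to C M (\<Sigma> iU \<cdot> \<phi> - \<epsilon>)"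
    using desusp_to_diff[OF Obs(3) iU\<phi> \<epsilon>] desusp_to_cmp_left[OF iU \<phi>] by simp
  show ?thesis
    unfolding condition_ii_for_def lifting_def 1 2 desusp_to_in_ideal_iff[OF T Obs(1) e]
      desusp_to_in_ideal_iff[OF \<Sigma>T Obs(3) Hom_diff[OF iU\<phi> \<epsilon>]]
    using desusp_to_Hom[OF Obs(1) e] desusp_to_Hom[OF Obs(1) \<phi>] e \<phi> by (auto simp: Hom_def)
qed

lemma desusp_to_surj_pair:
  assumes "condition_ii_for C T M L \<epsilon> U V iU iV e' f'"
  obtains e \<phi> where "e \<in> Hom V (\<Sigma>\<^sub>0 U)" "\<phi> \<in> Hom L (\<Sigma>\<^sub>0 U)" "e' = desusp_to C U e" "f' = desusp_to C U \<phi>"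
proof -
  have "e' \<in> Hom (desusp_ob C V) U" "f' \<in> Hom (desusp_ob C L) U"
    using assms Obs desusp_Ob by (auto simp: condition_ii_for_def Hom_def)
  then show thesis using that desusp_to_surj[OF Obs(2)] desusp_to_surj[OF Obs(5)] by metis
qed

lemma condition_ii_iff: "condition_ii C T M B L i p \<epsilon> U V iU iV \<longleftrightarrow> (\<exists>e \<phi>. lifting e \<phi>)"
proof
  assume "condition_ii C T M B L i p \<epsilon> U V iU iV"
  then obtain e' f' where "condition_ii_for C T M L \<epsilon> U V iU iV e' f'"
    by (auto simp: condition_ii_def)
  then show "\<exists>e \<phi>. lifting e \<phi>"
    using condition_ii_for_iff desusp_to_surj_pair by metis
next
  assume "\<exists>e \<phi>. lifting e \<phi>"
  then obtain e \<phi> where "lifting e \<phi>" by blast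
  then show "condition_ii C T M B L i p \<epsilon> U V iU iV"
    using condition_ii_for_iff[of e \<phi>] unfolding condition_ii_def lifting_def by blast
qed

text \<open>The additional equation survives the passage because \<open>desusp_to\<close> is
  injective and respects precomposition.\<close>

lemma condition_iii_iff: "condition_iii C T M B L i p \<epsilon> U V iU iV \<longleftrightarrow> (\<exists>\<phi>. lifting (\<phi> \<cdot> iV) \<phi>)"
proof
  assume "condition_iii C T M B L i p \<epsilon> U V iU iV"
  then obtain e' f' where *: "condition_ii_for C T M L \<epsilon> U V iU iV e' f'" "e' = f' \<cdot> desusp C iV"
    by (auto simp: condition_iii_def)
  obtain e \<phi> where e: "e \<in> Hom V (\<Sigma>\<^sub>0 U)" and \<phi>: "\<phi> \<in> Hom L (\<Sigma>\<^sub>0 U)"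
    and eq: "e' = desusp_to C U e" "f' = desusp_to C U \<phi>"
    by (rule desusp_to_surj_pair[OF *(1)])
  have "desusp_to C U e = desusp_to C U (\<phi> \<cdot> iV)"
    using eq *(2) desusp_to_cmp_right[OF Obs(1) \<phi> iV] by simp
  then have "e = \<phi> \<cdot> iV" by (rule desusp_to_inject[OF Obs(1) e Hom_cmp[OF \<phi> iV]])
  then show "\<exists>\<phi>. lifting (\<phi> \<cdot> iV) \<phi>" using *(1) eq condition_ii_for_iff[OF e \<phi>] by blast
next
  assume "\<exists>\<phi>. lifting (\<phi> \<cdot> iV) \<phi>"
  then obtain \<phi> where l: "lifting (\<phi> \<cdot> iV) \<phi>" by blast
  then have \<phi>: "\<phi> \<in> Hom L (\<Sigma>\<^sub>0 U)" by (simp add: lifting_def)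
  show "condition_iii C T M B L i p \<epsilon> U V iU iV"
    using condition_ii_for_iff[OF Hom_cmp[OF \<phi> iV] \<phi>] l desusp_to_cmp_right[OF Obs(1) \<phi> iV]
    unfolding condition_iii_def by blast
qed

text \<open>
  The correction term is \<open>\<phi> \<cdot> iV - e\<close>. It factors through some \<open>w : V \<rightarrow> \<Sigma> A\<close> with \<open>A\<close> in
  \<open>add \<Sigma> T\<close>, and \<open>w\<close> extends along \<open>iV\<close> because the connecting arrow of the cone of \<open>iV\<close> factors
  through \<open>\<Sigma> (add \<Sigma> T)\<close>.
\<close>

lemma lifting_compatible:
  assumes l: "lifting e \<phi>"
  shows "\<exists>\<phi>'. lifting (\<phi>' \<cdot> iV) \<phi>'"
proof -
  have e: "e \<in> Hom V (\<Sigma>\<^sub>0 U)" and \<phi>: "\<phi> \<in> Hom L (\<Sigma>\<^sub>0 U)" and eq: "\<epsilon> \<cdot> iV = \<Sigma> iU \<cdot> e"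
    and ge: "ghost T V e" and g\<phi>: "ghost (\<Sigma>\<^sub>0 T) L (\<Sigma> iU \<cdot> \<phi> - \<epsilon>)"
    using l by (auto simp: lifting_def)
  note siU = susp_Hom[OF iU]
  define z where "z = \<Sigma> iU \<cdot> \<phi> - \<epsilon>"
  have z: "z \<in> Hom L (\<Sigma>\<^sub>0 M)" unfolding z_def by (rule Hom_diff[OF Hom_cmp[OF siU \<phi>] \<epsilon>])
  define d where "d = \<phi> \<cdot> iV - e"
  have d: "d \<in> Hom V (\<Sigma>\<^sub>0 U)" unfolding d_def by (rule Hom_diff[OF Hom_cmp[OF \<phi> iV] e])
  \<comment> \<open>Up to the arrow \<Sigma> iU, which can be cancelled on arrows from \<Sigma> T,
    the error \<open>d\<close> is the restriction of the ghost \<open>z\<close>. Hence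
    \<open>d\<close> is itself a ghost for \<Sigma> T.\<close>
  have siUd: "\<Sigma> iU \<cdot> d = z \<cdot> iV"
    unfolding d_def z_def using cmp_diff[OF siU Hom_cmp[OF \<phi> iV] e]
      diff_cmp[OF Hom_cmp[OF siU \<phi>] \<epsilon> iV] assoc[OF siU \<phi> iV] eq by simp
  have "ghost (\<Sigma>\<^sub>0 T) V d"
    unfolding ghost_def
  proof
    fix s assume s: "s \<in> Hom (\<Sigma>\<^sub>0 T) V"
    have "\<Sigma> iU \<cdot> (d \<cdot> s) = z \<cdot> (iV \<cdot> s)"
      using assoc[OF siU d s] assoc[OF z iV s] siUd by simp
    also have "\<dots> = 0" using g\<phi> Hom_cmp[OF iV s] by (simp add: ghost_def z_def)
    finally show "d \<cdot> s = 0" by (rule F_mono_susp_cancel[OF iU iU_mono Hom_cmp[OF d s]])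
  qed
  then obtain A w c where A: "A \<in> add_closure C (\<Sigma>\<^sub>0 T)" and w: "w \<in> Hom V (\<Sigma>\<^sub>0 A)"
    and c: "c \<in> Hom (\<Sigma>\<^sub>0 A) (\<Sigma>\<^sub>0 U)" and cw: "c \<cdot> w = d"
    using ghost_factor_add[OF \<Sigma>T d] by blast
  have "\<exists>W g h. tri C V L W iV g h"
    by (rule tri_exists) (use Obs iV in \<open>auto simp: Hom_def\<close>)
  then obtain W g h where t: "tri C V L W iV g h" by blast
  note h = tri_Hom(3)[OF t]
  \<comment> \<open>This is injectivity of F iV: whatever \<open>h\<close> picks up from \<Sigma> T
    is killed by \<Sigma> iV.\<close>
  have "ghost (\<Sigma>\<^sub>0 T) W h"
    unfolding ghost_def
  proof
    fix s assume s: "s \<in> Hom (\<Sigma>\<^sub>0 T) W"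
    have "\<Sigma> iV \<cdot> (h \<cdot> s) = 0"
      using assoc[OF susp_Hom[OF iV] h s] tri_cmp_zero'(2)[OF t] zero_cmp[OF s] by simp
    then show "h \<cdot> s = 0" by (rule F_mono_susp_cancel[OF iV iV_mono Hom_cmp[OF h s]])
  qed
  then obtain A' w' c' where A': "A' \<in> add_closure C (\<Sigma>\<^sub>0 T)" and w': "w' \<in> Hom W (\<Sigma>\<^sub>0 A')"
    and c': "c' \<in> Hom (\<Sigma>\<^sub>0 A') (\<Sigma>\<^sub>0 V)" and cw': "c' \<cdot> w' = h"
    using ghost_factor_add[OF \<Sigma>T h] by blast
  obtain a where a: "a \<in> Hom A' V" "\<Sigma> a = c'" using susp_full[OF add_closure_Ob[OF A'] Obs(2) c'] by blast
  \<comment> \<open>Rigidity of \<Sigma> T: \<open>w \<cdot> a\<close> goes from \<open>A'\<close>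
    to the suspension of \<open>A\<close>, both in the additive closure of \<Sigma> T. Its vanishing
    is exactly what removes the obstruction \<open>\<Sigma> w \<cdot> h\<close>.\<close>
  have "ghost (\<Sigma>\<^sub>0 T) A' (w \<cdot> a)"
    using add_closure_rigid[OF \<Sigma>T A Hom_cmp[OF Hom_cmp[OF w a(1)]]] by (simp add: ghost_def)
  then have "w \<cdot> a = 0"
    by (rule ghost_add_closure_zero[OF susp_Ob[OF TOb] A' Hom_cmp[OF w a(1)]])
  then have "\<Sigma> w \<cdot> c' = 0"
    using susp_cmp[OF w a(1)] a(2) susp_zero[OF Hom_dom[OF a(1)]] by simp
  then have "\<Sigma> w \<cdot> h = 0"
    using assoc[OF susp_Hom[OF w] c' w'] cw' zero_cmp[OF w'] by simp
  then obtain w'' where w'': "w'' \<in> Hom L (\<Sigma>\<^sub>0 A)" "w'' \<cdot> iV = w"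
    using tri_extend_first[OF t w] by blast
  \<comment> \<open>Since \<open>y\<close> also factors through \<Sigma> A, it is a ghost, and
    subtracting it from \<phi> preserves clause (c).\<close>
  define y where "y = c \<cdot> w''"
  have y: "y \<in> Hom L (\<Sigma>\<^sub>0 U)" unfolding y_def by (rule Hom_cmp[OF c w''(1)])
  have yV: "y \<cdot> iV = d" unfolding y_def using assoc[OF c w''(1) iV] w''(2) cw by simp
  have gy: "ghost (\<Sigma>\<^sub>0 T) L y" unfolding y_def by (rule ghost_from_add_susp[OF \<Sigma>T A w''(1) c])
  define \<phi>' where "\<phi>' = \<phi> - y"
  have \<phi>': "\<phi>' \<in> Hom L (\<Sigma>\<^sub>0 U)" unfolding \<phi>'_def by (rule Hom_diff[OF \<phi> y])
  have \<phi>'V: "\<phi>' \<cdot> iV = e" unfolding \<phi>'_def using diff_cmp[OF \<phi> y iV] yV d_def by simp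
  have eq2: "\<Sigma> iU \<cdot> \<phi>' - \<epsilon> = z - \<Sigma> iU \<cdot> y"
    unfolding \<phi>'_def z_def using cmp_diff[OF siU \<phi> y] by simp
  have "ghost (\<Sigma>\<^sub>0 T) L (\<Sigma> iU \<cdot> \<phi>' - \<epsilon>)"
    unfolding ghost_def eq2
  proof
    fix s assume s: "s \<in> Hom (\<Sigma>\<^sub>0 T) L"
    show "(z - \<Sigma> iU \<cdot> y) \<cdot> s = 0"
      using diff_cmp[OF z Hom_cmp[OF siU y] s] assoc[OF siU y s] gy g\<phi> s cmp_zero[OF siU]
      by (simp add: ghost_def z_def)
  qed
  then have "lifting (\<phi>' \<cdot> iV) \<phi>'"
    unfolding lifting_def \<phi>'V using e \<phi>' eq ge by simp
  then show ?thesis by blast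
qed

lemma condition_iii_iff_ii:
  "condition_iii C T M B L i p \<epsilon> U V iU iV \<longleftrightarrow> condition_ii C T M B L i p \<epsilon> U V iU iV"
  unfolding condition_ii_iff condition_iii_iff using lifting_compatible by blast

section \<open>Submodules of FB and liftings\<close>

lemma condition_i_iff_Hom:
  "condition_i C T M B L i p \<epsilon> U V iU iV \<longleftrightarrow>
     (\<exists>E. F_submodule C T B E \<and> (\<lambda>x. iV \<cdot> x) ` Hom T V = (\<lambda>x. p \<cdot> x) ` E \<and>
        (\<lambda>x. iU \<cdot> x) ` Hom T U = {x \<in> Hom T M. i \<cdot> x \<in> E})"
  by (simp add: condition_i_def F\<^sub>0_def F\<^sub>1_def Hom_eq_hom Obs TOb)

text \<open>The arrow \<open>e\<close> produces a map \<open>b\<close> from a cover \<open>P\<close>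
  of \<open>V\<close> into \<open>B\<close>, and \<open>E\<close> is generated by its image and that
  of FU. Clause (c) enters only to bound the preimage of \<open>E\<close> in FM, through the kernel
  of F i.\<close>

lemma condition_i_if_lifting:
  assumes l: "lifting e \<phi>"
  shows "condition_i C T M B L i p \<epsilon> U V iU iV"
proof -
  have e: "e \<in> Hom V (\<Sigma>\<^sub>0 U)" and \<phi>: "\<phi> \<in> Hom L (\<Sigma>\<^sub>0 U)" and eq: "\<epsilon> \<cdot> iV = \<Sigma> iU \<cdot> e"
    and ge: "ghost T V e" and g\<phi>: "ghost (\<Sigma>\<^sub>0 T) L (\<Sigma> iU \<cdot> \<phi> - \<epsilon>)"
    using l by (auto simp: lifting_def)
  obtain A P k v w where A: "A \<in> add_closure C T" and P: "P \<in> add_closure C T" and t: "tri C A P V k v w"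
    and approx: "\<And>s. s \<in> Hom T V \<Longrightarrow> \<exists>y \<in> Hom T P. v \<cdot> y = s"
    using approximation_triangle[OF T Obs(2)] by metis
  note k = tri_Hom(1)[OF t] and v = tri_Hom(2)[OF t] and w = tri_Hom(3)[OF t]
  have POb: "P \<in> Ob C" using Hom_cod[OF k] .
  \<comment> \<open>As a ghost, \<open>e\<close> factors through the connecting arrow
    \<open>w\<close>, which yields the first vertical arrow \<open>iU \<cdot> u\<close> of a
    morphism from the approximation triangle to the given one.\<close>
  obtain e' where e': "e' \<in> Hom (\<Sigma>\<^sub>0 A) (\<Sigma>\<^sub>0 U)" "e' \<cdot> w = e" using ghost_factor[OF T t P e ge] .
  obtain u where u: "u \<in> Hom A U" "\<Sigma> u = e'" using susp_full[OF add_closure_Ob[OF A] Obs(1) e'(1)] by blast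
  note iUu = Hom_cmp[OF iU u(1)]
  have "\<Sigma> (iU \<cdot> u) \<cdot> w = \<epsilon> \<cdot> iV"
    using susp_cmp[OF iU u(1)] assoc[OF susp_Hom[OF iU] e'(1) w] u(2) e'(2) eq by simp
  then obtain b where b: "b \<in> Hom P B" and bk: "b \<cdot> k = i \<cdot> (iU \<cdot> u)" and pb: "iV \<cdot> v = p \<cdot> b"
    using tri_morphism_third[OF t triangle iUu iV] by blast
  note iiU = Hom_cmp[OF i iU]
  define E where "E = {b \<cdot> s + (i \<cdot> iU) \<cdot> x | s x. s \<in> Hom T P \<and> x \<in> Hom T U}"
  have EI: "b \<cdot> s + (i \<cdot> iU) \<cdot> x \<in> E" if "s \<in> Hom T P" "x \<in> Hom T U" for s x
    using that E_def by blast
  have zP: "0 \<in> Hom T P" and zU: "0 \<in> Hom T U" using Hom_zero TOb POb Obs by auto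
  have EHom: "E \<subseteq> Hom T B"
    unfolding E_def using Hom_add[OF Hom_cmp[OF b] Hom_cmp[OF iiU]] by blast
  have "subspace E"
  proof (rule subspaceI)
    show "0 \<in> E" using EI[OF zP zU] cmp_zero[OF b] cmp_zero[OF iiU] by simp
  next
    fix x y assume "x \<in> E" "y \<in> E"
    then obtain s r s' r' where *: "s \<in> Hom T P" "r \<in> Hom T U" "x = b \<cdot> s + (i \<cdot> iU) \<cdot> r"
      "s' \<in> Hom T P" "r' \<in> Hom T U" "y = b \<cdot> s' + (i \<cdot> iU) \<cdot> r'" by (auto simp: E_def)
    have "x + y = b \<cdot> (s + s') + (i \<cdot> iU) \<cdot> (r + r')"
      using * distrib_right_cmp[OF b *(1,4)] distrib_right_cmp[OF iiU *(2,5)] by simp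
    then show "x + y \<in> E" using EI[OF Hom_add[OF *(1,4)] Hom_add[OF *(2,5)]] by simp
  next
    fix a x assume "x \<in> E"
    then obtain s r where *: "s \<in> Hom T P" "r \<in> Hom T U" "x = b \<cdot> s + (i \<cdot> iU) \<cdot> r"
      by (auto simp: E_def)
    have "scale C a x = b \<cdot> scale C a s + (i \<cdot> iU) \<cdot> scale C a r"
      using * scale_right_cmp[OF b *(1)] scale_right_cmp[OF iiU *(2)] by (simp add: scale_right_distrib)
    then show "scale C a x \<in> E" using EI[OF Hom_scale[OF *(1)] Hom_scale[OF *(2)]] by simp
  qed
  moreover have "x \<cdot> a \<in> E" if "x \<in> E" and a: "a \<in> Hom T T" for x a
  proof -
    obtain s r where *: "s \<in> Hom T P" "r \<in> Hom T U" "x = b \<cdot> s + (i \<cdot> iU) \<cdot> r"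
      using \<open>x \<in> E\<close> by (auto simp: E_def)
    have "x \<cdot> a = b \<cdot> (s \<cdot> a) + (i \<cdot> iU) \<cdot> (r \<cdot> a)"
      using *(3) distrib_left_cmp[OF Hom_cmp[OF b *(1)] Hom_cmp[OF iiU *(2)] a]
        assoc[OF b *(1) a] assoc[OF iiU *(2) a] by simp
    then show ?thesis using EI[OF Hom_cmp[OF *(1) a] Hom_cmp[OF *(2) a]] by simp
  qed
  ultimately have sub: "F_submodule C T B E"
    using EHom by (simp add: F_submodule_def F\<^sub>0_def Hom_eq_hom Obs TOb)
  have piiU: "p \<cdot> ((i \<cdot> iU) \<cdot> x) = 0" if x: "x \<in> Hom T U" for x
    using assoc[OF i iU x] assoc[OF p i Hom_cmp[OF iU x]] tri_cmp_zero[OF triangle]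
      zero_cmp[OF Hom_cmp[OF iU x]] by simp
  have pE: "p \<cdot> (b \<cdot> s + (i \<cdot> iU) \<cdot> x) = iV \<cdot> (v \<cdot> s)" if s: "s \<in> Hom T P" and x: "x \<in> Hom T U" for s x
    using distrib_right_cmp[OF p Hom_cmp[OF b s] Hom_cmp[OF iiU x]] piiU[OF x]
      assoc[OF p b s] assoc[OF iV v s] pb by simp
  have "(\<lambda>x. iV \<cdot> x) ` Hom T V = (\<lambda>x. p \<cdot> x) ` E"
  proof
    show "(\<lambda>x. iV \<cdot> x) ` Hom T V \<subseteq> (\<lambda>x. p \<cdot> x) ` E"
    proof clarify
      fix x assume "x \<in> Hom T V"
      then obtain s where "s \<in> Hom T P" "v \<cdot> s = x" using approx by blast
      then show "iV \<cdot> x \<in> (\<lambda>x. p \<cdot> x) ` E" using pE[OF _ zU] EI[OF _ zU] by (metis imageI)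
    qed
    show "(\<lambda>x. p \<cdot> x) ` E \<subseteq> (\<lambda>x. iV \<cdot> x) ` Hom T V"
      using pE Hom_cmp[OF v] by (auto simp: E_def)
  qed
  moreover have "(\<lambda>x. iU \<cdot> x) ` Hom T U = {x \<in> Hom T M. i \<cdot> x \<in> E}"
  proof
    show "(\<lambda>x. iU \<cdot> x) ` Hom T U \<subseteq> {x \<in> Hom T M. i \<cdot> x \<in> E}"
    proof clarify
      fix x assume x: "x \<in> Hom T U"
      have "i \<cdot> (iU \<cdot> x) = b \<cdot> 0 + (i \<cdot> iU) \<cdot> x" using assoc[OF i iU x] cmp_zero[OF b] by simp
      then show "iU \<cdot> x \<in> Hom T M \<and> i \<cdot> (iU \<cdot> x) \<in> E" using EI[OF zP x] Hom_cmp[OF iU x] by simp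
    qed
    show "{x \<in> Hom T M. i \<cdot> x \<in> E} \<subseteq> (\<lambda>x. iU \<cdot> x) ` Hom T U"
    proof clarify
      fix x assume x: "x \<in> Hom T M" and "i \<cdot> x \<in> E"
      then obtain s r where s: "s \<in> Hom T P" and r: "r \<in> Hom T U" and ix: "i \<cdot> x = b \<cdot> s + (i \<cdot> iU) \<cdot> r"
        by (auto simp: E_def)
      have "p \<cdot> (i \<cdot> x) = 0"
        using assoc[OF p i x] tri_cmp_zero[OF triangle] zero_cmp[OF x] by simp
      then have "iV \<cdot> (v \<cdot> s) = 0" using pE[OF s r] ix by simp
      \<comment> \<open>Injectivity of F iV puts \<open>s\<close> in the image of \<open>k\<close>,
        where \<open>b \<cdot> k = i \<cdot> (iU \<cdot> u)\<close>; so the contribution of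
        \<open>b\<close> to \<open>i \<cdot> x\<close> already comes from FU.\<close>
      then have "v \<cdot> s = 0" by (rule F_mono_cancel[OF iV iV_mono Hom_cmp[OF v s]])
      then obtain q where q: "q \<in> Hom T A" "k \<cdot> q = s" using tri_factor_first[OF t s] by blast
      define r' where "r' = u \<cdot> q + r"
      have r': "r' \<in> Hom T U" unfolding r'_def by (rule Hom_add[OF Hom_cmp[OF u(1) q(1)] r])
      have "b \<cdot> s = (i \<cdot> iU) \<cdot> (u \<cdot> q)"
        using assoc[OF b k q(1)] q(2) bk assoc[OF i iUu q(1)] assoc[OF iU u(1) q(1)]
          assoc[OF i iU Hom_cmp[OF u(1) q(1)]] by simp
      then have "i \<cdot> x = i \<cdot> (iU \<cdot> r')"
        unfolding r'_def using ix distrib_right_cmp[OF iiU Hom_cmp[OF u(1) q(1)] r]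
          assoc[OF i iU r'[unfolded r'_def]] by simp
      \<comment> \<open>The difference lies in the kernel of F i, so its suspension is
        \<open>\<epsilon> \<cdot> y\<close>; by clause (c) \<epsilon> may be replaced there by
        \<open>\<Sigma> iU \<cdot> \<phi>\<close>.\<close>
      define x' where "x' = x - iU \<cdot> r'"
      have x': "x' \<in> Hom T M" unfolding x'_def by (rule Hom_diff[OF x Hom_cmp[OF iU r']])
      have "i \<cdot> x' = 0"
        unfolding x'_def using cmp_diff[OF i x Hom_cmp[OF iU r']] \<open>i \<cdot> x = i \<cdot> (iU \<cdot> r')\<close> by simp
      then obtain y where y: "y \<in> Hom (\<Sigma>\<^sub>0 T) L" "\<epsilon> \<cdot> y = \<Sigma> x'"
        using tri_exact_first[OF triangle x'] by blast
      obtain r'' where r'': "r'' \<in> Hom T U" "\<Sigma> r'' = \<phi> \<cdot> y"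
        using susp_full[OF TOb Obs(1) Hom_cmp[OF \<phi> y(1)]] by blast
      have "(\<Sigma> iU \<cdot> \<phi> - \<epsilon>) \<cdot> y = 0" using g\<phi> y(1) by (simp add: ghost_def)
      then have "\<Sigma> x' = \<Sigma> (iU \<cdot> r'')"
        using diff_cmp[OF Hom_cmp[OF susp_Hom[OF iU] \<phi>] \<epsilon> y(1)] assoc[OF susp_Hom[OF iU] \<phi> y(1)]
          y(2) susp_cmp[OF iU r''(1)] r''(2) by simp
      then have "x' = iU \<cdot> r''" by (rule susp_inject[OF x' Hom_cmp[OF iU r''(1)]])
      then have "x = iU \<cdot> (r'' + r')"
        unfolding x'_def using distrib_right_cmp[OF iU r''(1) r'] by (simp add: algebra_simps)
      then show "x \<in> (\<lambda>x. iU \<cdot> x) ` Hom T U" using Hom_add[OF r''(1) r'] by blast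
    qed
  qed
  ultimately show ?thesis unfolding condition_i_iff_Hom using sub by blast
qed

text \<open>\<open>\<epsilon> \<cdot> y\<close> is the suspension of some \<open>x\<close> with
  \<open>i \<cdot> x = 0\<close>. Since 0 lies in \<open>E\<close>, such an \<open>x\<close> belongs
  to FU.\<close>

lemma kernel_in_image:
  assumes E: "F_submodule C T B E" and iUE: "(\<lambda>x. iU \<cdot> x) ` Hom T U = {x \<in> Hom T M. i \<cdot> x \<in> E}"
    and y: "y \<in> Hom (\<Sigma>\<^sub>0 T) L"
  obtains u where "u \<in> Hom (\<Sigma>\<^sub>0 T) (\<Sigma>\<^sub>0 U)" "\<Sigma> iU \<cdot> u = \<epsilon> \<cdot> y"
proof -
  have "subspace E" using E by (simp add: F_submodule_def)
  obtain x where x: "x \<in> Hom T M" "\<Sigma> x = \<epsilon> \<cdot> y"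
    using susp_full[OF TOb Obs(3) Hom_cmp[OF \<epsilon> y]] by blast
  have "\<Sigma> (i \<cdot> x) = 0"
    using susp_cmp[OF i x(1)] x(2) assoc[OF susp_Hom[OF i] \<epsilon> y] tri_cmp_zero'(2)[OF triangle]
      zero_cmp[OF y] by simp
  then have "i \<cdot> x = 0" by (rule susp_eq_0[OF Hom_cmp[OF i x(1)]])
  then have "i \<cdot> x \<in> E" using subspace_0[OF \<open>subspace E\<close>] by simp
  then obtain t where "t \<in> Hom T U" "x = iU \<cdot> t" using iUE x(1) by blast
  then show thesis using that[of "\<Sigma> t"] susp_Hom susp_cmp[OF iU] x(2) by metis
qed

text \<open>In this weak form \<phi> and \<open>e\<close> are built independently: \<phi> from an
  approximation of \<open>L\<close> by \<Sigma> T and the kernel of F i, \<open>e\<close> from an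
  approximation of \<open>V\<close> by \<open>T\<close> and the image of \<open>E\<close> in
  FL.\<close>

lemma lifting_if_condition_i:
  assumes c: "condition_i C T M B L i p \<epsilon> U V iU iV"
  shows "\<exists>e \<phi>. lifting e \<phi>"
proof -
  obtain E where E: "F_submodule C T B E" and iVE: "(\<lambda>x. iV \<cdot> x) ` Hom T V = (\<lambda>x. p \<cdot> x) ` E"
    and iUE: "(\<lambda>x. iU \<cdot> x) ` Hom T U = {x \<in> Hom T M. i \<cdot> x \<in> E}"
    using c unfolding condition_i_iff_Hom by blast
  note siU = susp_Hom[OF iU] and \<Sigma>TOb = susp_Ob[OF TOb]
  have "\<exists>\<phi>. \<phi> \<in> Hom L (\<Sigma>\<^sub>0 U) \<and> ghost (\<Sigma>\<^sub>0 T) L (\<Sigma> iU \<cdot> \<phi> - \<epsilon>)"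
  proof -
    obtain A P k v w where A: "A \<in> add_closure C (\<Sigma>\<^sub>0 T)" and P: "P \<in> add_closure C (\<Sigma>\<^sub>0 T)"
      and t: "tri C A P L k v w" and approx: "\<And>s. s \<in> Hom (\<Sigma>\<^sub>0 T) L \<Longrightarrow> \<exists>y \<in> Hom (\<Sigma>\<^sub>0 T) P. v \<cdot> y = s"
      using approximation_triangle[OF \<Sigma>T Obs(5)] by metis
    note k = tri_Hom(1)[OF t] and v = tri_Hom(2)[OF t]
    have lift: "\<exists>y \<in> Hom (\<Sigma>\<^sub>0 T) (\<Sigma>\<^sub>0 U). \<Sigma> iU \<cdot> y = (\<epsilon> \<cdot> v) \<cdot> s" if s: "s \<in> Hom (\<Sigma>\<^sub>0 T) P" for s
      using kernel_in_image[OF E iUE Hom_cmp[OF v s]] assoc[OF \<epsilon> v s] by metis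
    obtain u where u: "u \<in> Hom P (\<Sigma>\<^sub>0 U)" "\<Sigma> iU \<cdot> u = \<epsilon> \<cdot> v"
      using add_closure_lift[OF \<Sigma>TOb P Hom_cmp[OF \<epsilon> v] siU F_submodule_Hom[OF \<Sigma>TOb susp_Ob[OF Obs(1)]] lift]
      by blast
    note uk = Hom_cmp[OF u(1) k]
    \<comment> \<open>The obstruction to extending \<open>u\<close> from \<open>P\<close> to
      \<open>L\<close> is \<open>u \<cdot> k\<close>; it vanishes because \<Sigma> iU kills it and
      can be cancelled on arrows from \<Sigma> T.\<close>
    have "\<Sigma> iU \<cdot> (u \<cdot> k) = 0"
      using assoc[OF siU u(1) k] u(2) assoc[OF \<epsilon> v k] tri_cmp_zero[OF t] cmp_zero[OF \<epsilon>] by simp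
    then have "\<Sigma> iU \<cdot> ((u \<cdot> k) \<cdot> s) = 0" if "s \<in> Hom (\<Sigma>\<^sub>0 T) A" for s
      using assoc[OF siU uk that] zero_cmp[OF that] by simp
    then have "ghost (\<Sigma>\<^sub>0 T) A (u \<cdot> k)"
      unfolding ghost_def using F_mono_susp_cancel[OF iU iU_mono Hom_cmp[OF uk]] by blast
    then have "u \<cdot> k = 0" by (rule ghost_add_closure_zero[OF \<Sigma>TOb A uk])
    then obtain \<phi> where \<phi>: "\<phi> \<in> Hom L (\<Sigma>\<^sub>0 U)" "\<phi> \<cdot> v = u" using tri_extend_second[OF t u(1)] by blast
    have zv: "(\<Sigma> iU \<cdot> \<phi> - \<epsilon>) \<cdot> v = 0"
      using diff_cmp[OF Hom_cmp[OF siU \<phi>(1)] \<epsilon> v] assoc[OF siU \<phi>(1) v] \<phi>(2) u(2) by simp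
    have "ghost (\<Sigma>\<^sub>0 T) L (\<Sigma> iU \<cdot> \<phi> - \<epsilon>)"
      unfolding ghost_def
    proof
      fix s assume "s \<in> Hom (\<Sigma>\<^sub>0 T) L"
      then obtain y where y: "y \<in> Hom (\<Sigma>\<^sub>0 T) P" "v \<cdot> y = s" using approx by blast
      show "(\<Sigma> iU \<cdot> \<phi> - \<epsilon>) \<cdot> s = 0"
        using assoc[OF Hom_diff[OF Hom_cmp[OF siU \<phi>(1)] \<epsilon>] v y(1)] zv y zero_cmp[OF y(1)] by simp
    qed
    then show ?thesis using \<phi> by blast
  qed
  moreover have "\<exists>e. e \<in> Hom V (\<Sigma>\<^sub>0 U) \<and> \<epsilon> \<cdot> iV = \<Sigma> iU \<cdot> e \<and> ghost T V e"
  proof -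
    obtain A P k v w where A: "A \<in> add_closure C T" and P: "P \<in> add_closure C T" and t: "tri C A P V k v w"
      using approximation_triangle[OF T Obs(2)] by metis
    note k = tri_Hom(1)[OF t] and v = tri_Hom(2)[OF t] and w = tri_Hom(3)[OF t]
    have AOb: "A \<in> Ob C" using Hom_dom[OF k] .
    have lift: "\<exists>y \<in> E. p \<cdot> y = (iV \<cdot> v) \<cdot> s" if s: "s \<in> Hom T P" for s
    proof -
      have "iV \<cdot> (v \<cdot> s) \<in> (\<lambda>x. p \<cdot> x) ` E" using iVE Hom_cmp[OF v s] by blast
      then show ?thesis using assoc[OF iV v s] by force
    qed
    \<comment> \<open>The lift takes values in \<open>E\<close>, not merely in FB; this is needed to
      bring \<open>m'\<close> back to FU.\<close>
    obtain b where b: "b \<in> Hom P B" and pb: "p \<cdot> b = iV \<cdot> v" and bE: "\<forall>s \<in> Hom T P. b \<cdot> s \<in> E"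
      using add_closure_lift[OF TOb P Hom_cmp[OF iV v] p E lift] by blast
    have "p \<cdot> (b \<cdot> k) = 0"
      using assoc[OF p b k] pb assoc[OF iV v k] tri_cmp_zero[OF t] cmp_zero[OF iV] by simp
    then obtain m where m: "m \<in> Hom A M" "i \<cdot> m = b \<cdot> k"
      using tri_factor_first[OF triangle Hom_cmp[OF b k]] by blast
    have "\<exists>c \<in> hom C V L. c \<cdot> v = p \<cdot> b \<and> \<Sigma> m \<cdot> w = \<epsilon> \<cdot> c"
      by (rule tri_morphism[OF t triangle]) (use m b in \<open>auto simp: Hom_def\<close>)
    then obtain c where c: "c \<in> Hom V L" and cv: "c \<cdot> v = p \<cdot> b" and mw: "\<Sigma> m \<cdot> w = \<epsilon> \<cdot> c"
      using Obs by (auto simp: Hom_def)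
    \<comment> \<open>Completion of the square yields some \<open>c\<close> that agrees with
      \<open>iV\<close> only after \<open>v\<close>. The difference factors through
      \<open>w\<close>, and subtracting the arrow \<open>q\<close> with
      \<open>\<Sigma> q = \<epsilon> \<cdot> c'\<close> from \<open>m\<close> corrects it without
      changing \<open>i \<cdot> m\<close>.\<close>
    have "(c - iV) \<cdot> v = 0" using diff_cmp[OF c iV v] cv pb by simp
    then obtain c' where c': "c' \<in> Hom (\<Sigma>\<^sub>0 A) L" "c' \<cdot> w = c - iV"
      using tri_extend_third[OF t Hom_diff[OF c iV]] by blast
    obtain q where q: "q \<in> Hom A M" "\<Sigma> q = \<epsilon> \<cdot> c'"
      using susp_full[OF AOb Obs(3) Hom_cmp[OF \<epsilon> c'(1)]] by blast
    have "\<Sigma> (i \<cdot> q) = 0"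
      using susp_cmp[OF i q(1)] q(2) assoc[OF susp_Hom[OF i] \<epsilon> c'(1)] tri_cmp_zero'(2)[OF triangle]
        zero_cmp[OF c'(1)] by simp
    then have iq: "i \<cdot> q = 0" by (rule susp_eq_0[OF Hom_cmp[OF i q(1)]])
    define m' where "m' = m - q"
    have m': "m' \<in> Hom A M" unfolding m'_def by (rule Hom_diff[OF m(1) q(1)])
    have im': "i \<cdot> m' = b \<cdot> k" unfolding m'_def using cmp_diff[OF i m(1) q(1)] m(2) iq by simp
    have "\<Sigma> m' \<cdot> w = \<epsilon> \<cdot> c - (\<epsilon> \<cdot> c') \<cdot> w"
      unfolding m'_def susp_diff[OF m(1) q(1)]
      using diff_cmp[OF susp_Hom[OF m(1)] susp_Hom[OF q(1)] w] mw q(2) by simp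
    also have "\<dots> = \<epsilon> \<cdot> iV"
      using assoc[OF \<epsilon> c'(1) w] c'(2) cmp_diff[OF \<epsilon> c iV] by simp
    finally have m'w: "\<Sigma> m' \<cdot> w = \<epsilon> \<cdot> iV" .
    have lift': "\<exists>y \<in> Hom T U. iU \<cdot> y = m' \<cdot> s" if s: "s \<in> Hom T A" for s
    proof -
      have "i \<cdot> (m' \<cdot> s) = b \<cdot> (k \<cdot> s)" using assoc[OF i m' s] assoc[OF b k s] im' by simp
      then have "i \<cdot> (m' \<cdot> s) \<in> E" using bE Hom_cmp[OF k s] by simp
      then have "m' \<cdot> s \<in> (\<lambda>x. iU \<cdot> x) ` Hom T U" using iUE Hom_cmp[OF m' s] by blast
      then show ?thesis by force
    qed
    obtain u where u: "u \<in> Hom A U" "iU \<cdot> u = m'"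
      using add_closure_lift[OF TOb A m' iU F_submodule_Hom[OF TOb Obs(1)] lift'] by blast
    have "\<epsilon> \<cdot> iV = \<Sigma> iU \<cdot> (\<Sigma> u \<cdot> w)"
      using m'w u(2) susp_cmp[OF iU u(1)] assoc[OF siU susp_Hom[OF u(1)] w] by simp
    then show ?thesis
      using Hom_cmp[OF susp_Hom[OF u(1)] w] ghost_from_add_susp[OF T A w susp_Hom[OF u(1)]] by blast
  qed
  ultimately show ?thesis unfolding lifting_def by blast
qed

lemma condition_i_iff_ii:
  "condition_i C T M B L i p \<epsilon> U V iU iV \<longleftrightarrow> condition_ii C T M B L i p \<epsilon> U V iU iV"
  unfolding condition_ii_iff using condition_i_if_lifting lifting_if_condition_i by blast

end

section \<open>The dichotomy\<close>

lemma (in vector_space) separating_functional: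
  assumes W: "subspace W" and x: "x \<notin> W"
  shows "\<exists>\<psi> :: 'b \<Rightarrow> 'a. (\<forall>y z. \<psi> (y + z) = \<psi> y + \<psi> z) \<and> (\<forall>a y. \<psi> (scale a y) = a * \<psi> y) \<and>
    (\<forall>w \<in> W. \<psi> w = 0) \<and> \<psi> x = 1"
proof -
  interpret field: vector_space "(*) :: 'a \<Rightarrow> 'a \<Rightarrow> 'a"
    by standard (simp_all add: algebra_simps)
  interpret pair: vector_space_pair scale "(*) :: 'a \<Rightarrow> 'a \<Rightarrow> 'a" ..
  obtain B where B: "B \<subseteq> W" "independent B" "W \<subseteq> span B"
    using maximal_independent_subset by blast
  have "span B \<subseteq> W" by (rule span_minimal[OF B(1) W])
  \<comment> \<open>A functional can thus be prescribed as 1 at \<open>x\<close> and 0 on a basis of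
    \<open>W\<close>, then extended to the whole ambient space.\<close>
  then have "independent (insert x B)" using x B(2) independent_insertI by blast
  then obtain \<psi> where lin: "Vector_Spaces.linear scale (*) \<psi>"
    and \<psi>: "\<forall>y \<in> insert x B. \<psi> y = (if y = x then 1 else 0)"
    using pair.linear_independent_extend[of "insert x B" "\<lambda>y. if y = x then 1 else 0"] by blast
  interpret \<psi>: Vector_Spaces.linear scale "(*)" \<psi> by (rule lin)
  have \<psi>B: "\<psi> y = 0" if "y \<in> B" for y using \<psi> B(1) x that by auto
  have "\<psi> w = 0" if "w \<in> W" for w
    using pair.linear_eq_0_on_span[OF lin, of B w] \<psi>B B(3) that by blast
  then show ?thesis by (intro exI[of _ \<psi>]) (simp add: \<psi>.add \<psi>.scale \<psi>)
qed

lemma (in vector_space) dim_1_multiple: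
  assumes "dim S = 1" and e: "e \<in> S" "e \<noteq> 0" and x: "x \<in> S"
  obtains a where "x = scale a e"
proof -
  obtain B where B: "S \<subseteq> span B" "card B = 1" using basis_exists[of S] assms(1) by metis
  then obtain b where "B = {b}" by (auto simp: card_1_singleton_iff)
  then have "S \<subseteq> range (\<lambda>k. scale k b)" using B(1) by (simp add: span_singleton)
  then obtain c d where c: "e = scale c b" and d: "x = scale d b"
    using e(1) x by blast
  have "c \<noteq> 0" using c e by auto
  then have "x = scale (d / c) e" using c d by simp
  then show thesis by (rule that)
qed

section \<open>The pairing decides between the two triangles\<close>

context cy2_category
begin

lemma form_nondegenerate_right:
  assumes h: "h \<in> Hom Y (\<Sigma>\<^sub>0 X)" and X: "X \<in> Ob C" and 0: "\<And>g. g \<in> Hom X (\<Sigma>\<^sub>0 Y) \<Longrightarrow> \<Phi> X Y g h = 0"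
  shows "h = 0"
proof (rule ccontr)
  assume "h \<noteq> 0"
  then obtain \<psi> where \<psi>: "\<forall>y z. \<psi> (y + z) = \<psi> y + \<psi> z" "\<forall>a y. \<psi> (scale C a y) = a * \<psi> y" "\<psi> h = 1"
    using separating_functional[OF subspace_single_0, of h] by auto
  obtain g where "g \<in> Hom X (\<Sigma>\<^sub>0 Y)" "\<forall>h \<in> Hom Y (\<Sigma>\<^sub>0 X). \<Phi> X Y g h = \<psi> h"
    using form_represents[OF X Hom_dom[OF h], of \<psi>] \<psi>(1,2) by blast
  then show False using 0 h \<psi>(3) by force
qed

text \<open>If both conditions held, \<epsilon> and \<epsilon>' would pair to 0, against
  nondegeneracy. If the one for \<Delta>' fails, a separating functional is represented by arrows
  that, once rescaled, give the lifting for \<Delta>.\<close>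

lemma dichotomy:
  assumes \<Delta>: "pair_over_triangle C \<Phi> T M B L U V i p \<epsilon> iU iV"
    and \<Delta>': "pair_over_triangle C \<Phi> T L B' M V U i' p' \<epsilon>' iV iU"
    and \<epsilon>_spans: "\<And>\<eta>. \<eta> \<in> Hom L (\<Sigma>\<^sub>0 M) \<Longrightarrow> \<exists>a. \<eta> = scale C a \<epsilon>" and \<epsilon>'_nonzero: "\<epsilon>' \<noteq> 0"
  shows "condition_iii C T M B L i p \<epsilon> U V iU iV \<longleftrightarrow> \<not> condition_ii C T L B' M i' p' \<epsilon>' V U iV iU"
proof -
  interpret \<Delta>: pair_over_triangle C \<Phi> T M B L U V i p \<epsilon> iU iV by (rule \<Delta>)
  interpret \<Delta>': pair_over_triangle C \<Phi> T L B' M V U i' p' \<epsilon>' iV iU by (rule \<Delta>')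
  note T = \<Delta>.T and \<Sigma>T = \<Delta>.\<Sigma>T and iU = \<Delta>.iU and iV = \<Delta>.iV and \<epsilon> = \<Delta>.\<epsilon> and \<epsilon>' = \<Delta>'.\<epsilon> and Obs = \<Delta>.Obs
  note siU = susp_Hom[OF iU] and siV = susp_Hom[OF iV]
  have excl: "\<not> \<Delta>'.lifting e \<phi>'" if l: "\<Delta>.lifting (\<phi> \<cdot> iV) \<phi>" for e \<phi> \<phi>'
  proof
    assume l': "\<Delta>'.lifting e \<phi>'"
    have \<phi>: "\<phi> \<in> Hom L (\<Sigma>\<^sub>0 U)" and eq: "\<epsilon> \<cdot> iV = \<Sigma> iU \<cdot> (\<phi> \<cdot> iV)" and g\<phi>: "ghost T V (\<phi> \<cdot> iV)"
      and gz: "ghost (\<Sigma>\<^sub>0 T) L (\<Sigma> iU \<cdot> \<phi> - \<epsilon>)"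
      using l by (auto simp: \<Delta>.lifting_def)
    have e: "e \<in> Hom U (\<Sigma>\<^sub>0 V)" and \<phi>': "\<phi>' \<in> Hom M (\<Sigma>\<^sub>0 V)" and eq': "\<epsilon>' \<cdot> iU = \<Sigma> iV \<cdot> e"
      and ge: "ghost T U e" and gh: "ghost (\<Sigma>\<^sub>0 T) M (\<Sigma> iV \<cdot> \<phi>' - \<epsilon>')"
      using l' by (auto simp: \<Delta>'.lifting_def)
    define z where "z = \<Sigma> iU \<cdot> \<phi> - \<epsilon>"
    define h where "h = \<Sigma> iV \<cdot> \<phi>' - \<epsilon>'"
    have z: "z \<in> Hom L (\<Sigma>\<^sub>0 M)" unfolding z_def by (rule Hom_diff[OF Hom_cmp[OF siU \<phi>] \<epsilon>])
    have h: "h \<in> Hom M (\<Sigma>\<^sub>0 L)" unfolding h_def by (rule Hom_diff[OF Hom_cmp[OF siV \<phi>'] \<epsilon>'])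
    \<comment> \<open>Here the equation of condition (iii) is used: \<open>e\<close> is
      \<open>\<phi> \<cdot> iV\<close>, so \<open>z\<close> vanishes on \<open>iV\<close> and is
      orthogonal to everything passing through \<Sigma> iV.\<close>
    have "z \<cdot> iV = 0"
      unfolding z_def using diff_cmp[OF Hom_cmp[OF siU \<phi>] \<epsilon> iV] assoc[OF siU \<phi> iV] eq by simp
    then have "\<Phi> L M z (\<Sigma> iV \<cdot> \<phi>') = 0"
      using form_natural_left[OF z Obs(3) iV \<phi>'] form_zero_left[OF Obs(2) \<phi>'] by simp
    moreover have "\<Phi> L M z h = 0"
      using ghost_orthogonal[OF \<Sigma>T Obs(3) z _ h] gz gh by (simp add: z_def h_def)
    moreover have "\<Sigma> iV \<cdot> \<phi>' = h + \<epsilon>'" by (simp add: h_def)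
    ultimately have "\<Phi> L M z \<epsilon>' = 0" using form_add_right[OF z h \<epsilon>'] by simp
    \<comment> \<open>Transposing \<open>iU\<close> and then \<open>iV\<close> turns this into the
      pairing of the ghosts \<open>\<phi> \<cdot> iV\<close> and \<open>e\<close>.\<close>
    moreover have "\<Phi> L M (\<Sigma> iU \<cdot> \<phi>) \<epsilon>' = 0"
      using form_natural_right[OF \<phi> iU \<epsilon>'] eq' form_natural_left[OF \<phi> Obs(1) iV e]
        ghost_orthogonal[OF T Obs(1) Hom_cmp[OF \<phi> iV] g\<phi> e ge] by simp
    ultimately have "\<Phi> L M \<epsilon> \<epsilon>' = 0"
      unfolding z_def using form_diff_left[OF Hom_cmp[OF siU \<phi>] \<epsilon> \<epsilon>'] by simp
    \<comment> \<open>Since \<epsilon> spans, orthogonality to \<epsilon> makes \<epsilon>'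
      orthogonal to all of C(L, \<Sigma> M).\<close>
    then have "\<Phi> L M \<eta> \<epsilon>' = 0" if "\<eta> \<in> Hom L (\<Sigma>\<^sub>0 M)" for \<eta>
      using \<epsilon>_spans[OF that] form_scale_left[of L M \<epsilon> \<epsilon>'] \<epsilon> \<epsilon>' by (auto simp: Hom_def)
    then show False
      using form_nondegenerate_right[OF \<epsilon>' Obs(5)] \<epsilon>'_nonzero by blast
  qed
  have exh: "\<exists>\<phi>. \<Delta>.lifting (\<phi> \<cdot> iV) \<phi>" if none: "\<nexists>e \<phi>'. \<Delta>'.lifting e \<phi>'"
  proof -
    interpret prod: vector_space "\<lambda>a (x :: 'm \<times> 'm). (scale C a (fst x), scale C a (snd x))"
      by standard (auto simp: scale_right_distrib scale_left_distrib prod_eq_iff)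
    have zOb: "0 \<in> Hom U (\<Sigma>\<^sub>0 V)" "0 \<in> Hom M (\<Sigma>\<^sub>0 V)" "0 \<in> Hom M (\<Sigma>\<^sub>0 L)"
      using Hom_zero susp_Ob Obs by auto
    text \<open>
      \<open>W\<close> is the image of the transpose, under the Calabi--Yau pairing, of the linear map that sends
      \<open>(\<phi>, \<eta>)\<close> to the classes of \<open>\<phi> \<cdot> iV\<close>, \<open>\<Sigma> iU \<cdot> \<phi> \<cdot> iV - \<eta> \<cdot> iV\<close> and \<open>\<Sigma> iU \<cdot> \<phi> - \<eta>\<close> modulo ghosts.
    \<close>
    define W where "W = {(\<Sigma> iV \<cdot> e + (\<Sigma> iV \<cdot> g + h) \<cdot> iU, - (\<Sigma> iV \<cdot> g + h)) | e g h.
      e \<in> Hom U (\<Sigma>\<^sub>0 V) \<and> ghost T U e \<and> g \<in> Hom M (\<Sigma>\<^sub>0 V) \<and> h \<in> Hom M (\<Sigma>\<^sub>0 L) \<and> ghost (\<Sigma>\<^sub>0 T) M h}"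
    have WI: "(\<Sigma> iV \<cdot> e + (\<Sigma> iV \<cdot> g + h) \<cdot> iU, - (\<Sigma> iV \<cdot> g + h)) \<in> W"
      if "e \<in> Hom U (\<Sigma>\<^sub>0 V)" "ghost T U e" "g \<in> Hom M (\<Sigma>\<^sub>0 V)" "h \<in> Hom M (\<Sigma>\<^sub>0 L)" "ghost (\<Sigma>\<^sub>0 T) M h"
      for e g h
      using that W_def by blast
    have ghost_0: "ghost S X 0" for S X
      using zero_cmp by (auto simp: ghost_def)
    have ghost_add: "ghost S X (f + g)" if "f \<in> Hom X Y" "g \<in> Hom X Y" "ghost S X f" "ghost S X g" for S X Y f g
      using that distrib_left_cmp[OF that(1,2)] by (simp add: ghost_def)
    have ghost_scale: "ghost S X (scale C a f)" if "f \<in> Hom X Y" "ghost S X f" for S X Y a f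
      using that scale_left_cmp[OF that(1)] by (simp add: ghost_def)
    have "prod.subspace W"
    proof (rule prod.subspaceI)
      have "(0 :: 'm \<times> 'm) = (\<Sigma> iV \<cdot> 0 + (\<Sigma> iV \<cdot> 0 + 0) \<cdot> iU, - (\<Sigma> iV \<cdot> 0 + 0))"
        using cmp_zero[OF siV] zero_cmp[OF iU] by (simp add: zero_prod_def)
      then show "0 \<in> W" using WI[OF zOb(1) ghost_0 zOb(2,3) ghost_0] by simp
    next
      fix x y assume "x \<in> W" "y \<in> W"
      then obtain e g h e' g' h' where *: "e \<in> Hom U (\<Sigma>\<^sub>0 V)" "ghost T U e" "g \<in> Hom M (\<Sigma>\<^sub>0 V)"
          "h \<in> Hom M (\<Sigma>\<^sub>0 L)" "ghost (\<Sigma>\<^sub>0 T) M h"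
          "x = (\<Sigma> iV \<cdot> e + (\<Sigma> iV \<cdot> g + h) \<cdot> iU, - (\<Sigma> iV \<cdot> g + h))"
        and b: "e' \<in> Hom U (\<Sigma>\<^sub>0 V)" "ghost T U e'" "g' \<in> Hom M (\<Sigma>\<^sub>0 V)"
          "h' \<in> Hom M (\<Sigma>\<^sub>0 L)" "ghost (\<Sigma>\<^sub>0 T) M h'"
          "y = (\<Sigma> iV \<cdot> e' + (\<Sigma> iV \<cdot> g' + h') \<cdot> iU, - (\<Sigma> iV \<cdot> g' + h'))"
        unfolding W_def by blast
      have "\<Sigma> iV \<cdot> (g + g') + (h + h') = (\<Sigma> iV \<cdot> g + h) + (\<Sigma> iV \<cdot> g' + h')"
        using distrib_right_cmp[OF siV *(3) b(3)] by (simp add: algebra_simps)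
      then have "x + y = (\<Sigma> iV \<cdot> (e + e') + (\<Sigma> iV \<cdot> (g + g') + (h + h')) \<cdot> iU,
          - (\<Sigma> iV \<cdot> (g + g') + (h + h')))"
        using *(6) b(6) distrib_right_cmp[OF siV *(1) b(1)]
          distrib_left_cmp[OF Hom_add[OF Hom_cmp[OF siV *(3)] *(4)] Hom_add[OF Hom_cmp[OF siV b(3)] b(4)] iU]
        by (simp add: algebra_simps)
      then show "x + y \<in> W"
        using WI[OF Hom_add[OF *(1) b(1)] ghost_add[OF *(1) b(1) *(2) b(2)] Hom_add[OF *(3) b(3)]
            Hom_add[OF *(4) b(4)] ghost_add[OF *(4) b(4) *(5) b(5)]] by simp
    next
      fix a x assume "x \<in> W"
      then obtain e g h where *: "e \<in> Hom U (\<Sigma>\<^sub>0 V)" "ghost T U e" "g \<in> Hom M (\<Sigma>\<^sub>0 V)"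
          "h \<in> Hom M (\<Sigma>\<^sub>0 L)" "ghost (\<Sigma>\<^sub>0 T) M h"
          "x = (\<Sigma> iV \<cdot> e + (\<Sigma> iV \<cdot> g + h) \<cdot> iU, - (\<Sigma> iV \<cdot> g + h))"
        unfolding W_def by blast
      have "\<Sigma> iV \<cdot> scale C a g + scale C a h = scale C a (\<Sigma> iV \<cdot> g + h)"
        using scale_right_cmp[OF siV *(3)] by (simp add: scale_right_distrib)
      then have "(scale C a (fst x), scale C a (snd x)) =
          (\<Sigma> iV \<cdot> scale C a e + (\<Sigma> iV \<cdot> scale C a g + scale C a h) \<cdot> iU,
           - (\<Sigma> iV \<cdot> scale C a g + scale C a h))"
        using *(6) scale_right_cmp[OF siV *(1)] scale_left_cmp[OF Hom_add[OF Hom_cmp[OF siV *(3)] *(4)] iU]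
        by (simp add: scale_right_distrib scale_right_diff_distrib)
      then show "(scale C a (fst x), scale C a (snd x)) \<in> W"
        using WI[OF Hom_scale[OF *(1)] ghost_scale[OF *(1,2)] Hom_scale[OF *(3)] Hom_scale[OF *(4)]
            ghost_scale[OF *(4,5)]] by simp
    qed
    \<comment> \<open>Second coordinate \<epsilon>' forces \<open>\<Sigma> iV \<cdot> g + h\<close>
      to be - \<epsilon>', and then first coordinate 0 reads
      \<open>\<epsilon>' \<cdot> iU = \<Sigma> iV \<cdot> e\<close>. So \<open>e\<close> and - g
      would be a lifting for \<Delta>'.\<close>
    moreover have "(0, \<epsilon>') \<notin> W"
    proof
      assume "(0, \<epsilon>') \<in> W"
      then obtain e g h where e: "e \<in> Hom U (\<Sigma>\<^sub>0 V)" "ghost T U e" and g: "g \<in> Hom M (\<Sigma>\<^sub>0 V)"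
        and h: "h \<in> Hom M (\<Sigma>\<^sub>0 L)" "ghost (\<Sigma>\<^sub>0 T) M h"
        and 1: "0 = \<Sigma> iV \<cdot> e + (\<Sigma> iV \<cdot> g + h) \<cdot> iU" and 2: "\<epsilon>' = - (\<Sigma> iV \<cdot> g + h)"
        unfolding W_def by blast
      have "\<Sigma> iV \<cdot> g + h = - \<epsilon>'" using 2 by simp
      then have "\<epsilon>' \<cdot> iU = \<Sigma> iV \<cdot> e" using 1 uminus_cmp[OF \<epsilon>' iU] by simp
      moreover have "\<Sigma> iV \<cdot> (- g) - \<epsilon>' = h" using 2 cmp_uminus[OF siV g] by simp
      ultimately have "\<Delta>'.lifting e (- g)"
        unfolding \<Delta>'.lifting_def using e h Hom_uminus[OF g] by simp
      then show False using none by blast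
    qed
    ultimately obtain \<psi> :: "'m \<times> 'm \<Rightarrow> 'k" where add: "\<forall>y z. \<psi> (y + z) = \<psi> y + \<psi> z"
      and scale: "\<forall>a x. \<psi> (scale C a (fst x), scale C a (snd x)) = a * \<psi> x"
      and \<psi>W: "\<forall>w \<in> W. \<psi> w = 0" and \<psi>\<epsilon>': "\<psi> (0, \<epsilon>') = 1"
      using prod.separating_functional[of W "(0, \<epsilon>')"] by blast
    have add1: "\<psi> (x + y, 0) = \<psi> (x, 0) + \<psi> (y, 0)" and add2: "\<psi> (0, x + y) = \<psi> (0, x) + \<psi> (0, y)" for x y
      using add[rule_format, of "(x, 0)" "(y, 0)"] add[rule_format, of "(0, x)" "(0, y)"] by simp_all
    have scale1: "\<psi> (scale C a x, 0) = a * \<psi> (x, 0)" and scale2: "\<psi> (0, scale C a x) = a * \<psi> (0, x)" for a x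
      using scale[rule_format, of a "(x, 0)"] scale[rule_format, of a "(0, x)"] by simp_all
    \<comment> \<open>The two coordinates of the functional are represented separately, giving
      \<phi> and the provisional substitute \<eta> for \<epsilon>.\<close>
    obtain \<phi> where \<phi>: "\<phi> \<in> Hom L (\<Sigma>\<^sub>0 U)" and \<Phi>\<phi>: "\<forall>x \<in> Hom U (\<Sigma>\<^sub>0 L). \<Phi> L U \<phi> x = \<psi> (x, 0)"
      using form_represents[OF Obs(5,1), of "\<lambda>x. \<psi> (x, 0)"] add1 scale1 by blast
    obtain \<eta> where \<eta>: "\<eta> \<in> Hom L (\<Sigma>\<^sub>0 M)" and \<Phi>\<eta>: "\<forall>x \<in> Hom M (\<Sigma>\<^sub>0 L). \<Phi> L M \<eta> x = \<psi> (0, x)"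
      using form_represents[OF Obs(5,3), of "\<lambda>x. \<psi> (0, x)"] add2 scale2 by blast
    have split: "\<Phi> L U \<phi> x + \<Phi> L M \<eta> y = 0"
      if "(x, y) \<in> W" "x \<in> Hom U (\<Sigma>\<^sub>0 L)" "y \<in> Hom M (\<Sigma>\<^sub>0 L)" for x y
      using \<psi>W that add[rule_format, of "(x, 0)" "(0, y)"] \<Phi>\<phi> \<Phi>\<eta> by simp
    define z where "z = \<Sigma> iU \<cdot> \<phi> - \<eta>"
    have z: "z \<in> Hom L (\<Sigma>\<^sub>0 M)" unfolding z_def by (rule Hom_diff[OF Hom_cmp[OF siU \<phi>] \<eta>])
    \<comment> \<open>This explains the shape of \<open>W\<close>: its elements
      \<open>(y \<cdot> iU, - y)\<close> test exactly
      \<open>\<Sigma> iU \<cdot> \<phi> - \<eta>\<close> against \<open>y\<close>.\<close>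
    have z_form: "\<Phi> L M z y = \<Phi> L U \<phi> (y \<cdot> iU) + \<Phi> L M \<eta> (- y)" if y: "y \<in> Hom M (\<Sigma>\<^sub>0 L)" for y
      unfolding z_def using form_diff_left[OF Hom_cmp[OF siU \<phi>] \<eta> y] form_natural_right[OF \<phi> iU y]
        form_uminus_right[OF \<eta> y] by simp
    \<comment> \<open>Taking only one of \<open>e\<close>, \<open>h\<close> and \<open>g\<close>
      nonzero in \<open>W\<close> gives, in turn, the three facts \<open>g1\<close>,
      \<open>g2\<close> and \<open>ziV\<close>.\<close>
    have g1: "ghost T V (\<phi> \<cdot> iV)"
    proof (rule ghost_if_orthogonal[OF T Obs(1) Hom_cmp[OF \<phi> iV]])
      fix e assume e: "e \<in> Hom U (\<Sigma>\<^sub>0 V)" "ghost T U e"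
      have "(\<Sigma> iV \<cdot> e, 0) \<in> W"
        using WI[OF e zOb(2,3) ghost_0] cmp_zero[OF siV] zero_cmp[OF iU] by simp
      then show "\<Phi> V U (\<phi> \<cdot> iV) e = 0"
        using split[OF _ Hom_cmp[OF siV e(1)] zOb(3)] form_zero_right[OF \<eta> Obs(3)]
          form_natural_left[OF \<phi> Obs(1) iV e(1)] by simp
    qed
    have g2: "ghost (\<Sigma>\<^sub>0 T) L z"
    proof (rule ghost_if_orthogonal[OF \<Sigma>T Obs(3) z])
      fix h assume h: "h \<in> Hom M (\<Sigma>\<^sub>0 L)" "ghost (\<Sigma>\<^sub>0 T) M h"
      have "(h \<cdot> iU, - h) \<in> W"
        using WI[OF zOb(1) ghost_0 zOb(2) h] cmp_zero[OF siV] by simp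
      then show "\<Phi> L M z h = 0"
        using split[OF _ Hom_cmp[OF h(1) iU] Hom_uminus[OF h(1)]] z_form[OF h(1)] by simp
    qed
    have ziV: "z \<cdot> iV = 0"
    proof (rule form_nondegenerate[OF Hom_cmp[OF z iV] Obs(3)])
      fix g assume g: "g \<in> Hom M (\<Sigma>\<^sub>0 V)"
      note y = Hom_cmp[OF siV g]
      have "((\<Sigma> iV \<cdot> g) \<cdot> iU, - (\<Sigma> iV \<cdot> g)) \<in> W"
        using WI[OF zOb(1) ghost_0 g zOb(3) ghost_0] cmp_zero[OF siV] by simp
      then show "\<Phi> V M (z \<cdot> iV) g = 0"
        using split[OF _ Hom_cmp[OF y iU] Hom_uminus[OF y]] z_form[OF y]
          form_natural_left[OF z Obs(3) iV g] by simp
    qed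
    obtain a where a: "\<eta> = scale C a \<epsilon>" using \<epsilon>_spans[OF \<eta>] by blast
    \<comment> \<open>The normalization of the functional at (0, \<epsilon>') excludes \<eta> = 0,
      so \<phi> may be divided by \<open>a\<close> to replace \<eta> by \<epsilon>.\<close>
    have "\<Phi> L M \<eta> \<epsilon>' = 1" using \<Phi>\<eta> \<epsilon>' \<psi>\<epsilon>' by simp
    then have "a \<noteq> 0" using a form_zero_left[OF Obs(5) \<epsilon>'] by auto
    define \<phi>\<^sub>1 where "\<phi>\<^sub>1 = scale C (inverse a) \<phi>"
    have \<phi>\<^sub>1: "\<phi>\<^sub>1 \<in> Hom L (\<Sigma>\<^sub>0 U)" unfolding \<phi>\<^sub>1_def by (rule Hom_scale[OF \<phi>])
    have z\<^sub>1: "\<Sigma> iU \<cdot> \<phi>\<^sub>1 - \<epsilon> = scale C (inverse a) z"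
      unfolding \<phi>\<^sub>1_def z_def using a \<open>a \<noteq> 0\<close> scale_right_cmp[OF siU \<phi>]
      by (simp add: scale_right_diff_distrib)
    have "(\<Sigma> iU \<cdot> \<phi>\<^sub>1 - \<epsilon>) \<cdot> iV = 0"
      unfolding z\<^sub>1 using scale_left_cmp[OF z iV] ziV by simp
    then have "\<epsilon> \<cdot> iV = \<Sigma> iU \<cdot> (\<phi>\<^sub>1 \<cdot> iV)"
      using diff_cmp[OF Hom_cmp[OF siU \<phi>\<^sub>1] \<epsilon> iV] assoc[OF siU \<phi>\<^sub>1 iV] by simp
    moreover have "ghost T V (\<phi>\<^sub>1 \<cdot> iV)"
      unfolding \<phi>\<^sub>1_def scale_left_cmp[OF \<phi> iV] by (rule ghost_scale[OF Hom_cmp[OF \<phi> iV] g1])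
    moreover have "ghost (\<Sigma>\<^sub>0 T) L (\<Sigma> iU \<cdot> \<phi>\<^sub>1 - \<epsilon>)"
      unfolding z\<^sub>1 by (rule ghost_scale[OF z g2])
    ultimately have "\<Delta>.lifting (\<phi>\<^sub>1 \<cdot> iV) \<phi>\<^sub>1"
      unfolding \<Delta>.lifting_def using \<phi>\<^sub>1 Hom_cmp[OF \<phi>\<^sub>1 iV] by simp
    then show ?thesis by blast
  qed
  show ?thesis using excl exh unfolding \<Delta>.condition_iii_iff \<Delta>'.condition_ii_iff by blast
qed

end

theorem proposition4p3:
  fixes C :: "('k::alg_closed_field, 'o, 'm::ab_group_add) triangulated_data"
    and T L M B B' U V :: 'o
    and i p \<epsilon> i' p' \<epsilon>' iU iV :: 'm
  assumes "triangulated_category C"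
    and "hom_finite C"
    and "calabi_yau_2 C"
    and "split_idempotents C"
    and "cluster_tilting C T"
    and "L \<in> Ob C" and "M \<in> Ob C"
    and "vector_space.dim (scale C) (hom C L (susp_ob C M)) = 1"
    and "tri C M B L i p \<epsilon>" and "\<not> split_triangle C M B L i p \<epsilon>"
    and "tri C L B' M i' p' \<epsilon>'" and "\<not> split_triangle C L B' M i' p' \<epsilon>'"
    and "U \<in> Ob C" and "iU \<in> hom C U M" and "F_mono C T U iU"
    and "V \<in> Ob C" and "iV \<in> hom C V L" and "F_mono C T V iV"
  shows "(condition_i C T M B L i p \<epsilon> U V iU iV
            \<longleftrightarrow> \<not> condition_i C T L B' M i' p' \<epsilon>' V U iV iU)
       \<and> (condition_ii C T M B L i p \<epsilon> U V iU iV
            \<longleftrightarrow> \<not> condition_ii C T L B' M i' p' \<epsilon>' V U iV iU)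
       \<and> (condition_iii C T M B L i p \<epsilon> U V iU iV
            \<longleftrightarrow> \<not> condition_iii C T L B' M i' p' \<epsilon>' V U iV iU)"
proof -
  interpret triangulated_category C by fact
  obtain \<Phi> where \<Phi>: "cy2_category C \<Phi>"
  proof -
    obtain \<Phi> where 1: "\<forall>X \<in> Ob C. \<forall>Y \<in> Ob C.
        bij_betw (\<Phi> X Y) (hom C X (susp_ob C Y)) (dual_space (scale C) (hom C Y (susp_ob C X))) \<and>
        (\<forall>g \<in> hom C X (susp_ob C Y). \<forall>h \<in> hom C Y (susp_ob C X).
           (\<forall>g' \<in> hom C X (susp_ob C Y). \<Phi> X Y (g + g') h = \<Phi> X Y g h + \<Phi> X Y g' h) \<and>
           (\<forall>a. \<Phi> X Y (scale C a g) h = a * \<Phi> X Y g h))"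
      and 2: "\<forall>X \<in> Ob C. \<forall>X' \<in> Ob C. \<forall>Y \<in> Ob C. \<forall>Y' \<in> Ob C.
        \<forall>u \<in> hom C X' X. \<forall>v \<in> hom C Y Y'.
        \<forall>g \<in> hom C X (susp_ob C Y). \<forall>h \<in> hom C Y' (susp_ob C X').
          \<Phi> X' Y' (cmp C (susp C v) (cmp C g u)) h = \<Phi> X Y g (cmp C (susp C u) (cmp C h v))"
      using \<open>calabi_yau_2 C\<close> unfolding calabi_yau_2_def by blast
    have "cy2_category C \<Phi>"
      by unfold_locales (use \<open>hom_finite C\<close> 1 2 in blast)+
    then show thesis by (rule that)
  qed
  interpret cy2_category C \<Phi> by (rule \<Phi>)
  have iU: "iU \<in> Hom U M" and iV: "iV \<in> Hom V L" using assms by (auto simp: Hom_def)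
  interpret \<Delta>: pair_over_triangle C \<Phi> T M B L U V i p \<epsilon> iU iV
    by unfold_locales (use assms iU iV in blast)+
  interpret \<Delta>': pair_over_triangle C \<Phi> T L B' M V U i' p' \<epsilon>' iV iU
    by unfold_locales (use assms iU iV in blast)+
  have nonzero: "\<epsilon> \<noteq> 0" "\<epsilon>' \<noteq> 0"
    using assms split_triangle_if_zero by blast+
  have "\<exists>a. \<eta> = scale C a \<epsilon>" if "\<eta> \<in> Hom L (\<Sigma>\<^sub>0 M)" for \<eta>
    using dim_1_multiple[OF assms(8), of \<epsilon> \<eta>] \<Delta>.\<epsilon> that nonzero by (auto simp: Hom_def)
  then have "condition_iii C T M B L i p \<epsilon> U V iU iV \<longleftrightarrow> \<not> condition_ii C T L B' M i' p' \<epsilon>' V U iV iU"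
    using dichotomy \<Delta>.pair_over_triangle_axioms \<Delta>'.pair_over_triangle_axioms nonzero by blast
  \<comment> \<open>All three claims reduce to this mixed statement once (i) and (iii) are rewritten
    to (ii) for both triangles.\<close>
  then show ?thesis
    unfolding \<Delta>.condition_i_iff_ii \<Delta>'.condition_i_iff_ii \<Delta>.condition_iii_iff_ii \<Delta>'.condition_iii_iff_ii
    by blast
qed

end
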